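(* There is a universal constant $c_1>0$ such that the following holds. Let $m>2$, suppose that the random vector $X_0\in\mathbb{R}^p$ is strongly $m$-th order isotropic with constant $\tilde C_m$ and that its components are sub-Gaussian with constant $C$, and let $M\ge1$. Then for all $t>0$, with probability at least $1-(1+n^{-m/(m-2)})\exp[-t]$, $$\frac1{c_1}\sup_{u\in\mathbb{R}^p:\ \|X_0^Tu\|_2\le1,\ \|u\|_1\le M}\Big|\|Xu\|_{2,n}^2-\|X_0^Tu\|_2^2\Big|$$ $$\le\ MC\sqrt{\frac{\big(2t+2\log(2p)+2m(\log n)/(m-2)\big)\big(\log p\,\log^3n+t\big)}{n}}$$ $$+\ M^2C^2\,\frac{\big(2t+2\log(2p)+2m(\log n)/(m-2)\big)\big(\log p\,\log^3n+t\big)}{n}\ +\ \tilde C_m^2\,\frac{\exp[-t(m-2)/m]}{n}.$$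
   Context: $X$ is an $n\times p$ random matrix whose rows are i.i.d. copies of $X_0^T$. For a real random variable $Z$, $\|Z\|_m:=(\mathbb{E}|Z|^m)^{1/m}$. For $u\in\mathbb{R}^p$, $\|u\|_1$ is the $\ell_1$-norm and $\|Xu\|_{2,n}^2:=\frac1n\sum_{i=1}^n((Xu)_i)^2$. Strong isotropy: $X_0$ is strongly $m$-th order isotropic with constant $\tilde C_m$ if for all $u\in\mathbb{R}^p$ with $\|X_0^Tu\|_2=1$ one has $\|X_0^Tu\|_m\le\tilde C_m$. Sub-Gaussian: a real random variable $Z$ is sub-Gaussian with constant $C$ if $\mathbb{E}\exp[\lambda|Z|]\le2\exp[\lambda^2C^2/2]$ for all $\lambda>0$.
   Formalization: The formal theorem assumes p ≥ 2: for p = 1 the factor log p vanishes and the stated bound fails (X_0 in {0, √a}, m = 4, t = 2/n²). Sample spaces are taken on fixed canonical types, which loses nothing since only the laws of X_0 and X matter. *)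

theory Defs
  imports "HOL-Probability.Probability"
begin

text \<open>
  The dimension \<open>p\<close> has to be quantified inside the statement, after the universal constant, so a
  vector of dimension \<open>p\<close> is a function \<open>nat \<Rightarrow> real\<close> of which only the entries \<open>j < p\<close> are used. As
  a measurable space the vectors of dimension \<open>p\<close> are the following product (its elements are
  \<open>undefined\<close> outside \<open>{..<p}\<close>).
\<close>

definition vec_space :: "nat \<Rightarrow> (nat \<Rightarrow> real) measure" where
  "vec_space p = PiM {..<p} (\<lambda>_. borel)"

definition inner_vec :: "nat \<Rightarrow> (nat \<Rightarrow> real) \<Rightarrow> (nat \<Rightarrow> real) \<Rightarrow> real" where
  "inner_vec p x u = (\<Sum>j<p. x j * u j)"

definition l1_norm :: "nat \<Rightarrow> (nat \<Rightarrow> real) \<Rightarrow> real" where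
  "l1_norm p u = (\<Sum>j<p. \<bar>u j\<bar>)"

text \<open>For an \<open>n \<times> p\<close> matrix \<open>A\<close> with rows \<open>A i\<close>, this is $\|Au\|_{2,n}^2$.\<close>

definition emp_norm_sq :: "nat \<Rightarrow> nat \<Rightarrow> (nat \<Rightarrow> nat \<Rightarrow> real) \<Rightarrow> (nat \<Rightarrow> real) \<Rightarrow> real" where
  "emp_norm_sq n p A u = (1 / real n) * (\<Sum>i<n. (inner_vec p (A i) u)\<^sup>2)"

text \<open>
  $\|Z\|_m = (E|Z|^m)^{1/m}$, with value \<open>\<top>\<close> when the moment is infinite (the Bochner integral
  would give \<open>0\<close> there).
\<close>

definition Lnorm :: "'a measure \<Rightarrow> real \<Rightarrow> ('a \<Rightarrow> real) \<Rightarrow> ennreal" where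
  "Lnorm P m Z =
     (let I = (\<integral>\<^sup>+ \<omega>. ennreal (\<bar>Z \<omega>\<bar> powr m) \<partial>P)
      in if I = \<top> then \<top> else ennreal (enn2real I powr (1 / m)))"

definition strongly_isotropic ::
  "'a measure \<Rightarrow> nat \<Rightarrow> ('a \<Rightarrow> nat \<Rightarrow> real) \<Rightarrow> real \<Rightarrow> real \<Rightarrow> bool" where
  "strongly_isotropic P p X0 m Cm \<longleftrightarrow>
     (\<forall>u. Lnorm P 2 (\<lambda>\<omega>. inner_vec p (X0 \<omega>) u) = 1 \<longrightarrow>
          Lnorm P m (\<lambda>\<omega>. inner_vec p (X0 \<omega>) u) \<le> ennreal Cm)"

definition sub_Gaussian :: "'a measure \<Rightarrow> ('a \<Rightarrow> real) \<Rightarrow> real \<Rightarrow> bool" where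
  "sub_Gaussian P Z C \<longleftrightarrow>
     (\<forall>l>0. (\<integral>\<^sup>+ \<omega>. ennreal (exp (l * \<bar>Z \<omega>\<bar>)) \<partial>P) \<le> ennreal (2 * exp (l\<^sup>2 * C\<^sup>2 / 2)))"

text \<open>
  \<open>X 0, \<dots>, X (n - 1)\<close> (on the space \<open>Q\<close>) are i.i.d. copies of \<open>X0\<close> (on the space \<open>P\<close>);
  \<open>indep_vars\<close> includes measurability of each \<open>X i\<close>.
\<close>

definition iid_copies ::
  "nat \<Rightarrow> nat \<Rightarrow> 'b measure \<Rightarrow> (nat \<Rightarrow> 'b \<Rightarrow> nat \<Rightarrow> real) \<Rightarrow>
   'a measure \<Rightarrow> ('a \<Rightarrow> nat \<Rightarrow> real) \<Rightarrow> bool" where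
  "iid_copies n p Q X P X0 \<longleftrightarrow>
     prob_space.indep_vars Q (\<lambda>_. vec_space p) X {..<n} \<and>
     (\<forall>i<n. distr Q (vec_space p) (X i) = distr P (vec_space p) X0)"

text \<open>
  In \<open>sup_deviation\<close> the vector \<open>u = 0\<close> is admissible and the \<open>\<ell>\<^sub>1\<close>-constraint bounds the entries of
  \<open>u\<close>, so the real supremum is over a nonempty set that is bounded above. On that set
  \<open>Lnorm P 2 (\<dots>) \<le> 1\<close> is finite, so \<open>enn2real\<close> loses nothing.
\<close>

definition sup_deviation ::
  "nat \<Rightarrow> nat \<Rightarrow> (nat \<Rightarrow> nat \<Rightarrow> real) \<Rightarrow> 'a measure \<Rightarrow> ('a \<Rightarrow> nat \<Rightarrow> real) \<Rightarrow> real \<Rightarrow> real" where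
  "sup_deviation n p A P X0 M =
     (SUP u \<in> {u. Lnorm P 2 (\<lambda>\<omega>. inner_vec p (X0 \<omega>) u) \<le> 1 \<and> l1_norm p u \<le> M}.
        \<bar>emp_norm_sq n p A u - (enn2real (Lnorm P 2 (\<lambda>\<omega>. inner_vec p (X0 \<omega>) u)))\<^sup>2\<bar>)"

text \<open>
  Sample spaces. A constant chosen before a sample space whose type is a type variable could depend
  on that type. To keep the constant universal, the theorem quantifies over sample spaces of the
  canonical types \<open>nat \<Rightarrow> real\<close> (for \<open>X0\<close>) and \<open>nat \<Rightarrow> nat \<Rightarrow> real\<close> (for the matrix). Nothing is
  lost: hypotheses and conclusion depend only on the laws of \<open>X0\<close> and \<open>X\<close>, and random vectors and
  matrices on any other space are realised, with the same laws, by coordinate maps on these types.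
\<close>

text \<open>
  The theorem assumes \<open>p \<ge> 2\<close>, implicit in the factor \<open>ln p\<close>: for \<open>p = 1\<close> that factor vanishes and
  the bound fails (take \<open>X0\<close> with values in \<open>{0, sqrt a}\<close>, \<open>a\<close> large, \<open>n / a - 1/2\<close> a large integer and
  \<open>t = 2 / n\<^sup>2\<close>, \<open>m = 4\<close>, where \<open>sqrt a\<close> has probability \<open>1 / a\<close>).
\<close>

end

(* Symmetrisation with a ghost sample reduces the supremum of |P_n f - P f| over f_u(x) = <x, u>^2 to
   sign averages conditional on the rows. Those are bounded by chaining, with nets of averages of
   extreme points of the l1-ball (Maurey) that are small in the maximum over the rows. The chaining bound
   has the form const * M * K * sqrt(S / n), where K is the largest entry and S the supremum of
   P_n f + P_n' f; since S is at most 2 plus the two deviations, the bound controls itself. *)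

theory Submission
  imports Defs
begin

section \<open>Random signs\<close>

text \<open>A net that is accurate to \<open>M * K / 2 ^ k\<close> in all n rows at once needs
  averages of about \<open>4 ^ k * ln n\<close> points out of \<open>2 * p + 1\<close>. Its
  log-cardinality thus grows like \<open>4 ^ k\<close> while the links shrink like
  \<open>2 ^ k\<close>: all levels cost the same, and about log n of them are needed. After
  squaring, the levels contribute (log n)^2 and the nets log n * log p, which is the factor log p *
  log^3 n.

  The tail bound uses no concentration inequality for suprema. The ghost deviation is at most twice
  its mean with probability at least 1/2, independently of the sample, so restricting to that event
  costs a factor 2. The resulting \<open>6 * exp (- t)\<close> becomes \<open>exp (- t)\<close> on
  replacing t by \<open>t + ln 6\<close>, which the constant absorbs for n >= 2. For n = 1 the
  factor log n vanishes and gives no slack: there the claim is void for small t, and for large t the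
  largest entry alone suffices.

  Signs range over the subsets of \<open>{..<n}\<close> and their averages are finite sums, so no
  sign space has to be added to the product measure.\<close>

lemma cosh_le_exp_square: "cosh x \<le> exp (x\<^sup>2 / 2)" for x :: real
proof -
  have fact_le: "2 ^ n * fact n \<le> (fact (2 * n) :: real)" for n
  proof (induction n)
    case (Suc n)
    have "2 ^ Suc n * fact (Suc n) = (2 * real (Suc n)) * (2 ^ n * fact n)"
      by (simp add: algebra_simps)
    also have "\<dots> \<le> (2 * real (Suc n)) * (real (2 * n + 1) * fact (2 * n))"
      by (intro mult_left_mono order.trans[OF Suc]) (auto simp: mult_le_cancel_right1)
    also have "\<dots> = fact (2 * Suc n)"
      by (simp add: algebra_simps)
    finally show ?case .
  qed simp
  have "(\<lambda>n. if even n then x ^ n /\<^sub>R fact n else 0) sums cosh x"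
    by (rule cosh_converges)
  then have "(\<lambda>n. x ^ (2 * n) / fact (2 * n)) sums cosh x"
    by (subst (asm) sums_mono_reindex[of "\<lambda>n. 2 * n", symmetric])
       (auto simp: strict_mono_def field_simps elim!: evenE)
  moreover have "(\<lambda>n. (x\<^sup>2 / 2) ^ n /\<^sub>R fact n) sums exp (x\<^sup>2 / 2)"
    by (rule exp_converges)
  moreover have "x ^ (2 * n) / fact (2 * n) \<le> (x\<^sup>2 / 2) ^ n /\<^sub>R fact n" for n
  proof -
    have "x ^ (2 * n) / fact (2 * n) \<le> x ^ (2 * n) / (2 ^ n * fact n)"
      using fact_le[of n] by (intro divide_left_mono) (auto simp: power_mult)
    also have "\<dots> = (x\<^sup>2 / 2) ^ n /\<^sub>R fact n"
      by (simp only: power_mult[of x 2 n] power_divide) (simp add: divide_inverse mult.commute)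
    finally show ?thesis .
  qed
  ultimately show ?thesis
    by (rule sums_le[rotated 1])
qed

text \<open>A sign vector is encoded by the set \<open>s\<close> of the indices that carry the sign \<open>+1\<close>.\<close>

definition sign_sum :: "nat \<Rightarrow> (nat \<Rightarrow> real) \<Rightarrow> nat set \<Rightarrow> real" where
  "sign_sum n c s = (\<Sum>i<n. (if i \<in> s then 1 else - 1) * c i)"

lemma sign_sum_diff: "sign_sum n (\<lambda>i. c i - d i) s = sign_sum n c s - sign_sum n d s"
  by (simp add: sign_sum_def sum_subtractf right_diff_distrib)

lemma abs_sign_sum_le: "\<bar>sign_sum n c s\<bar> \<le> (\<Sum>i<n. \<bar>c i\<bar>)"
  unfolding sign_sum_def by (rule order.trans[OF sum_abs]) (auto intro!: sum_mono)

text \<open>Expanding the product of the factors \<open>exp (c i) + exp (- c i)\<close> gives one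
  term per sign pattern, and each factor is \<open>2 * cosh (c i)\<close>. This is the moment bound
  for a Rademacher sum, left unnormalised over the \<open>2 ^ n\<close> patterns.\<close>

lemma sum_exp_sign_sum:
  "(\<Sum>s\<in>Pow {..<n}. exp (sign_sum n c s)) \<le> 2 ^ n * exp ((\<Sum>i<n. (c i)\<^sup>2) / 2)"
proof -
  have "(\<Sum>s\<in>Pow {..<n}. exp (sign_sum n c s)) =
      (\<Sum>s\<in>Pow {..<n}. (\<Prod>i\<in>s. exp (c i)) * (\<Prod>i\<in>{..<n} - s. exp (- c i)))"
  proof (intro sum.cong refl)
    fix s assume s: "s \<in> Pow {..<n}"
    have "sign_sum n c s = (\<Sum>i\<in>s. c i) + (\<Sum>i\<in>{..<n} - s. - c i)"
      unfolding sign_sum_def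
      using s by (subst sum.subset_diff[of s]) (auto intro!: sum.cong)
    then show "exp (sign_sum n c s) = (\<Prod>i\<in>s. exp (c i)) * (\<Prod>i\<in>{..<n} - s. exp (- c i))"
      using s by (simp add: exp_add exp_sum finite_subset[of s])
  qed
  also have "\<dots> = (\<Prod>i<n. exp (c i) + exp (- c i))"
    by (rule prod_add[symmetric]) simp
  also have "\<dots> \<le> (\<Prod>i<n. 2 * exp ((c i)\<^sup>2 / 2))"
  proof (intro prod_mono)
    fix i show "0 \<le> exp (c i) + exp (- c i) \<and> exp (c i) + exp (- c i) \<le> 2 * exp ((c i)\<^sup>2 / 2)"
      using cosh_le_exp_square[of "c i"] by (simp add: cosh_def add_nonneg_nonneg)
  qed
  also have "\<dots> = 2 ^ n * exp ((\<Sum>i<n. (c i)\<^sup>2) / 2)"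
    by (simp add: prod.distrib exp_sum sum_divide_distrib)
  finally show ?thesis .
qed

lemma sum_exp_abs_sign_sum:
  assumes "(\<Sum>i<n. (c i)\<^sup>2) \<le> \<sigma>\<^sup>2"
  shows "(\<Sum>s\<in>Pow {..<n}. exp (l * \<bar>sign_sum n c s\<bar>)) \<le> 2 ^ n * (2 * exp (l\<^sup>2 * \<sigma>\<^sup>2 / 2))"
proof -
  have *: "(\<Sum>s\<in>Pow {..<n}. exp (sign_sum n (\<lambda>i. k * c i) s)) \<le> 2 ^ n * exp (l\<^sup>2 * \<sigma>\<^sup>2 / 2)"
    if "k\<^sup>2 = l\<^sup>2" for k
  proof -
    have "(\<Sum>i<n. (k * c i)\<^sup>2) \<le> l\<^sup>2 * \<sigma>\<^sup>2"
      using mult_left_mono[OF assms, of "l\<^sup>2"] that by (simp add: power_mult_distrib sum_distrib_left)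
    then show ?thesis
      by (intro order.trans[OF sum_exp_sign_sum]) auto
  qed
  have "exp (l * \<bar>sign_sum n c s\<bar>)
      \<le> exp (sign_sum n (\<lambda>i. l * c i) s) + exp (sign_sum n (\<lambda>i. - l * c i) s)" for s
  proof -
    have "sign_sum n (\<lambda>i. k * c i) s = k * sign_sum n c s" for k
      by (simp add: sign_sum_def sum_distrib_left algebra_simps)
    note scale = this
    have "sign_sum n (\<lambda>i. - l * c i) s = - l * sign_sum n c s" by (rule scale)
    then show ?thesis
      unfolding scale by (cases "sign_sum n c s \<ge> 0") (auto simp: abs_if)
  qed
  then have "(\<Sum>s\<in>Pow {..<n}. exp (l * \<bar>sign_sum n c s\<bar>)) \<le>
      (\<Sum>s\<in>Pow {..<n}. exp (sign_sum n (\<lambda>i. l * c i) s)) +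
      (\<Sum>s\<in>Pow {..<n}. exp (sign_sum n (\<lambda>i. - l * c i) s))"
    by (subst sum.distrib[symmetric]) (auto intro: sum_mono)
  then show ?thesis
    using *[of l] *[of "- l"] by (simp del: mult_minus_left)
qed

text \<open>Exponential moments are summed over \<open>V\<close>; the parameter \<open>h\<close>
  pays for the size of \<open>V\<close> and for the two signs of each sum. The mean bound supplies a
  majorant \<open>Y\<close> rather than a maximum, so that the majorants of several chaining levels
  can simply be added.\<close>

lemma finite_max_sign_sum:
  fixes V :: "(nat \<Rightarrow> real) set"
  assumes V: "finite V" and card: "2 * real (card V) \<le> exp h"
    and h: "h \<ge> 0" and \<sigma>: "\<sigma> \<ge> 0" and var: "\<And>c. c \<in> V \<Longrightarrow> (\<Sum>i<n. (c i)\<^sup>2) \<le> \<sigma>\<^sup>2"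
  shows finite_max_sign_sum_mean:
      "\<exists>Y. (\<forall>s\<in>Pow {..<n}. \<forall>c\<in>V. \<bar>sign_sum n c s\<bar> \<le> Y s) \<and>
           (\<Sum>s\<in>Pow {..<n}. Y s) \<le> 2 ^ n * (\<sigma> * sqrt (2 * h))"
    and finite_max_sign_sum_tail:
      "t \<ge> 0 \<Longrightarrow> real (card {s\<in>Pow {..<n}. \<exists>c\<in>V. \<bar>sign_sum n c s\<bar> > \<sigma> * sqrt (2 * (h + t))})
         \<le> 2 ^ n * exp (- t)"
proof -
  have zero: "sign_sum n c s = 0" if "\<sigma> = 0" "c \<in> V" for c s
  proof -
    have "(\<Sum>i<n. (c i)\<^sup>2) = 0" using var[OF that(2)] that(1) by (simp add: sum_nonneg antisym)
    then have "\<forall>i<n. c i = 0" by (subst (asm) sum_nonneg_eq_0_iff) auto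
    then show ?thesis by (simp add: sign_sum_def)
  qed
  have mgf: "(\<Sum>s\<in>Pow {..<n}. \<Sum>c\<in>V. exp (l * \<bar>sign_sum n c s\<bar>)) \<le> 2 ^ n * exp (h + l\<^sup>2 * \<sigma>\<^sup>2 / 2)"
    for l
  proof -
    have "(\<Sum>s\<in>Pow {..<n}. \<Sum>c\<in>V. exp (l * \<bar>sign_sum n c s\<bar>)) =
        (\<Sum>c\<in>V. \<Sum>s\<in>Pow {..<n}. exp (l * \<bar>sign_sum n c s\<bar>))"
      by (rule sum.swap)
    also have "\<dots> \<le> (\<Sum>c\<in>V. 2 ^ n * (2 * exp (l\<^sup>2 * \<sigma>\<^sup>2 / 2)))"
      by (intro sum_mono sum_exp_abs_sign_sum var)
    also have "\<dots> = 2 ^ n * ((2 * real (card V)) * exp (l\<^sup>2 * \<sigma>\<^sup>2 / 2))"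
      by simp
    also have "\<dots> \<le> 2 ^ n * exp (h + l\<^sup>2 * \<sigma>\<^sup>2 / 2)"
      using mult_right_mono[OF card, of "exp (l\<^sup>2 * \<sigma>\<^sup>2 / 2)"] by (simp add: exp_add)
    finally show ?thesis .
  qed
  show "\<exists>Y. (\<forall>s\<in>Pow {..<n}. \<forall>c\<in>V. \<bar>sign_sum n c s\<bar> \<le> Y s) \<and>
           (\<Sum>s\<in>Pow {..<n}. Y s) \<le> 2 ^ n * (\<sigma> * sqrt (2 * h))"
  proof (cases "\<sigma> = 0 \<or> h = 0")
    case True
    have "V = {}" if "h = 0"
      using card V that by (cases "card V") auto
    with True show ?thesis
      by (intro exI[of _ "\<lambda>_. 0"]) (auto simp: zero)
  next
    case False
    with \<sigma> h have pos: "\<sigma> > 0" "h > 0" by auto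
    \<comment> \<open>Chosen so that the variance term equals \<open>h\<close>; the averaged
      exponential sum is then at most \<open>exp (2 * h)\<close>.\<close>
    define l where "l = sqrt (2 * h) / \<sigma>"
    have l: "l > 0" "l\<^sup>2 * \<sigma>\<^sup>2 / 2 = h" "l * (\<sigma> * sqrt (2 * h)) = 2 * h"
      using pos by (auto simp: l_def power_divide)
    \<comment> \<open>The tangent of the exponential at \<open>2 * h\<close>, summed over
      \<open>V\<close>. Its average is at most \<open>(2 * h - 1 + 1) / l\<close>, which is
      \<open>\<sigma> * sqrt (2 * h)\<close>.\<close>
    define Y where "Y s = (2 * h - 1 + (\<Sum>c\<in>V. exp (l * \<bar>sign_sum n c s\<bar>)) * exp (- 2 * h)) / l" for s
    have "\<bar>sign_sum n c s\<bar> \<le> Y s" if "c \<in> V" for c s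
    proof -
      have "1 + (l * \<bar>sign_sum n c s\<bar> - 2 * h) \<le> exp (l * \<bar>sign_sum n c s\<bar> - 2 * h)"
        by (rule exp_ge_add_one_self)
      also have "\<dots> = exp (l * \<bar>sign_sum n c s\<bar>) * exp (- 2 * h)"
        by (simp flip: exp_add)
      also have "\<dots> \<le> (\<Sum>c\<in>V. exp (l * \<bar>sign_sum n c s\<bar>)) * exp (- 2 * h)"
        using V that by (intro mult_right_mono member_le_sum) auto
      finally show ?thesis
        using l(1) by (simp add: Y_def field_simps)
    qed
    moreover have "(\<Sum>s\<in>Pow {..<n}. Y s) \<le> 2 ^ n * (\<sigma> * sqrt (2 * h))"
    proof -
      have "(\<Sum>s\<in>Pow {..<n}. Y s) * l = 2 ^ n * (2 * h - 1) +
          (\<Sum>s\<in>Pow {..<n}. \<Sum>c\<in>V. exp (l * \<bar>sign_sum n c s\<bar>)) * exp (- 2 * h)"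
        using l(1) by (simp add: Y_def sum.distrib sum_distrib_right card_Pow flip: sum_divide_distrib)
      also have "\<dots> \<le> 2 ^ n * (2 * h - 1) + (2 ^ n * exp (h + h)) * exp (- 2 * h)"
        using mgf[of l] l(2) by (intro add_left_mono mult_right_mono) auto
      also have "\<dots> = 2 ^ n * (2 * h)"
        by (simp add: algebra_simps flip: exp_add)
      also have "\<dots> = 2 ^ n * (\<sigma> * sqrt (2 * h)) * l"
        using l(3) by (simp add: mult.commute mult.left_commute)
      finally show ?thesis
        using l(1) by simp
    qed
    ultimately show ?thesis by (intro exI[of _ Y]) auto
  qed
  show "real (card {s\<in>Pow {..<n}. \<exists>c\<in>V. \<bar>sign_sum n c s\<bar> > \<sigma> * sqrt (2 * (h + t))})
         \<le> 2 ^ n * exp (- t)" (is "real (card ?B) \<le> _") if t: "t \<ge> 0"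
  proof (cases "\<sigma> = 0")
    case True
    then have "?B = {}" by (auto simp: zero)
    then show ?thesis by (metis card.empty exp_ge_zero of_nat_0 zero_le_mult_iff zero_le_numeral zero_le_power)
  next
    case False
    with \<sigma> have pos: "\<sigma> > 0" by auto
    \<comment> \<open>Chernoff's bound: the moment is at most \<open>exp (h + (h + t))\<close>, and
      dividing by the threshold \<open>exp (2 * (h + t))\<close> leaves
      \<open>exp (- t)\<close>.\<close>
    define l where "l = sqrt (2 * (h + t)) / \<sigma>"
    have l: "l \<ge> 0" "l\<^sup>2 * \<sigma>\<^sup>2 / 2 = h + t" "l * (\<sigma> * sqrt (2 * (h + t))) = 2 * (h + t)"
      using pos h t by (auto simp: l_def power_divide)
    have "real (card ?B) * exp (2 * (h + t)) = (\<Sum>s\<in>?B. exp (2 * (h + t)))"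
      by simp
    also have "\<dots> \<le> (\<Sum>s\<in>?B. \<Sum>c\<in>V. exp (l * \<bar>sign_sum n c s\<bar>))"
    proof (intro sum_mono)
      fix s assume "s \<in> ?B"
      then obtain c where c: "c \<in> V" "\<bar>sign_sum n c s\<bar> > \<sigma> * sqrt (2 * (h + t))" by auto
      have "exp (2 * (h + t)) \<le> exp (l * \<bar>sign_sum n c s\<bar>)"
        using c(2) l(1) by (subst l(3)[symmetric]) (auto intro: mult_left_mono)
      also have "\<dots> \<le> (\<Sum>c\<in>V. exp (l * \<bar>sign_sum n c s\<bar>))"
        using V c by (intro member_le_sum) auto
      finally show "exp (2 * (h + t)) \<le> (\<Sum>c\<in>V. exp (l * \<bar>sign_sum n c s\<bar>))" .
    qed
    also have "\<dots> \<le> (\<Sum>s\<in>Pow {..<n}. \<Sum>c\<in>V. exp (l * \<bar>sign_sum n c s\<bar>))"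
      by (intro sum_mono2) (auto intro: sum_nonneg)
    also have "\<dots> \<le> 2 ^ n * exp (h + (h + t))"
      using mgf[of l] l(2) by simp
    also have "\<dots> = 2 ^ n * exp (- t) * exp (2 * (h + t))"
        by (simp flip: exp_add mult.assoc)
    finally show ?thesis by simp
  qed
qed

section \<open>Approximation by averages of extreme points\<close>

lemma exp_le_quadratic: "exp x \<le> 1 + x + x\<^sup>2" if "\<bar>x\<bar> \<le> 1" for x :: real
proof (cases "x \<ge> 0")
  case True
  then show ?thesis using exp_bound[of x] that by simp
next
  case False
  define y where "y = - x"
  have y: "0 < y" "y \<le> 1" "x = - y" using that False by (auto simp: y_def)
  have "exp x = 1 / exp y" by (simp add: y exp_minus divide_inverse)
  also have "\<dots> \<le> 1 / (1 + y)"
    using y exp_ge_add_one_self[of y] by (intro divide_left_mono) auto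
  also have "\<dots> \<le> 1 + x + x\<^sup>2"
  proof -
    have "(1 + x + x\<^sup>2) * (1 + y) = 1 + y ^ 3"
      by (simp add: y algebra_simps power2_eq_square power3_eq_cube)
    then show ?thesis using y by (simp add: divide_le_eq)
  qed
  finally show ?thesis .
qed

text \<open>The linear term is kept apart because \<open>z * sinh x\<close> vanishes after averaging
  over a centred \<open>z\<close>; what remains is a factor of second order in
  \<open>z\<close>.\<close>

lemma cosh_add_le:
  fixes x z :: real
  assumes "\<bar>z\<bar> \<le> 1"
  shows "cosh (x + z) \<le> cosh x * (1 + z\<^sup>2) + z * sinh x"
proof -
  have "exp x * exp z \<le> exp x * (1 + z + z\<^sup>2)"
    using exp_le_quadratic[OF assms] by simp
  moreover have "exp (- x) * exp (- z) \<le> exp (- x) * (1 + (- z) + (- z)\<^sup>2)"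
    using exp_le_quadratic[of "- z"] assms by (intro mult_left_mono) auto
  ultimately have "exp (x + z) + exp (- (x + z)) \<le>
      exp x * (1 + z + z\<^sup>2) + exp (- x) * (1 + (- z) + (- z)\<^sup>2)"
    unfolding minus_add_distrib exp_add by (rule add_mono)
  also have "\<dots> = 2 * (cosh x * (1 + z\<^sup>2) + z * sinh x)"
    unfolding cosh_def sinh_def by (simp add: field_simps)
  finally show ?thesis
    by (simp add: cosh_def)
qed

text \<open>Derandomisation: a bound on the mean over a random extreme point becomes an actual
  choice of one.\<close>

lemma exists_le_weighted_sum:
  fixes f w :: "'a \<Rightarrow> real"
  assumes "finite A" "\<And>a. a \<in> A \<Longrightarrow> w a \<ge> 0" "sum w A = 1" "(\<Sum>a\<in>A. w a * f a) \<le> v"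
  shows "\<exists>a\<in>A. f a \<le> v"
proof (rule ccontr)
  assume "\<not> ?thesis"
  then have less: "v < f a" if "a \<in> A" for a using that by auto
  obtain a where a: "a \<in> A" "w a > 0"
    using assms by (metis less_eq_real_def sum.neutral zero_neq_one)
  have "(\<Sum>a\<in>A. w a * v) < (\<Sum>a\<in>A. w a * f a)"
    using assms(1) a less assms(2)
    by (intro sum_strict_mono_ex1) (auto intro!: mult_left_mono mult_strict_left_mono intro: less_imp_le)
  then show False
    using assms by (simp flip: sum_distrib_right)
qed

text \<open>The sequence is chosen greedily, keeping the potential \<open>\<Sum>i. cosh (\<lambda> y i)\<close> of the
  accumulated error \<open>y\<close> below its average over the next choice.\<close>

lemma greedy_approximation:
  fixes g :: "nat \<Rightarrow> 'a \<Rightarrow> real"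
  assumes A: "finite A" and w: "\<And>a. a \<in> A \<Longrightarrow> w a \<ge> 0" "sum w A = 1"
    and g: "\<And>i a. i < n \<Longrightarrow> a \<in> A \<Longrightarrow> \<bar>g i a\<bar> \<le> 1" and l: "0 \<le> l" "l \<le> 1 / 2"
  shows "\<exists>as. set as \<subseteq> A \<and> length as = m \<and>
    (\<Sum>i<n. cosh (l * (\<Sum>a\<leftarrow>as. g i a - (\<Sum>a\<in>A. w a * g i a)))) \<le> real n * exp (4 * l\<^sup>2 * real m)"
proof (induction m)
  case (Suc m)
  define e where "e i a = l * (g i a - (\<Sum>a\<in>A. w a * g i a))" for i a
  have avg: "\<bar>\<Sum>a\<in>A. w a * g i a\<bar> \<le> 1" if "i < n" for i
  proof -
    have "\<bar>\<Sum>a\<in>A. w a * g i a\<bar> \<le> (\<Sum>a\<in>A. w a * 1)"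
      using w g that by (intro order.trans[OF sum_abs] sum_mono) (auto simp: abs_mult mult_left_le)
    then show ?thesis using w by simp
  qed
  have e: "\<bar>e i a\<bar> \<le> 2 * l" if "i < n" "a \<in> A" for i a
  proof -
    have "\<bar>g i a - (\<Sum>a\<in>A. w a * g i a)\<bar> \<le> 2"
      using g[OF that] avg[OF that(1)] by linarith
    then show ?thesis
      using mult_left_mono[of "\<bar>g i a - (\<Sum>a\<in>A. w a * g i a)\<bar>" 2 l] l
      by (simp add: e_def abs_mult mult.commute)
  qed
  obtain as where as: "set as \<subseteq> A" "length as = m"
    "(\<Sum>i<n. cosh (\<Sum>a\<leftarrow>as. e i a)) \<le> real n * exp (4 * l\<^sup>2 * real m)"
    using Suc by (auto simp: e_def sum_list_const_mult)
  define y where "y i = (\<Sum>a\<leftarrow>as. e i a)" for i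
  \<comment> \<open>The weights centre \<open>e i\<close>, so the \<open>sinh\<close> term drops out
    and appending one more point costs every row the same factor
    \<open>exp (4 * l\<^sup>2)\<close>.\<close>
  have mean: "(\<Sum>a\<in>A. w a * cosh (y i + e i a)) \<le> cosh (y i) * exp (4 * l\<^sup>2)" if i: "i < n" for i
  proof -
    have "(\<Sum>a\<in>A. w a * cosh (y i + e i a)) \<le>
        (\<Sum>a\<in>A. w a * (cosh (y i) * (1 + (2 * l)\<^sup>2) + e i a * sinh (y i)))"
    proof (intro sum_mono mult_left_mono w)
      fix a assume a: "a \<in> A"
      have "(e i a)\<^sup>2 \<le> (2 * l)\<^sup>2"
        using power_mono[OF e[OF i a], of 2] by simp
      moreover have "\<bar>e i a\<bar> \<le> 1" using e[OF i a] l by simp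
      ultimately show "cosh (y i + e i a) \<le> cosh (y i) * (1 + (2 * l)\<^sup>2) + e i a * sinh (y i)"
        by (intro order.trans[OF cosh_add_le] add_right_mono mult_left_mono) auto
    qed
    also have "\<dots> = cosh (y i) * (1 + (2 * l)\<^sup>2) * sum w A + (\<Sum>a\<in>A. w a * e i a) * sinh (y i)"
      by (simp add: sum.distrib sum_distrib_left sum_distrib_right algebra_simps)
    also have "(\<Sum>a\<in>A. w a * e i a) = 0"
    proof -
      have "(\<Sum>a\<in>A. w a * e i a) =
          l * ((\<Sum>a\<in>A. w a * g i a) - (\<Sum>a\<in>A. w a * (\<Sum>a\<in>A. w a * g i a)))"
        unfolding sum_subtractf[symmetric] sum_distrib_left[of l] e_def
        by (intro sum.cong refl) (simp only: right_diff_distrib mult.left_commute)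
      then show ?thesis using w(2) by (simp flip: sum_distrib_right)
    qed
    also have "cosh (y i) * (1 + (2 * l)\<^sup>2) * sum w A + 0 * sinh (y i) \<le> cosh (y i) * exp (4 * l\<^sup>2)"
      using w exp_ge_add_one_self[of "4 * l\<^sup>2"] by (simp add: power_mult_distrib)
    finally show ?thesis .
  qed
  have "(\<Sum>a\<in>A. w a * (\<Sum>i<n. cosh (y i + e i a))) = (\<Sum>i<n. \<Sum>a\<in>A. w a * cosh (y i + e i a))"
    by (subst sum.swap) (simp add: sum_distrib_left)
  also have "\<dots> \<le> (\<Sum>i<n. cosh (y i) * exp (4 * l\<^sup>2))"
    using mean by (intro sum_mono) auto
  also have "\<dots> \<le> real n * exp (4 * l\<^sup>2 * real m) * exp (4 * l\<^sup>2)"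
    using as(3) by (simp flip: sum_distrib_right add: y_def)
  also have "\<dots> = real n * exp (4 * l\<^sup>2 * real (Suc m))"
    by (simp add: algebra_simps exp_add)
  finally obtain a where "a \<in> A" "(\<Sum>i<n. cosh (y i + e i a)) \<le> real n * exp (4 * l\<^sup>2 * real (Suc m))"
    using exists_le_weighted_sum[OF A w, where f = "\<lambda>a. \<Sum>i<n. cosh (y i + e i a)"] by blast
  moreover have "l * (\<Sum>a\<leftarrow>a # as. g i a - (\<Sum>a\<in>A. w a * g i a)) = y i + e i a" for i a
    by (simp add: y_def e_def sum_list_const_mult distrib_left)
  ultimately show ?case
    using as by (intro exI[of _ "a # as"]) simp
qed simp

text \<open>Maurey's empirical method in the maximum norm over the rows: averages of
  \<open>l * 4 ^ k\<close> atoms come within \<open>4 * b / 2 ^ k\<close> of every convex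
  combination, and lists of that length are few. Controlling all n rows at once costs only the
  condition that \<open>l\<close> dominates \<open>ln (2 * n)\<close>.\<close>

lemma weighted_average_net:
  fixes g :: "nat \<Rightarrow> 'a \<Rightarrow> real" and w :: "'t \<Rightarrow> 'a \<Rightarrow> real"
  assumes A: "finite A" and w: "\<And>u a. u \<in> T \<Longrightarrow> a \<in> A \<Longrightarrow> w u a \<ge> 0" "\<And>u. u \<in> T \<Longrightarrow> sum (w u) A = 1"
    and g: "\<And>i a. i < n \<Longrightarrow> a \<in> A \<Longrightarrow> \<bar>g i a\<bar> \<le> b" and b: "b > 0"
    and n: "n \<ge> 1" and l: "ln (2 * real n) \<le> real l"
  shows "\<exists>\<pi>. \<pi> \<in> T \<rightarrow> T \<and> finite (\<pi> ` T) \<and> card (\<pi> ` T) \<le> card A ^ (l * 4 ^ k) \<and>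
    (\<forall>u\<in>T. \<forall>i<n. \<bar>(\<Sum>a\<in>A. w u a * g i a) - (\<Sum>a\<in>A. w (\<pi> u) a * g i a)\<bar> \<le> 8 * b / 2 ^ k)"
proof -
  define m where "m = l * 4 ^ k"
  \<comment> \<open>With this scale \<open>4 * z\<^sup>2 * m\<close> equals \<open>l\<close>, which
    balances the growth of the potential against the allowance for \<open>ln (2 * n)\<close>. It
    also stays in the range \<open>z \<le> 1 / 2\<close> of the greedy choice.\<close>
  define z where "z = 1 / (2 * 2 ^ k :: real)"
  have z: "0 < z" "z \<le> 1 / 2" by (auto simp: z_def field_simps)
  have "0 < ln (2 * real n)" using n by simp
  then have lpos: "real l > 0" using l by linarith
  have mz: "real m * z = real l * 2 ^ k / 2"
    using power_mult_distrib[of "2::real" 2 k] by (simp add: m_def z_def)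
  define L where "L = {as. set as \<subseteq> A \<and> length as = m}"
  have "\<exists>as\<in>L. \<forall>i<n. \<bar>(\<Sum>a\<in>A. w u a * g i a) - b * ((\<Sum>a\<leftarrow>as. g i a / b) / real m)\<bar> \<le> 4 * b / 2 ^ k"
    if u: "u \<in> T" for u
  proof -
    define h where "h i = (\<Sum>a\<in>A. w u a * (g i a / b))" for i
    have "\<bar>g i a / b\<bar> \<le> 1" if "i < n" "a \<in> A" for i a
      using g[OF that] b by (simp add: abs_divide)
    then obtain as where as: "set as \<subseteq> A" "length as = m"
      "(\<Sum>i<n. cosh (z * (\<Sum>a\<leftarrow>as. g i a / b - h i))) \<le> real n * exp (4 * z\<^sup>2 * real m)"
      using greedy_approximation[OF A w(1)[OF u] w(2)[OF u], of n "\<lambda>i a. g i a / b" z m] z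
      unfolding h_def by auto
    have "\<bar>(\<Sum>a\<in>A. w u a * g i a) - b * ((\<Sum>a\<leftarrow>as. g i a / b) / real m)\<bar> \<le> 4 * b / 2 ^ k" if i: "i < n" for i
    proof -
      define y where "y = (\<Sum>a\<leftarrow>as. g i a / b - h i)"
      have y: "y = (\<Sum>a\<leftarrow>as. g i a / b) - real m * h i"
        by (simp add: y_def sum_list_subtractf sum_list_triv as(2))
      have "exp \<bar>z * y\<bar> \<le> 2 * cosh (z * y)"
        by (simp add: cosh_def abs_if)
      \<comment> \<open>A single row is bounded by the potential of all rows; together with the
        preceding factor 2 this is what costs \<open>ln (2 * n)\<close>.\<close>
      also have "cosh (z * y) \<le> (\<Sum>i<n. cosh (z * (\<Sum>a\<leftarrow>as. g i a / b - h i)))"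
        unfolding y_def using i
        by (intro member_le_sum[where f = "\<lambda>i. cosh (z * (\<Sum>a\<leftarrow>as. g i a / b - h i))"]) auto
      also note as(3)
      also have "2 * (real n * exp (4 * z\<^sup>2 * real m)) = exp (ln (2 * real n) + 4 * z\<^sup>2 * real m)"
        using n by (simp add: exp_add)
      finally have "\<bar>z * y\<bar> \<le> ln (2 * real n) + 4 * z\<^sup>2 * real m" by simp
      also have "\<dots> \<le> real l + 4 * z\<^sup>2 * real m" using l by simp
      also have "\<dots> = (4 / 2 ^ k) * (real m * z)"
        using mz by (simp add: power2_eq_square field_simps z_def)
      finally have "\<bar>y\<bar> * z \<le> (4 / 2 ^ k) * real m * z"
        using z by (simp add: abs_mult mult.commute mult.left_commute)
      then have yle: "\<bar>y\<bar> \<le> (4 / 2 ^ k) * real m"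
        by (rule mult_right_le_imp_le[OF _ z(1)])
      have m: "real m > 0" using lpos by (simp add: m_def)
      have "(\<Sum>a\<in>A. w u a * g i a) = b * h i"
        using b by (simp add: h_def sum_distrib_left)
      moreover have "b * h i - b * ((\<Sum>a\<leftarrow>as. g i a / b) / real m) = - (b / real m) * y"
        unfolding y using m by (simp add: field_simps)
      ultimately have "\<bar>(\<Sum>a\<in>A. w u a * g i a) - b * ((\<Sum>a\<leftarrow>as. g i a / b) / real m)\<bar> = b / real m * \<bar>y\<bar>"
        using b m by (simp add: abs_mult)
      also have "\<dots> \<le> b / real m * ((4 / 2 ^ k) * real m)"
        using b m yle by (intro mult_left_mono) auto
      finally show ?thesis using m by (simp add: field_simps)
    qed
    with as show ?thesis by (auto simp: L_def)
  qed
  then obtain code where code: "\<And>u. u \<in> T \<Longrightarrow> code u \<in> L"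
    "\<And>u i. u \<in> T \<Longrightarrow> i < n \<Longrightarrow>
      \<bar>(\<Sum>a\<in>A. w u a * g i a) - b * ((\<Sum>a\<leftarrow>code u. g i a / b) / real m)\<bar> \<le> 4 * b / 2 ^ k"
    by metis
  \<comment> \<open>An average of atoms need not come from a member of \<open>T\<close>, so the net
    takes one member of \<open>T\<close> for each list in use. Two members that share a list differ
    by at most twice \<open>4 * b / 2 ^ k\<close>, hence the 8.\<close>
  define rep where "rep c = (SOME v. v \<in> T \<and> code v = c)" for c
  have rep: "rep (code u) \<in> T" "code (rep (code u)) = code u" if "u \<in> T" for u
    using someI[of "\<lambda>v. v \<in> T \<and> code v = code u" u] that by (auto simp: rep_def)
  have L: "finite L" "card L = card A ^ m"
    using A unfolding L_def by (auto simp: finite_lists_length_eq card_lists_length_eq)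
  have img: "(\<lambda>u. rep (code u)) ` T \<subseteq> rep ` L" using code(1) by auto
  show ?thesis
  proof (intro exI[of _ "\<lambda>u. rep (code u)"] conjI ballI allI impI)
    show "card ((\<lambda>u. rep (code u)) ` T) \<le> card A ^ (l * 4 ^ k)"
      using card_mono[OF _ img] card_image_le[OF L(1), of rep] L by (simp add: m_def)
  next
    fix u i assume "u \<in> T" "i < n"
    then have "\<bar>(\<Sum>a\<in>A. w u a * g i a) - (\<Sum>a\<in>A. w (rep (code u)) a * g i a)\<bar> \<le> 4 * b / 2 ^ k + 4 * b / 2 ^ k"
      using code(2)[of u i] code(2)[of "rep (code u)" i] rep[of u] by simp
    then show "\<bar>(\<Sum>a\<in>A. w u a * g i a) - (\<Sum>a\<in>A. w (rep (code u)) a * g i a)\<bar> \<le> 8 * b / 2 ^ k"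
      by simp
  next
    show "finite ((\<lambda>u. rep (code u)) ` T)"
      using img L(1) by (rule finite_subset[OF _ finite_imageI])
  qed (use rep in auto)
qed

section \<open>Chaining for squares\<close>

lemma sum_abs_le_of_sum_squares:
  fixes y :: "nat \<Rightarrow> real"
  assumes "(\<Sum>i<n. (y i)\<^sup>2) \<le> real n * R\<^sup>2" "R \<ge> 0"
  shows "(\<Sum>i<n. \<bar>y i\<bar>) \<le> real n * R"
proof -
  have "(\<Sum>i<n. \<bar>y i\<bar>)\<^sup>2 \<le> real n * (\<Sum>i<n. (y i)\<^sup>2)"
    using Cauchy_Schwarz_ineq_sum[of "\<lambda>_. 1" "\<lambda>i. \<bar>y i\<bar>" "{..<n}"] by simp
  also have "\<dots> \<le> (real n * R)\<^sup>2"
    using mult_left_mono[OF assms(1), of "real n"] by (simp add: power2_eq_square algebra_simps)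
  finally show ?thesis
    using assms(2) by (simp add: power2_le_iff_abs_le sum_nonneg)
qed

lemma sum_half_powers_le: "(\<Sum>k\<le>\<kappa>. 1 / 2 ^ k) \<le> (2::real)"
proof -
  have "(\<Sum>k\<le>\<kappa>. 1 / 2 ^ k) = (2::real) - 1 / 2 ^ \<kappa>"
    by (induction \<kappa>) auto
  then show ?thesis by simp
qed

text \<open>Pays for the union bound over the levels once level \<open>k\<close> has been granted an
  additional exponent of at least \<open>4 ^ k\<close>.\<close>

lemma sum_exp_neg_4_power_le: "(\<Sum>k\<le>\<kappa>. exp (- (4 ^ k))) \<le> (1::real)"
proof -
  have "exp (- (4 ^ k)) \<le> (1 / 2 :: real) ^ Suc k" for k
  proof -
    have "real (Suc k) \<le> 4 ^ k"
      by (induction k) auto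
    then have "(2::real) ^ Suc k \<le> exp (real (Suc k))"
      using power_mono[of "2::real" "exp 1" "Suc k"] exp_ge_add_one_self[of "1::real"]
      by (simp add: exp_of_nat_mult[symmetric] del: power_Suc exp_ge_add_one_self)
    also have "\<dots> \<le> exp (4 ^ k)"
      using \<open>real (Suc k) \<le> 4 ^ k\<close> by simp
    finally show ?thesis
      by (simp add: exp_minus power_divide divide_simps del: power_Suc)
  qed
  then have "(\<Sum>k\<le>\<kappa>. exp (- (4 ^ k))) \<le> (\<Sum>k\<le>\<kappa>. (1 / 2 :: real) ^ Suc k)"
    by (intro sum_mono)
  also have "\<dots> \<le> 1"
  proof -
    have "(\<Sum>k\<le>\<kappa>. (1 / 2 :: real) ^ Suc k) = (\<Sum>k\<le>\<kappa>. 1 / 2 ^ k) / 2"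
      by (subst sum_divide_distrib) (simp add: power_divide mult.commute)
    then show ?thesis using sum_half_powers_le[of \<kappa>] by simp
  qed
  finally show ?thesis .
qed

context
  fixes y :: "nat \<Rightarrow> 't \<Rightarrow> real" and T :: "'t set" and \<pi> :: "nat \<Rightarrow> 't \<Rightarrow> 't"
    and n \<kappa> :: nat and \<beta> R H :: real
  assumes n: "n \<ge> 1" "n \<le> 4 ^ \<kappa>" and R: "R \<ge> 0" and H: "H \<ge> 1"
    and y: "\<And>u i. u \<in> T \<Longrightarrow> i < n \<Longrightarrow> \<bar>y i u\<bar> \<le> \<beta>" and \<beta>: "\<beta> \<ge> 0"
    and R_bound: "\<And>u. u \<in> T \<Longrightarrow> (\<Sum>i<n. (y i u)\<^sup>2) \<le> real n * R\<^sup>2"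
    and \<pi>: "\<And>k u. u \<in> T \<Longrightarrow> \<pi> k u \<in> T" and fin: "\<And>k. finite (\<pi> k ` T)"
    and card: "\<And>k. real (card (\<pi> k ` T)) \<le> exp (H * 4 ^ k)"
    and net: "\<And>k u i. u \<in> T \<Longrightarrow> i < n \<Longrightarrow> \<bar>y i u - y i (\<pi> k u)\<bar> \<le> \<beta> / 2 ^ k"
begin

text \<open>Links are differences of the squares, since these are what the signs multiply. At level
  0 the predecessor is the constant 0, so that no base point is needed and the first link carries
  the whole square.\<close>

definition chain_link :: "nat \<Rightarrow> 't \<Rightarrow> nat \<Rightarrow> real" where
  "chain_link k u i =
     (y i (\<pi> k u))\<^sup>2 - (case k of 0 \<Rightarrow> 0 | Suc j \<Rightarrow> (y i (\<pi> j u))\<^sup>2)"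

definition chain_scale :: "nat \<Rightarrow> real" where
  "chain_scale k = 6 * \<beta> * R * sqrt (real n) / 2 ^ k"

lemma chain_scale_nonneg: "chain_scale k \<ge> 0"
  using \<beta> R by (simp add: chain_scale_def)

text \<open>A difference of squares factors. Two net errors bound the difference by
  \<open>3 * \<beta> / 2 ^ k\<close> in every row, and the sum is bounded in quadratic mean by
  \<open>2 * R\<close>, hence the 6 in \<open>chain_scale\<close>. Only one factor is estimated in
  the maximum over the rows; the other leaves \<open>R\<close> in the bound, which later makes it
  self-bounding.\<close>

lemma chain_link_variance:
  assumes u: "u \<in> T"
  shows "(\<Sum>i<n. (chain_link k u i)\<^sup>2) \<le> (chain_scale k)\<^sup>2"
proof (cases k)
  case 0
  have "(\<Sum>i<n. (chain_link k u i)\<^sup>2) = (\<Sum>i<n. (y i (\<pi> 0 u))\<^sup>2 * (y i (\<pi> 0 u))\<^sup>2)"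
    by (simp add: chain_link_def 0 power2_eq_square)
  also have "\<dots> \<le> (\<Sum>i<n. \<beta>\<^sup>2 * (y i (\<pi> 0 u))\<^sup>2)"
    using y[OF \<pi>[OF u]] \<beta>
    by (intro sum_mono mult_right_mono) (auto simp: abs_le_square_iff[symmetric])
  also have "\<dots> \<le> \<beta>\<^sup>2 * (real n * R\<^sup>2)"
    using R_bound[OF \<pi>[OF u]] by (simp flip: sum_distrib_left add: mult_left_mono)
  also have "\<dots> \<le> (chain_scale k)\<^sup>2"
    by (simp add: chain_scale_def 0 power_mult_distrib)
  finally show ?thesis .
next
  case (Suc j)
  define v v' where "v = \<pi> (Suc j) u" and "v' = \<pi> j u"
  have v: "v \<in> T" "v' \<in> T" using \<pi> u by (auto simp: v_def v'_def)
  have close: "(y i v - y i v')\<^sup>2 \<le> (3 * \<beta> / 2 ^ k)\<^sup>2" if "i < n" for i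
  proof -
    have "\<bar>y i v - y i v'\<bar> \<le> \<beta> / 2 ^ Suc j + \<beta> / 2 ^ j"
      using net[OF u that, of "Suc j"] net[OF u that, of j] by (simp add: v_def v'_def)
    also have "\<dots> = 3 * \<beta> / 2 ^ k" by (simp add: Suc field_simps)
    finally show ?thesis using \<beta> by (simp flip: abs_le_square_iff)
  qed
  have "(\<Sum>i<n. (chain_link k u i)\<^sup>2) = (\<Sum>i<n. (y i v - y i v')\<^sup>2 * (y i v + y i v')\<^sup>2)"
  proof (intro sum.cong refl)
    fix i
    have "chain_link k u i = (y i v - y i v') * (y i v + y i v')"
      by (simp add: chain_link_def Suc v_def v'_def power2_eq_square algebra_simps)
    then show "(chain_link k u i)\<^sup>2 = (y i v - y i v')\<^sup>2 * (y i v + y i v')\<^sup>2"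
      by (simp add: power_mult_distrib)
  qed
  also have "\<dots> \<le> (\<Sum>i<n. (3 * \<beta> / 2 ^ k)\<^sup>2 * (2 * (y i v)\<^sup>2 + 2 * (y i v')\<^sup>2))"
  proof (intro sum_mono mult_mono)
    fix i assume "i \<in> {..<n}"
    then show "(y i v - y i v')\<^sup>2 \<le> (3 * \<beta> / 2 ^ k)\<^sup>2" using close by simp
    have "0 \<le> (y i v - y i v')\<^sup>2" by simp
    then show "(y i v + y i v')\<^sup>2 \<le> 2 * (y i v)\<^sup>2 + 2 * (y i v')\<^sup>2"
      unfolding power2_sum power2_diff by simp
  qed auto
  also have "\<dots> = (3 * \<beta> / 2 ^ k)\<^sup>2 * (2 * (\<Sum>i<n. (y i v)\<^sup>2) + 2 * (\<Sum>i<n. (y i v')\<^sup>2))"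
    by (simp add: sum.distrib flip: sum_distrib_left)
  also have "\<dots> \<le> (3 * \<beta> / 2 ^ k)\<^sup>2 * (4 * (real n * R\<^sup>2))"
    using R_bound[OF v(1)] R_bound[OF v(2)] by (intro mult_left_mono) auto
  also have "\<dots> = (chain_scale k)\<^sup>2"
    by (simp add: chain_scale_def power_mult_distrib power_divide)
  finally show ?thesis .
qed

lemma finite_chain_links: "finite (chain_link k ` T)"
  and card_chain_links: "2 * real (card (chain_link k ` T)) \<le> exp (3 * H * 4 ^ k)"
proof -
  \<comment> \<open>A link is determined by its two net points. At \<open>k = 0\<close> truncated
    subtraction makes the second point a copy of the first, and the case distinction ignores
    it.\<close>
  define P where "P = \<pi> k ` T \<times> \<pi> (k - 1) ` T"
  have sub: "chain_link k ` T \<subseteq>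
      (\<lambda>(v, v') i. (y i v)\<^sup>2 - (case k of 0 \<Rightarrow> 0 | Suc j \<Rightarrow> (y i v')\<^sup>2)) ` P" (is "_ \<subseteq> ?f ` P")
  proof
    fix c assume "c \<in> chain_link k ` T"
    then obtain u where u: "u \<in> T" "c = chain_link k u" by blast
    have "c = ?f (\<pi> k u, \<pi> (k - 1) u)"
      by (rule ext, cases k) (simp_all add: u(2) chain_link_def)
    moreover have "(\<pi> k u, \<pi> (k - 1) u) \<in> P"
      using u(1) by (simp add: P_def)
    ultimately show "c \<in> ?f ` P" by (rule image_eqI)
  qed
  have P: "finite P" using fin by (simp add: P_def)
  then show "finite (chain_link k ` T)"
    using sub by (rule finite_subset[rotated, OF finite_imageI])
  have "card (chain_link k ` T) \<le> card (?f ` P)"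
    using P sub by (intro card_mono finite_imageI)
  also have "\<dots> \<le> card P" using P by (rule card_image_le)
  finally have "real (card (chain_link k ` T)) \<le> real (card (\<pi> k ` T)) * real (card (\<pi> (k - 1) ` T))"
    by (simp add: P_def card_cartesian_product flip: of_nat_mult)
  also have "\<dots> \<le> exp (H * 4 ^ k) * exp (H * 4 ^ (k - 1))"
    using card by (intro mult_mono) auto
  also have "\<dots> \<le> exp (H * 4 ^ k) * exp (H * 4 ^ k)"
    using H by (simp add: power_increasing)
  \<comment> \<open>One of the three multiples of \<open>H * 4 ^ k\<close> absorbs the factor 2; the
    other two come from the pair of nets.\<close>
  finally have "2 * real (card (chain_link k ` T)) \<le> exp 1 * (exp (H * 4 ^ k) * exp (H * 4 ^ k))"
    using exp_ge_add_one_self[of "1::real"] by (intro mult_mono) auto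
  also have "\<dots> = exp (1 + 2 * (H * 4 ^ k))" by (simp flip: exp_add)
  also have "\<dots> \<le> exp (3 * H * 4 ^ k)"
    using mult_mono[OF H one_le_power[of "4::real" k]] H by simp
  finally show "2 * real (card (chain_link k ` T)) \<le> exp (3 * H * 4 ^ k)" .
qed

text \<open>Telescoping leaves the error of the finest net, which needs no cancellation between
  signs: \<open>2 ^ \<kappa>\<close> is at least \<open>sqrt n\<close>, so even the sum of absolute
  values is of the size of one chaining level.\<close>

lemma abs_sign_sum_squares_le:
  assumes u: "u \<in> T"
  shows "\<bar>sign_sum n (\<lambda>i. (y i u)\<^sup>2) s\<bar> \<le>
    (\<Sum>k\<le>\<kappa>. \<bar>sign_sum n (chain_link k u) s\<bar>) + 2 * \<beta> * R * sqrt (real n)"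
proof -
  have chain: "\<bar>sign_sum n (\<lambda>i. (y i (\<pi> k u))\<^sup>2) s\<bar> \<le> (\<Sum>j\<le>k. \<bar>sign_sum n (chain_link j u) s\<bar>)" for k
  proof (induction k)
    case (Suc k)
    have "sign_sum n (chain_link (Suc k) u) s =
        sign_sum n (\<lambda>i. (y i (\<pi> (Suc k) u))\<^sup>2) s - sign_sum n (\<lambda>i. (y i (\<pi> k u))\<^sup>2) s"
      by (simp add: chain_link_def[abs_def] sign_sum_diff)
    with Suc show ?case by simp
  qed (simp add: chain_link_def[abs_def])
  define v where "v = \<pi> \<kappa> u"
  have v: "v \<in> T" using \<pi> u by (simp add: v_def)
  have "\<bar>sign_sum n (\<lambda>i. (y i u)\<^sup>2) s - sign_sum n (\<lambda>i. (y i v)\<^sup>2) s\<bar>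
      \<le> (\<Sum>i<n. \<bar>(y i u)\<^sup>2 - (y i v)\<^sup>2\<bar>)"
    unfolding sign_sum_diff[symmetric] by (rule abs_sign_sum_le)
  also have "\<dots> \<le> (\<Sum>i<n. (\<bar>y i u\<bar> + \<bar>y i v\<bar>) * (\<beta> / 2 ^ \<kappa>))"
    unfolding square_diff_square_factored power2_eq_square abs_mult
    using net[OF u] by (intro sum_mono mult_mono) (auto simp: v_def)
  also have "\<dots> = ((\<Sum>i<n. \<bar>y i u\<bar>) + (\<Sum>i<n. \<bar>y i v\<bar>)) * (\<beta> / 2 ^ \<kappa>)"
    by (subst sum.distrib[symmetric]) (rule sum_distrib_right[symmetric])
  also have "\<dots> \<le> (real n * R + real n * R) * (\<beta> / 2 ^ \<kappa>)"
    using \<beta> by (intro mult_right_mono add_mono sum_abs_le_of_sum_squares R_bound u v R) auto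
  also have "\<dots> = 2 * \<beta> * R * (real n / 2 ^ \<kappa>)" by simp
  also have "\<dots> \<le> 2 * \<beta> * R * sqrt (real n)"
  proof (intro mult_left_mono)
    have "real n \<le> 4 ^ \<kappa>"
      using n(2) by simp
    also have "\<dots> = (2 ^ \<kappa>)\<^sup>2"
      using power_mult_distrib[of "2::real" 2 \<kappa>] by (simp add: power2_eq_square)
    finally have "real n \<le> (2 ^ \<kappa>)\<^sup>2" .
    then have "sqrt (real n) \<le> 2 ^ \<kappa>" by (rule real_le_lsqrt[rotated]) auto
    then have "sqrt (real n) * sqrt (real n) \<le> sqrt (real n) * 2 ^ \<kappa>"
      by (intro mult_left_mono) auto
    then show "real n / 2 ^ \<kappa> \<le> sqrt (real n)" by (simp add: divide_le_eq)
  qed (use \<beta> R in auto)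
  finally show ?thesis using chain[of \<kappa>] unfolding v_def by linarith
qed

text \<open>The root of the entropy grows like \<open>2 ^ k\<close> and the scale decays like
  \<open>2 ^ k\<close>, so all levels contribute equally, which gives \<open>\<kappa> + 1\<close>.
  The part with \<open>t\<close> has no such growth and sums geometrically, so \<open>sqrt t\<close>
  is not multiplied by the number of levels.\<close>

lemma chain_sum_le:
  assumes t: "t \<ge> 0"
  shows "(\<Sum>k\<le>\<kappa>. chain_scale k * sqrt (2 * (3 * H * 4 ^ k + (H * 4 ^ k + t)))) + 2 * \<beta> * R * sqrt (real n)
    \<le> 20 * \<beta> * R * sqrt (real n) * ((\<kappa> + 1) * sqrt H + sqrt t)"
proof -
  define B where "B = 6 * \<beta> * R * sqrt (real n)"
  have B: "B \<ge> 0" using \<beta> R by (simp add: B_def)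
  have root: "sqrt (2 * (3 * H * 4 ^ k + (H * 4 ^ k + t))) \<le> 3 * 2 ^ k * sqrt H + 3 / 2 * sqrt t" for k
  proof -
    have "2 * (3 * H * 4 ^ k + (H * 4 ^ k + t)) \<le> (3 * 2 ^ k * sqrt H)\<^sup>2 + (3 / 2 * sqrt t)\<^sup>2"
    proof -
      have "(3 * 2 ^ k * sqrt H)\<^sup>2 = 9 * (H * 4 ^ k)" "(3 / 2 * sqrt t)\<^sup>2 = 9 / 4 * t"
        using H t power_mult_distrib[of "2::real" 2 k]
        by (simp_all add: power_mult_distrib power2_eq_square[of "2 ^ k"] power_divide)
      moreover have "0 \<le> H * 4 ^ k" using H by simp
      moreover have "2 * (3 * H * 4 ^ k + (H * 4 ^ k + t)) = 8 * (H * 4 ^ k) + 2 * t"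
        by simp
      ultimately show ?thesis using t by linarith
    qed
    then have "sqrt (2 * (3 * H * 4 ^ k + (H * 4 ^ k + t)))
        \<le> sqrt ((3 * 2 ^ k * sqrt H)\<^sup>2 + (3 / 2 * sqrt t)\<^sup>2)"
      by (rule real_sqrt_le_mono)
    also have "\<dots> \<le> 3 * 2 ^ k * sqrt H + 3 / 2 * sqrt t"
      using H t by (intro sqrt_sum_squares_le_sum) auto
    finally show ?thesis .
  qed
  have "(\<Sum>k\<le>\<kappa>. chain_scale k * sqrt (2 * (3 * H * 4 ^ k + (H * 4 ^ k + t))))
      \<le> (\<Sum>k\<le>\<kappa>. (B / 2 ^ k) * (3 * 2 ^ k * sqrt H + 3 / 2 * sqrt t))"
    unfolding chain_scale_def B_def[symmetric] using root B by (intro sum_mono mult_left_mono) auto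
  also have "\<dots> = (\<Sum>k\<le>\<kappa>. 3 * B * sqrt H + (3 / 2 * B * sqrt t) * (1 / 2 ^ k))"
    by (intro sum.cong refl) (simp add: field_simps)
  also have "\<dots> = 3 * B * ((\<kappa> + 1) * sqrt H) + (3 / 2 * B * sqrt t) * (\<Sum>k\<le>\<kappa>. 1 / 2 ^ k)"
    by (simp add: sum.distrib sum_distrib_left)
  also have "\<dots> \<le> 3 * B * ((\<kappa> + 1) * sqrt H) + (3 / 2 * B * sqrt t) * 2"
    using B t sum_half_powers_le[of \<kappa>] by (intro add_left_mono mult_left_mono) auto
  finally have 1: "(\<Sum>k\<le>\<kappa>. chain_scale k * sqrt (2 * (3 * H * 4 ^ k + (H * 4 ^ k + t))))
      \<le> 3 * B * ((\<kappa> + 1) * sqrt H + sqrt t)"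
    by (simp add: algebra_simps)
  have "1 * 1 \<le> (\<kappa> + 1) * sqrt H"
    using H by (intro mult_mono) auto
  then have "1 \<le> (\<kappa> + 1) * sqrt H + sqrt t"
    using t by (simp add: add_increasing2)
  then have 2: "(B / 3) * 1 \<le> (B / 3) * ((\<kappa> + 1) * sqrt H + sqrt t)"
    using B by (intro mult_left_mono) auto
  have 3: "2 * \<beta> * R * sqrt (real n) = (B / 3) * 1" by (simp add: B_def)
  \<comment> \<open>With \<open>B\<close> carrying the factor 6, the links account for 18 and the
    remainder for 2.\<close>
  have 4: "20 * \<beta> * R * sqrt (real n) * x = 3 * B * x + (B / 3) * x" for x by (simp add: B_def)
  show ?thesis unfolding 3 4 using 1 2 by (rule add_mono)
qed

lemma chaining_mean:
  "\<exists>Y. (\<forall>s\<in>Pow {..<n}. \<forall>u\<in>T. \<bar>sign_sum n (\<lambda>i. (y i u)\<^sup>2) s\<bar> \<le> Y s) \<and>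
    (\<Sum>s\<in>Pow {..<n}. Y s) \<le> 2 ^ n * (20 * \<beta> * R * sqrt (real n) * ((\<kappa> + 1) * sqrt H))"
proof -
  have "\<exists>Y. (\<forall>s\<in>Pow {..<n}. \<forall>c\<in>chain_link k ` T. \<bar>sign_sum n c s\<bar> \<le> Y s) \<and>
      (\<Sum>s\<in>Pow {..<n}. Y s) \<le> 2 ^ n * (chain_scale k * sqrt (2 * (3 * H * 4 ^ k)))" for k
    using H by (intro finite_max_sign_sum_mean finite_chain_links card_chain_links chain_scale_nonneg)
      (auto intro: chain_link_variance)
  then obtain Y where Y: "\<And>k s u. s \<in> Pow {..<n} \<Longrightarrow> u \<in> T \<Longrightarrow> \<bar>sign_sum n (chain_link k u) s\<bar> \<le> Y k s"
    "\<And>k. (\<Sum>s\<in>Pow {..<n}. Y k s) \<le> 2 ^ n * (chain_scale k * sqrt (2 * (3 * H * 4 ^ k)))"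
    by (metis image_eqI)
  define Z where "Z s = (\<Sum>k\<le>\<kappa>. Y k s) + 2 * \<beta> * R * sqrt (real n)" for s
  have "\<bar>sign_sum n (\<lambda>i. (y i u)\<^sup>2) s\<bar> \<le> Z s" if "s \<in> Pow {..<n}" "u \<in> T" for s u
    unfolding Z_def using that Y(1)
    by (intro order.trans[OF abs_sign_sum_squares_le] add_right_mono sum_mono) auto
  moreover have "(\<Sum>s\<in>Pow {..<n}. Z s) \<le> 2 ^ n * (20 * \<beta> * R * sqrt (real n) * ((\<kappa> + 1) * sqrt H))"
  proof -
    have "(\<Sum>s\<in>Pow {..<n}. Z s) = (\<Sum>k\<le>\<kappa>. \<Sum>s\<in>Pow {..<n}. Y k s) + 2 ^ n * (2 * \<beta> * R * sqrt (real n))"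
      unfolding Z_def sum.distrib by (subst sum.swap) (simp add: card_Pow)
    \<comment> \<open>The exponent is enlarged by \<open>H * 4 ^ k\<close> so that the sum computed
      for the tail can be reused with \<open>t = 0\<close>.\<close>
    also have "\<dots> \<le> (\<Sum>k\<le>\<kappa>. 2 ^ n * (chain_scale k * sqrt (2 * (3 * H * 4 ^ k + (H * 4 ^ k + 0))))) +
        2 ^ n * (2 * \<beta> * R * sqrt (real n))"
      using H by (intro add_right_mono sum_mono order.trans[OF Y(2)] mult_left_mono chain_scale_nonneg)
        auto
    also have "\<dots> = 2 ^ n * ((\<Sum>k\<le>\<kappa>. chain_scale k * sqrt (2 * (3 * H * 4 ^ k + (H * 4 ^ k + 0)))) +
        2 * \<beta> * R * sqrt (real n))"
      by (simp add: sum_distrib_left distrib_left)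
    also have "\<dots> \<le> 2 ^ n * (20 * \<beta> * R * sqrt (real n) * ((\<kappa> + 1) * sqrt H + sqrt 0))"
      by (intro mult_left_mono chain_sum_le) auto
    finally show ?thesis by simp
  qed
  ultimately show ?thesis by blast
qed

text \<open>Level \<open>k\<close> works with the exponent \<open>H * 4 ^ k + t\<close>. As
  \<open>H \<ge> 1\<close>, it fails with probability at most
  \<open>exp (- t) * exp (- (4 ^ k))\<close>, and these sum to at most
  \<open>exp (- t)\<close>.\<close>

lemma chaining_tail:
  assumes t: "t \<ge> 0"
  shows "real (card {s\<in>Pow {..<n}. \<exists>u\<in>T. \<bar>sign_sum n (\<lambda>i. (y i u)\<^sup>2) s\<bar> >
      20 * \<beta> * R * sqrt (real n) * ((\<kappa> + 1) * sqrt H + sqrt t)}) \<le> 2 ^ n * exp (- t)"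
    (is "real (card ?B) \<le> _")
proof -
  define th where "th k = chain_scale k * sqrt (2 * (3 * H * 4 ^ k + (H * 4 ^ k + t)))" for k
  define E where "E k = {s\<in>Pow {..<n}. \<exists>c\<in>chain_link k ` T. \<bar>sign_sum n c s\<bar> > th k}" for k
  have E: "real (card (E k)) \<le> 2 ^ n * exp (- t) * exp (- (4 ^ k))" for k
  proof -
    have "real (card (E k)) \<le> 2 ^ n * exp (- (H * 4 ^ k + t))"
      unfolding E_def th_def using H t
      by (intro finite_max_sign_sum_tail finite_chain_links card_chain_links chain_scale_nonneg)
        (auto intro: chain_link_variance)
    also have "\<dots> \<le> 2 ^ n * (exp (- t) * exp (- (4 ^ k)))"
      using H by (simp flip: exp_add)
    finally show ?thesis by simp
  qed
  have "?B \<subseteq> (\<Union>k\<le>\<kappa>. E k)"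
  proof (rule subsetI, rule ccontr)
    fix s assume s: "s \<in> ?B" "s \<notin> (\<Union>k\<le>\<kappa>. E k)"
    then obtain u where u: "u \<in> T" "\<bar>sign_sum n (\<lambda>i. (y i u)\<^sup>2) s\<bar> >
      20 * \<beta> * R * sqrt (real n) * ((\<kappa> + 1) * sqrt H + sqrt t)" by auto
    have "\<bar>sign_sum n (chain_link k u) s\<bar> \<le> th k" if "k \<le> \<kappa>" for k
      using s that u(1) unfolding E_def by force
    then have "\<bar>sign_sum n (\<lambda>i. (y i u)\<^sup>2) s\<bar> \<le> (\<Sum>k\<le>\<kappa>. th k) + 2 * \<beta> * R * sqrt (real n)"
      by (intro order.trans[OF abs_sign_sum_squares_le[OF u(1)]] add_right_mono sum_mono) auto
    with chain_sum_le[OF t] u(2) show False unfolding th_def by simp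
  qed
  then have "card ?B \<le> card (\<Union>k\<le>\<kappa>. E k)"
    by (intro card_mono) (auto simp: E_def)
  also have "\<dots> \<le> (\<Sum>k\<le>\<kappa>. card (E k))"
    by (intro card_UN_le) auto
  finally have "real (card ?B) \<le> (\<Sum>k\<le>\<kappa>. real (card (E k)))"
    by (simp flip: of_nat_sum)
  also have "\<dots> \<le> 2 ^ n * exp (- t) * (\<Sum>k\<le>\<kappa>. exp (- (4 ^ k)))"
    unfolding sum_distrib_left by (intro sum_mono E)
  also have "\<dots> \<le> 2 ^ n * exp (- t) * 1"
    by (intro mult_left_mono sum_exp_neg_4_power_le) auto
  finally show ?thesis by simp
qed

end

section \<open>Nets of the l1-ball and sign averages over the rows of a fixed matrix\<close>

lemma l1_hull_net:
  fixes x :: "nat \<Rightarrow> nat \<Rightarrow> real"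
  assumes n: "n \<ge> 1" and p: "p \<ge> 1" and M: "M > 0" and K: "K > 0"
    and x: "\<And>i j. i < n \<Longrightarrow> j < p \<Longrightarrow> \<bar>x i j\<bar> \<le> K"
    and T: "\<And>u. u \<in> T \<Longrightarrow> l1_norm p u \<le> M" and l: "ln (2 * real n) \<le> real l"
  shows "\<exists>\<pi>. \<pi> \<in> T \<rightarrow> T \<and> finite (\<pi> ` T) \<and>
    real (card (\<pi> ` T)) \<le> exp (real l * ln (2 * real p + 1) * 4 ^ k) \<and>
    (\<forall>u\<in>T. \<forall>i<n. \<bar>inner_vec p (x i) u - inner_vec p (x i) (\<pi> u)\<bar> \<le> 8 * (M * K) / 2 ^ k)"
proof -
  \<comment> \<open>\<open>Some (j, pos)\<close> is the vertex plus or minus \<open>M\<close> times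
    the j-th unit vector. \<open>None\<close> is the origin; it takes the mass that is missing when
    \<open>u\<close> lies in the interior of the ball.\<close>
  define A where "A = insert None (Some ` ({..<p} \<times> (UNIV :: bool set)))"
  define g :: "nat \<Rightarrow> (nat \<times> bool) option \<Rightarrow> real" where
    "g i a = (case a of None \<Rightarrow> 0 | Some (j, pos) \<Rightarrow> if pos then M * x i j else - (M * x i j))" for i a
  define w :: "(nat \<Rightarrow> real) \<Rightarrow> (nat \<times> bool) option \<Rightarrow> real" where
    "w u a = (case a of None \<Rightarrow> 1 - l1_norm p u / M
      | Some (j, pos) \<Rightarrow> if pos then max (u j) 0 / M else max (- u j) 0 / M)" for u a
  have sum_A: "sum f A = f None + (\<Sum>j<p. f (Some (j, True)) + f (Some (j, False)))" for f :: "_ \<Rightarrow> real"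
  proof -
    have "sum f A = f None + sum f (Some ` ({..<p} \<times> UNIV))"
      unfolding A_def by (subst sum.insert) auto
    also have "sum f (Some ` ({..<p} \<times> UNIV)) = (\<Sum>(j, b)\<in>{..<p} \<times> UNIV. f (Some (j, b)))"
      by (subst sum.reindex) (auto simp: case_prod_unfold)
    also have "\<dots> = (\<Sum>j<p. \<Sum>b\<in>UNIV. f (Some (j, b)))"
      by (rule sum.cartesian_product[symmetric])
    also have "\<dots> = (\<Sum>j<p. f (Some (j, True)) + f (Some (j, False)))"
      by (simp add: UNIV_bool add.commute)
    finally show ?thesis .
  qed
  have A: "finite A" by (simp add: A_def)
  have card_A: "card A = 2 * p + 1"
    unfolding A_def by (subst card_insert_disjoint) (auto simp: card_image card_cartesian_product)
  have w1: "sum (w u) A = 1" for u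
  proof -
    have "max (u j) 0 / M + max (- u j) 0 / M = \<bar>u j\<bar> / M" for j
      by (simp add: max_def abs_if)
    then show ?thesis
      by (simp add: sum_A w_def l1_norm_def sum_divide_distrib)
  qed
  have inner: "(\<Sum>a\<in>A. w u a * g i a) = inner_vec p (x i) u" for u i
  proof -
    have "max (u j) 0 / M * (M * x i j) + max (- u j) 0 / M * (- (M * x i j)) = x i j * u j" for j
      using M by (simp add: max_def)
    then show ?thesis
      by (simp only: sum_A inner_vec_def w_def g_def option.case prod.case if_True if_False
          mult_zero_right add_0)
  qed
  have w0: "w u a \<ge> 0" if "u \<in> T" "a \<in> A" for u a
    using T[OF that(1)] M by (auto simp: w_def split: option.splits)
  have gb: "\<bar>g i a\<bar> \<le> M * K" if "i < n" "a \<in> A" for i a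
    using that x M K by (auto simp: A_def g_def abs_mult intro!: mult_left_mono)
  have pow: "real (card A ^ (l * 4 ^ k)) = exp (real l * ln (2 * real p + 1) * 4 ^ k)"
  proof -
    have "real (card A ^ (l * 4 ^ k)) = exp (ln (2 * real p + 1)) ^ (l * 4 ^ k)"
      by (simp add: card_A add.commute)
    also have "\<dots> = exp (real (l * 4 ^ k) * ln (2 * real p + 1))"
      by (rule exp_of_nat_mult[symmetric])
    finally show ?thesis by (simp add: mult.commute mult.left_commute)
  qed
  have "\<exists>\<pi>. \<pi> \<in> T \<rightarrow> T \<and> finite (\<pi> ` T) \<and> card (\<pi> ` T) \<le> card A ^ (l * 4 ^ k) \<and>
    (\<forall>u\<in>T. \<forall>i<n. \<bar>inner_vec p (x i) u - inner_vec p (x i) (\<pi> u)\<bar> \<le> 8 * (M * K) / 2 ^ k)"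
    unfolding inner[symmetric]
    by (rule weighted_average_net[OF A]) (use w0 w1 gb n l M K in auto)
  then show ?thesis
    unfolding pow[symmetric] of_nat_le_iff .
qed

lemma abs_inner_vec_le:
  assumes "\<And>j. j < p \<Longrightarrow> \<bar>x j\<bar> \<le> K" "l1_norm p u \<le> M" "K \<ge> 0"
  shows "\<bar>inner_vec p x u\<bar> \<le> M * K"
proof -
  have "\<bar>inner_vec p x u\<bar> \<le> (\<Sum>j<p. K * \<bar>u j\<bar>)"
    unfolding inner_vec_def using assms(1)
    by (intro order.trans[OF sum_abs] sum_mono) (auto simp: abs_mult intro!: mult_right_mono)
  also have "\<dots> = K * l1_norm p u"
    by (simp add: l1_norm_def sum_distrib_left)
  also have "\<dots> \<le> M * K"
    using assms by (simp add: mult.commute mult_left_mono)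
  finally show ?thesis .
qed

locale chaining_levels =
  fixes n p l \<kappa> :: nat
  assumes n: "n \<ge> 1" and p: "p \<ge> 1"
    and l: "ln (2 * real n) \<le> real l" "l \<ge> 1" and \<kappa>: "n \<le> 4 ^ \<kappa>"
begin

text \<open>The part of the chaining bound that does not depend on the tail parameter. With
  \<open>l\<close> and \<open>\<kappa>\<close> of order log n, its square is of order log p * log^3
  n.\<close>

definition G :: real where "G = (\<kappa> + 1) * sqrt (real l * ln (2 * real p + 1))"

lemma ln_p_ge_1: "ln (2 * real p + 1) \<ge> 1"
proof -
  have "exp 1 \<le> (3 :: real)" by (rule exp_le)
  also have "\<dots> \<le> 2 * real p + 1" using p by simp
  finally show ?thesis by (subst ln_ge_iff) (use p in auto)
qed

lemma H_ge_1: "real l * ln (2 * real p + 1) \<ge> 1"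
  using mult_mono[of 1 "real l" 1 "ln (2 * real p + 1)"] l ln_p_ge_1 by simp

lemma G_ge_1: "G \<ge> 1"
  using mult_mono[of 1 "real \<kappa> + 1" 1 "sqrt (real l * ln (2 * real p + 1))"] H_ge_1
  by (simp add: G_def add.commute)

lemma
  fixes x :: "nat \<Rightarrow> nat \<Rightarrow> real"
  assumes M: "M > 0" and K: "K \<ge> 0"
    and x: "\<And>i j. i < n \<Longrightarrow> j < p \<Longrightarrow> \<bar>x i j\<bar> \<le> K"
    and T: "\<And>u. u \<in> T \<Longrightarrow> l1_norm p u \<le> M"
    and S: "\<And>u. u \<in> T \<Longrightarrow> emp_norm_sq n p x u \<le> S" "S \<ge> 0"
  shows rows_chaining_mean:
      "\<exists>Y. (\<forall>s\<in>Pow {..<n}. \<forall>u\<in>T. \<bar>sign_sum n (\<lambda>i. (inner_vec p (x i) u)\<^sup>2) s\<bar> \<le> Y s) \<and>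
        (\<Sum>s\<in>Pow {..<n}. Y s) \<le> 2 ^ n * (160 * (M * K) * sqrt S * sqrt (real n) * G)"
    and rows_chaining_tail: "t \<ge> 0 \<Longrightarrow>
      real (card {s\<in>Pow {..<n}. \<exists>u\<in>T. \<bar>sign_sum n (\<lambda>i. (inner_vec p (x i) u)\<^sup>2) s\<bar> >
        160 * (M * K) * sqrt S * sqrt (real n) * (G + sqrt t)}) \<le> 2 ^ n * exp (- t)"
proof -
  have *: "(\<exists>Y. (\<forall>s\<in>Pow {..<n}. \<forall>u\<in>T. \<bar>sign_sum n (\<lambda>i. (inner_vec p (x i) u)\<^sup>2) s\<bar> \<le> Y s) \<and>
        (\<Sum>s\<in>Pow {..<n}. Y s) \<le> 2 ^ n * (160 * (M * K) * sqrt S * sqrt (real n) * G)) \<and>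
      (t \<ge> 0 \<longrightarrow> real (card {s\<in>Pow {..<n}. \<exists>u\<in>T. \<bar>sign_sum n (\<lambda>i. (inner_vec p (x i) u)\<^sup>2) s\<bar> >
        160 * (M * K) * sqrt S * sqrt (real n) * (G + sqrt t)}) \<le> 2 ^ n * exp (- t))" for t
  proof (cases "K = 0")
    case True
    \<comment> \<open>The net construction rescales by \<open>M * K\<close>, so vanishing data is
      treated apart.\<close>
    have "inner_vec p (x i) u = 0" if "i < n" for i u
      using x[OF that] by (simp add: inner_vec_def True)
    then have zero: "sign_sum n (\<lambda>i. (inner_vec p (x i) u)\<^sup>2) s = 0" for u s
      by (simp add: sign_sum_def)
    show ?thesis
      unfolding zero True by (auto intro!: exI[of _ "\<lambda>_. 0"])
  next
    case False
    with K have K: "K > 0" by simp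
    have "\<exists>\<pi>. \<forall>k. \<pi> k \<in> T \<rightarrow> T \<and> finite (\<pi> k ` T) \<and>
      real (card (\<pi> k ` T)) \<le> exp (real l * ln (2 * real p + 1) * 4 ^ k) \<and>
      (\<forall>u\<in>T. \<forall>i<n. \<bar>inner_vec p (x i) u - inner_vec p (x i) (\<pi> k u)\<bar> \<le> 8 * (M * K) / 2 ^ k)"
      by (intro choice allI l1_hull_net n p M K x T l)
    then obtain \<pi> where \<pi>0: "\<forall>k. \<pi> k \<in> T \<rightarrow> T \<and> finite (\<pi> k ` T) \<and>
      real (card (\<pi> k ` T)) \<le> exp (real l * ln (2 * real p + 1) * 4 ^ k) \<and>
      (\<forall>u\<in>T. \<forall>i<n. \<bar>inner_vec p (x i) u - inner_vec p (x i) (\<pi> k u)\<bar> \<le> 8 * (M * K) / 2 ^ k)"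
      by (elim exE) (rule that)
    then have \<pi>: "\<And>k u. u \<in> T \<Longrightarrow> \<pi> k u \<in> T" "\<And>k. finite (\<pi> k ` T)"
      "\<And>k. real (card (\<pi> k ` T)) \<le> exp (real l * ln (2 * real p + 1) * 4 ^ k)"
      "\<And>k u i. u \<in> T \<Longrightarrow> i < n \<Longrightarrow>
        \<bar>inner_vec p (x i) u - inner_vec p (x i) (\<pi> k u)\<bar> \<le> 8 * (M * K) / 2 ^ k"
      by (simp_all add: Pi_iff)
    \<comment> \<open>The values are at most \<open>M * K\<close>; the larger bound is used because
      one \<beta> has to serve both for the values and for the net errors. It turns the constant 20
      into 160.\<close>
    have y: "\<bar>inner_vec p (x i) u\<bar> \<le> 8 * (M * K)" if "u \<in> T" "i < n" for u i
    proof -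
      have "\<bar>inner_vec p (x i) u\<bar> \<le> M * K"
        using that K by (intro abs_inner_vec_le x T) auto
      moreover have "0 < M * K" using M K by simp
      ultimately show ?thesis by linarith
    qed
    have R: "(\<Sum>i<n. (inner_vec p (x i) u)\<^sup>2) \<le> real n * (sqrt S)\<^sup>2" if "u \<in> T" for u
      using S(1)[OF that] S(2) n by (simp add: emp_norm_sq_def field_simps)
    have \<beta>: "8 * (M * K) \<ge> 0" "sqrt S \<ge> 0" using M K S by auto
    note hyps = n \<kappa> \<beta>(2) H_ge_1 y \<beta>(1) R \<pi>
    note inst = chaining_mean chaining_tail
    note inst = inst[where y = "\<lambda>i. inner_vec p (x i)" and T = T and \<pi> = \<pi>, OF hyps]
    have eq: "20 * (8 * (M * K)) = 160 * (M * K)" by simp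
    show ?thesis
      unfolding G_def eq[symmetric] by (intro conjI impI inst)
  qed
  show "\<exists>Y. (\<forall>s\<in>Pow {..<n}. \<forall>u\<in>T. \<bar>sign_sum n (\<lambda>i. (inner_vec p (x i) u)\<^sup>2) s\<bar> \<le> Y s) \<and>
        (\<Sum>s\<in>Pow {..<n}. Y s) \<le> 2 ^ n * (160 * (M * K) * sqrt S * sqrt (real n) * G)"
    by (rule *[THEN conjunct1])
  show "t \<ge> 0 \<Longrightarrow>
      real (card {s\<in>Pow {..<n}. \<exists>u\<in>T. \<bar>sign_sum n (\<lambda>i. (inner_vec p (x i) u)\<^sup>2) s\<bar> >
        160 * (M * K) * sqrt S * sqrt (real n) * (G + sqrt t)}) \<le> 2 ^ n * exp (- t)"
    by (rule *[THEN conjunct2, THEN mp])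
qed

end

section \<open>Exchanging rows with their ghosts\<close>

text \<open>The permutation of the \<open>2 * n\<close> rows that exchanges row \<open>i\<close> with its ghost \<open>n + i\<close> for
  \<open>i \<notin> s\<close>.\<close>

definition swap_rows :: "nat \<Rightarrow> nat set \<Rightarrow> nat \<Rightarrow> nat" where
  "swap_rows n s k =
     (if k < n then if k \<in> s then k else n + k else if k - n \<in> s then k else k - n)"

definition emp_diff :: "nat \<Rightarrow> nat \<Rightarrow> (nat \<Rightarrow> nat \<Rightarrow> real) \<Rightarrow> (nat \<Rightarrow> real) \<Rightarrow> real" where
  "emp_diff n p x u = emp_norm_sq n p x u - emp_norm_sq n p (\<lambda>i. x (n + i)) u"

definition emp_sum :: "nat \<Rightarrow> nat \<Rightarrow> (nat \<Rightarrow> nat \<Rightarrow> real) \<Rightarrow> (nat \<Rightarrow> real) \<Rightarrow> real" where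
  "emp_sum n p x u = emp_norm_sq n p x u + emp_norm_sq n p (\<lambda>i. x (n + i)) u"

lemma emp_norm_sq_cong:
  "(\<And>i. i < n \<Longrightarrow> x i = y i) \<Longrightarrow> emp_norm_sq n p x u = emp_norm_sq n p y u"
  by (simp add: emp_norm_sq_def)

lemma emp_norm_sq_nonneg: "emp_norm_sq n p x u \<ge> 0"
  by (simp add: emp_norm_sq_def sum_nonneg)

text \<open>Exchanging a row with its ghost flips the sign of the corresponding difference, so along
  all exchanges the difference of the empirical norms runs through the values of a sign
  process.\<close>

lemma emp_diff_swap_rows:
  "emp_diff n p (\<lambda>i. x (swap_rows n s i)) u =
     (sign_sum n (\<lambda>i. (inner_vec p (x i) u)\<^sup>2) s - sign_sum n (\<lambda>i. (inner_vec p (x (n + i)) u)\<^sup>2) s) / n"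
  unfolding emp_diff_def emp_norm_sq_def sign_sum_diff[symmetric] right_diff_distrib[symmetric]
    sum_subtractf[symmetric]
  by (auto simp: sign_sum_def swap_rows_def intro!: sum.cong)

text \<open>An exchange only permutes the two summands that belong to a row. The bound
  \<open>S\<close> in the chaining can therefore be fixed before the signs are drawn.\<close>

lemma emp_sum_swap_rows:
  "emp_sum n p (\<lambda>i. x (swap_rows n s i)) u = emp_sum n p x u"
  unfolding emp_sum_def emp_norm_sq_def distrib_left[symmetric] sum.distrib[symmetric]
  by (auto simp: swap_rows_def intro!: sum.cong)

lemma swap_rows_involution: "k < 2 * n \<Longrightarrow> swap_rows n s (swap_rows n s k) = k"
  by (auto simp: swap_rows_def)

lemma swap_rows_less: "k < 2 * n \<Longrightarrow> swap_rows n s k < 2 * n"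
  by (auto simp: swap_rows_def)

context chaining_levels
begin

text \<open>Sample rows and ghost rows are chained separately under the common bounds
  \<open>K\<close> and \<open>S\<close>. This accounts for 320 as twice 160 and for the factor 2 in
  the tail.\<close>

lemma
  fixes x :: "nat \<Rightarrow> nat \<Rightarrow> real"
  assumes M: "M > 0" and K: "K \<ge> 0"
    and x: "\<And>i j. i < 2 * n \<Longrightarrow> j < p \<Longrightarrow> \<bar>x i j\<bar> \<le> K"
    and T: "\<And>u. u \<in> T \<Longrightarrow> l1_norm p u \<le> M"
    and S: "\<And>u. u \<in> T \<Longrightarrow> emp_sum n p x u \<le> S" "S \<ge> 0"
  shows swapped_chaining_mean:
      "\<exists>Y. (\<forall>s\<in>Pow {..<n}. \<forall>u\<in>T. \<bar>emp_diff n p (\<lambda>i. x (swap_rows n s i)) u\<bar> \<le> Y s) \<and>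
        (\<Sum>s\<in>Pow {..<n}. Y s) \<le> 2 ^ n * (320 * M * G / sqrt (real n) * (sqrt S * K))"
    and swapped_chaining_tail: "t \<ge> 0 \<Longrightarrow>
      real (card {s\<in>Pow {..<n}. \<exists>u\<in>T. \<bar>emp_diff n p (\<lambda>i. x (swap_rows n s i)) u\<bar> >
        320 * M * (G + sqrt t) / sqrt (real n) * (sqrt S * K)}) \<le> 2 ^ n * (2 * exp (- t))"
proof -
  have S1: "emp_norm_sq n p x u \<le> S" "emp_norm_sq n p (\<lambda>i. x (n + i)) u \<le> S" if "u \<in> T" for u
    using S(1)[OF that] emp_norm_sq_nonneg[of n p x u] emp_norm_sq_nonneg[of n p "\<lambda>i. x (n + i)" u]
    by (auto simp: emp_sum_def)
  define \<xi> \<eta> where "\<xi> u s = sign_sum n (\<lambda>i. (inner_vec p (x i) u)\<^sup>2) s"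
    and "\<eta> u s = sign_sum n (\<lambda>i. (inner_vec p (x (n + i)) u)\<^sup>2) s" for u s
  have diff: "emp_diff n p (\<lambda>i. x (swap_rows n s i)) u = (\<xi> u s - \<eta> u s) / real n" for u s
    by (simp add: emp_diff_swap_rows \<xi>_def \<eta>_def)
  have root: "real n = sqrt (real n) * sqrt (real n)" by simp
  have x1: "\<And>i j. i < n \<Longrightarrow> j < p \<Longrightarrow> \<bar>x i j\<bar> \<le> K" "\<And>i j. i < n \<Longrightarrow> j < p \<Longrightarrow> \<bar>x (n + i) j\<bar> \<le> K"
    using x by auto
  have thr: "(160 * (M * K) * sqrt S * sqrt (real n) * c + 160 * (M * K) * sqrt S * sqrt (real n) * c) / real n
      = 320 * M * c / sqrt (real n) * (sqrt S * K)" for c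
    using n by (subst root) (simp add: field_simps del: real_sqrt_mult_self)
  have "\<exists>Y. (\<forall>s\<in>Pow {..<n}. \<forall>u\<in>T. \<bar>\<xi> u s\<bar> \<le> Y s) \<and>
      (\<Sum>s\<in>Pow {..<n}. Y s) \<le> 2 ^ n * (160 * (M * K) * sqrt S * sqrt (real n) * G)"
    unfolding \<xi>_def by (intro rows_chaining_mean M K x1 T S1 S(2))
  then obtain Y where Y: "\<forall>s\<in>Pow {..<n}. \<forall>u\<in>T. \<bar>\<xi> u s\<bar> \<le> Y s"
      "(\<Sum>s\<in>Pow {..<n}. Y s) \<le> 2 ^ n * (160 * (M * K) * sqrt S * sqrt (real n) * G)"
    by (elim exE conjE) (rule that)
  have "\<exists>Y. (\<forall>s\<in>Pow {..<n}. \<forall>u\<in>T. \<bar>\<eta> u s\<bar> \<le> Y s) \<and>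
      (\<Sum>s\<in>Pow {..<n}. Y s) \<le> 2 ^ n * (160 * (M * K) * sqrt S * sqrt (real n) * G)"
    unfolding \<eta>_def by (intro rows_chaining_mean M K x1 T S1 S(2))
  then obtain Y' where Y': "\<forall>s\<in>Pow {..<n}. \<forall>u\<in>T. \<bar>\<eta> u s\<bar> \<le> Y' s"
      "(\<Sum>s\<in>Pow {..<n}. Y' s) \<le> 2 ^ n * (160 * (M * K) * sqrt S * sqrt (real n) * G)"
    by (elim exE conjE) (rule that)
  show "\<exists>Y. (\<forall>s\<in>Pow {..<n}. \<forall>u\<in>T. \<bar>emp_diff n p (\<lambda>i. x (swap_rows n s i)) u\<bar> \<le> Y s) \<and>
        (\<Sum>s\<in>Pow {..<n}. Y s) \<le> 2 ^ n * (320 * M * G / sqrt (real n) * (sqrt S * K))"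
  proof (intro exI[of _ "\<lambda>s. (Y s + Y' s) / real n"] conjI ballI)
    fix s u assume "s \<in> Pow {..<n}" "u \<in> T"
    then have "\<bar>\<xi> u s - \<eta> u s\<bar> \<le> Y s + Y' s"
      using Y(1)[rule_format, of s u] Y'(1)[rule_format, of s u] by linarith
    then show "\<bar>emp_diff n p (\<lambda>i. x (swap_rows n s i)) u\<bar> \<le> (Y s + Y' s) / real n"
      unfolding diff by (simp add: abs_divide divide_right_mono)
  next
    have "(\<Sum>s\<in>Pow {..<n}. (Y s + Y' s) / real n) =
        ((\<Sum>s\<in>Pow {..<n}. Y s) + (\<Sum>s\<in>Pow {..<n}. Y' s)) / real n"
      by (simp add: sum.distrib flip: sum_divide_distrib)
    also have "\<dots> \<le> 2 ^ n * ((160 * (M * K) * sqrt S * sqrt (real n) * G +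
        160 * (M * K) * sqrt S * sqrt (real n) * G) / real n)"
      unfolding times_divide_eq_right distrib_left
      by (intro divide_right_mono add_mono Y(2) Y'(2)) simp
    finally show "(\<Sum>s\<in>Pow {..<n}. (Y s + Y' s) / real n)
        \<le> 2 ^ n * (320 * M * G / sqrt (real n) * (sqrt S * K))"
      unfolding thr .
  qed
  show "real (card {s\<in>Pow {..<n}. \<exists>u\<in>T. \<bar>emp_diff n p (\<lambda>i. x (swap_rows n s i)) u\<bar> >
        320 * M * (G + sqrt t) / sqrt (real n) * (sqrt S * K)}) \<le> 2 ^ n * (2 * exp (- t))"
    (is "real (card ?B) \<le> _") if t: "t \<ge> 0"
  proof -
    define \<tau> where "\<tau> = 160 * (M * K) * sqrt S * sqrt (real n) * (G + sqrt t)"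
    define B1 B2 where "B1 = {s\<in>Pow {..<n}. \<exists>u\<in>T. \<bar>\<xi> u s\<bar> > \<tau>}"
      and "B2 = {s\<in>Pow {..<n}. \<exists>u\<in>T. \<bar>\<eta> u s\<bar> > \<tau>}"
    have B1: "real (card B1) \<le> 2 ^ n * exp (- t)"
      unfolding B1_def \<tau>_def \<xi>_def by (intro rows_chaining_tail M K x1 T S1 S(2) t)
    have B2: "real (card B2) \<le> 2 ^ n * exp (- t)"
      unfolding B2_def \<tau>_def \<eta>_def by (intro rows_chaining_tail M K x1 T S1 S(2) t)
    have "?B \<subseteq> B1 \<union> B2"
    proof (rule subsetI, rule ccontr)
      fix s assume s: "s \<in> ?B" "s \<notin> B1 \<union> B2"
      then obtain u where u: "u \<in> T" "\<bar>(\<xi> u s - \<eta> u s) / real n\<bar> > (\<tau> + \<tau>) / real n"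
        unfolding diff \<tau>_def thr by auto
      then have "\<bar>\<xi> u s - \<eta> u s\<bar> > \<tau> + \<tau>"
        using n by (simp add: abs_divide divide_less_cancel)
      moreover have "\<bar>\<xi> u s\<bar> \<le> \<tau>" "\<bar>\<eta> u s\<bar> \<le> \<tau>"
        using s u(1) unfolding B1_def B2_def by force+
      ultimately show False by linarith
    qed
    then have "card ?B \<le> card (B1 \<union> B2)"
      by (intro card_mono) (auto simp: B1_def B2_def)
    also have "\<dots> \<le> card B1 + card B2" by (rule card_Un_le)
    finally have "real (card ?B) \<le> real (card B1) + real (card B2)" by simp
    with B1 B2 show ?thesis by simp
  qed
qed

end

section \<open>Maxima of sub-Gaussian variables\<close>

context prob_space
begin

lemma
  assumes [measurable]: "Z \<in> borel_measurable M" and Z: "sub_Gaussian M Z C" and l: "l > 0"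
  shows sub_Gaussian_integrable_exp: "integrable M (\<lambda>x. exp (l * \<bar>Z x\<bar>))"
    and sub_Gaussian_expectation_exp: "expectation (\<lambda>x. exp (l * \<bar>Z x\<bar>)) \<le> 2 * exp (l\<^sup>2 * C\<^sup>2 / 2)"
    and sub_Gaussian_prob_ge: "prob {x\<in>space M. \<bar>Z x\<bar> \<ge> a} \<le> 2 * exp (l\<^sup>2 * C\<^sup>2 / 2 - l * a)"
proof -
  have le: "(\<integral>\<^sup>+ x. ennreal (exp (l * \<bar>Z x\<bar>)) \<partial>M) \<le> ennreal (2 * exp (l\<^sup>2 * C\<^sup>2 / 2))"
    using Z l by (simp add: sub_Gaussian_def)
  show int: "integrable M (\<lambda>x. exp (l * \<bar>Z x\<bar>))"
    by (rule integrableI_bounded) (use le in \<open>auto intro: le_less_trans\<close>)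
  have "ennreal (expectation (\<lambda>x. exp (l * \<bar>Z x\<bar>))) \<le> ennreal (2 * exp (l\<^sup>2 * C\<^sup>2 / 2))"
    using le by (subst (asm) nn_integral_eq_integral[OF int]) auto
  then show mean: "expectation (\<lambda>x. exp (l * \<bar>Z x\<bar>)) \<le> 2 * exp (l\<^sup>2 * C\<^sup>2 / 2)"
    by (subst (asm) ennreal_le_iff) auto
  have "{x\<in>space M. \<bar>Z x\<bar> \<ge> a} = {x\<in>space M. exp (l * a) \<le> exp (l * \<bar>Z x\<bar>)}"
    using l by auto
  then have "prob {x\<in>space M. \<bar>Z x\<bar> \<ge> a} \<le> expectation (\<lambda>x. exp (l * \<bar>Z x\<bar>)) / exp (l * a)"
    using integral_Markov_inequality_measure[OF int sets.top, of "exp (l * a)"] by simp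
  also have "\<dots> \<le> 2 * exp (l\<^sup>2 * C\<^sup>2 / 2) / exp (l * a)"
    by (intro divide_right_mono mean) auto
  finally show "prob {x\<in>space M. \<bar>Z x\<bar> \<ge> a} \<le> 2 * exp (l\<^sup>2 * C\<^sup>2 / 2 - l * a)"
    by (simp add: exp_diff)
qed

lemma sub_Gaussian_zero:
  assumes [measurable]: "Z \<in> borel_measurable M" and Z: "sub_Gaussian M Z 0"
  shows "AE x in M. Z x = 0"
proof -
  have "AE x in M. \<bar>Z x\<bar> < 1 / real (Suc k)" for k
  proof -
    have "prob {x\<in>space M. \<bar>Z x\<bar> \<ge> 1 / real (Suc k)} \<le> 2 * exp (- l)" if "l > 0" for l
      using sub_Gaussian_prob_ge[OF assms, of "l * real (Suc k)" "1 / real (Suc k)"] that by simp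
    then have "eventually (\<lambda>l. prob {x\<in>space M. \<bar>Z x\<bar> \<ge> 1 / real (Suc k)} \<le> 2 * exp (- l)) at_top"
      by (intro eventually_mono[OF eventually_gt_at_top[of 0]])
    moreover have "((\<lambda>l. 2 * exp (- l)) \<longlongrightarrow> 2 * 0) (at_top :: real filter)"
      by (intro tendsto_mult tendsto_const filterlim_compose[OF exp_at_bot] filterlim_uminus_at_bot_at_top)
    ultimately have "prob {x\<in>space M. \<bar>Z x\<bar> \<ge> 1 / real (Suc k)} \<le> 2 * 0"
      by (intro tendsto_lowerbound[where F = at_top]) auto
    then have "prob {x\<in>space M. \<bar>Z x\<bar> \<ge> 1 / real (Suc k)} = 0"
      by (simp add: measure_le_0_iff)
    then have "AE x in M. x \<notin> {x\<in>space M. \<bar>Z x\<bar> \<ge> 1 / real (Suc k)}"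
      by (subst AE_iff_measurable[OF _ refl]) (auto simp: emeasure_eq_measure)
    then show ?thesis by (rule AE_mp) (auto intro!: AE_I2)
  qed
  then have "AE x in M. \<forall>k. \<bar>Z x\<bar> < 1 / real (Suc k)"
    by (simp add: AE_all_countable)
  moreover have "z = 0" if "\<forall>k. \<bar>z\<bar> < 1 / real (Suc k)" for z :: real
  proof (rule ccontr)
    assume "z \<noteq> 0"
    then obtain k where "inverse (real (Suc k)) < \<bar>z\<bar>"
      using reals_Archimedean[of "\<bar>z\<bar>"] by auto
    with that show False by (metis inverse_eq_divide less_asym)
  qed
  ultimately show ?thesis by (auto elim: eventually_mono)
qed

lemma sub_Gaussian_prob_gt:
  assumes [measurable]: "Z \<in> borel_measurable M" and Z: "sub_Gaussian M Z C"
    and C: "C \<ge> 0" and r: "r \<ge> 0"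
  shows "prob {x\<in>space M. \<bar>Z x\<bar> > C * r} \<le> 2 * exp (- (r\<^sup>2 / 2))"
proof -
  consider "C = 0" | "r = 0" | "C > 0" "r > 0" using C r by fastforce
  then show ?thesis
  proof cases
    case 1
    then have "AE x in M. \<not> \<bar>Z x\<bar> > C * r"
      using sub_Gaussian_zero[of Z] assms by auto
    then have "prob {x\<in>space M. \<bar>Z x\<bar> > C * r} = 0"
      by (subst prob_eq_0) auto
    then show ?thesis by simp
  next
    case 2
    then show ?thesis by (simp add: order.trans[OF prob_le_1])
  next
    case 3
    have "prob {x\<in>space M. \<bar>Z x\<bar> > C * r} \<le> prob {x\<in>space M. \<bar>Z x\<bar> \<ge> C * r}"
      by (intro finite_measure_mono) auto
    also have "\<dots> \<le> 2 * exp ((r / C)\<^sup>2 * C\<^sup>2 / 2 - (r / C) * (C * r))"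
      using 3 by (intro sub_Gaussian_prob_ge Z) auto
    also have "(r / C)\<^sup>2 * C\<^sup>2 / 2 - (r / C) * (C * r) = - (r\<^sup>2 / 2)"
      using 3 by (simp add: power_divide power2_eq_square)
    finally show ?thesis .
  qed
qed

context
  fixes Z :: "'i \<Rightarrow> 'a \<Rightarrow> real" and I :: "'i set" and C :: real
  assumes I: "finite I" "I \<noteq> {}" and Z: "\<And>i. i \<in> I \<Longrightarrow> Z i \<in> borel_measurable M"
    "\<And>i. i \<in> I \<Longrightarrow> sub_Gaussian M (Z i) C" and C: "C \<ge> 0"
begin

lemma sub_Gaussian_max_prob_gt:
  assumes t: "t \<ge> 0"
  shows "prob {x\<in>space M. Max ((\<lambda>i. \<bar>Z i x\<bar>) ` I) > C * sqrt (2 * (ln (2 * real (card I)) + t))} \<le> exp (- t)"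
proof -
  have card: "real (card I) \<ge> 1"
    using I by (simp add: Suc_leI card_gt_0_iff)
  define r where "r = sqrt (2 * (ln (2 * real (card I)) + t))"
  have r: "r \<ge> 0" "r\<^sup>2 / 2 = ln (2 * real (card I)) + t"
    using card t by (auto simp: r_def)
  have "{x\<in>space M. Max ((\<lambda>i. \<bar>Z i x\<bar>) ` I) > C * r} = (\<Union>i\<in>I. {x\<in>space M. \<bar>Z i x\<bar> > C * r})"
    using I by (auto simp: Max_gr_iff)
  then have "prob {x\<in>space M. Max ((\<lambda>i. \<bar>Z i x\<bar>) ` I) > C * r}
      \<le> (\<Sum>i\<in>I. prob {x\<in>space M. \<bar>Z i x\<bar> > C * r})"
    using I Z(1) by (auto intro!: finite_measure_subadditive_finite)
  also have "\<dots> \<le> (\<Sum>i\<in>I. 2 * exp (- (r\<^sup>2 / 2)))"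
    using C r by (intro sum_mono sub_Gaussian_prob_gt Z) auto
  also have "\<dots> = 2 * real (card I) * exp (- (r\<^sup>2 / 2))" by simp
  also have "\<dots> = exp (- t)"
    unfolding r(2) minus_add_distrib exp_add using card by (simp add: exp_minus)
  finally show ?thesis unfolding r_def .
qed

text \<open>With \<open>L = ln (2 * card I)\<close>, the square of \<open>l\<close> times the
  maximum is at most \<open>(2 * L)\<^sup>2\<close> up to level \<open>2 * L\<close>, and the excess
  is charged to the exponential sum. That sum has mean at most \<open>exp (2 * L)\<close>, which
  leaves \<open>4 * L\<^sup>2 + 4 * L + 2\<close>, at most \<open>10 * L\<^sup>2\<close>. Two
  indices are required so that \<open>L \<ge> 1\<close>.\<close>

lemma
  assumes card: "card I \<ge> 2"
  shows sub_Gaussian_max_square_integrable: "integrable M (\<lambda>x. (Max ((\<lambda>i. \<bar>Z i x\<bar>) ` I))\<^sup>2)"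
    and sub_Gaussian_max_square:
      "expectation (\<lambda>x. (Max ((\<lambda>i. \<bar>Z i x\<bar>) ` I))\<^sup>2) \<le> 5 * C\<^sup>2 * ln (2 * real (card I))"
proof -
  have [measurable]: "(\<lambda>x. Max ((\<lambda>i. \<bar>Z i x\<bar>) ` I)) \<in> borel_measurable M"
    using I Z(1) by (intro borel_measurable_Max borel_measurable_abs) auto
  have "integrable M (\<lambda>x. (Max ((\<lambda>i. \<bar>Z i x\<bar>) ` I))\<^sup>2) \<and>
      expectation (\<lambda>x. (Max ((\<lambda>i. \<bar>Z i x\<bar>) ` I))\<^sup>2) \<le> 5 * C\<^sup>2 * ln (2 * real (card I))"
  proof (cases "C = 0")
    case True
    have "AE x in M. \<forall>i\<in>I. Z i x = 0"
      using I Z True by (intro AE_finite_allI sub_Gaussian_zero) auto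
    then have ae: "AE x in M. (Max ((\<lambda>i. \<bar>Z i x\<bar>) ` I))\<^sup>2 = 0"
      by (rule AE_mp) (use I in \<open>auto intro!: AE_I2 simp: image_constant_conv cong: image_cong\<close>)
    have "integrable M (\<lambda>x. (Max ((\<lambda>i. \<bar>Z i x\<bar>) ` I))\<^sup>2)"
      by (subst integrable_cong_AE[where g = "\<lambda>_. 0"]) (use ae in auto)
    moreover have "expectation (\<lambda>x. (Max ((\<lambda>i. \<bar>Z i x\<bar>) ` I))\<^sup>2) = expectation (\<lambda>_. 0)"
      by (intro integral_cong_AE ae) auto
    ultimately show ?thesis using True by simp
  next
    case False
    with C have C: "C > 0" by simp
    define L where "L = ln (2 * real (card I))"
    have "exp 1 \<le> (4 :: real)" using exp_le by simp
    then have "exp 1 \<le> 2 * real (card I)" using card by linarith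
    then have L: "L \<ge> 1" unfolding L_def using card by (subst ln_ge_iff) auto
    \<comment> \<open>Makes each exponential moment at most \<open>2 * exp L\<close>; the union over
      \<open>I\<close> contributes the remaining factor, since \<open>2 * card I\<close> equals
      \<open>exp L\<close>.\<close>
    define l where "l = sqrt (2 * L) / C"
    have l: "l > 0" "l\<^sup>2 = 2 * L / C\<^sup>2"
      using L C by (auto simp: l_def power_divide)
    define F where "F x = (C\<^sup>2 / (2 * L)) * ((2 * L)\<^sup>2 + (4 * L + 2) * exp (- (2 * L)) * (\<Sum>i\<in>I. exp (l * \<bar>Z i x\<bar>)))" for x
    have square: "(l * z)\<^sup>2 \<le> (2 * L)\<^sup>2 + (4 * L + 2) * exp (- (2 * L)) * exp (l * z)" if "z \<ge> 0" for z
    proof (cases "l * z \<le> 2 * L")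
      case True
      then have "(l * z)\<^sup>2 \<le> (2 * L)\<^sup>2" using l that by (intro power_mono) auto
      then show ?thesis using L by (simp add: add_increasing2)
    next
      case False
      define h where "h = l * z - 2 * L"
      have h: "h > 0" using False by (simp add: h_def)
      have eh: "h \<le> exp h" "h\<^sup>2 \<le> 2 * exp h"
        using exp_ge_add_one_self[of h] exp_lower_Taylor_quadratic[of h] h
        by (simp_all del: exp_ge_add_one_self)
      have "(l * z)\<^sup>2 = (2 * L)\<^sup>2 + (4 * L) * h + h\<^sup>2"
        by (simp add: h_def power2_eq_square algebra_simps)
      also have "\<dots> \<le> (2 * L)\<^sup>2 + (4 * L) * exp h + 2 * exp h"
        using eh L by (intro add_mono mult_left_mono) auto
      also have "\<dots> = (2 * L)\<^sup>2 + (4 * L + 2) * exp (- (2 * L)) * exp (l * z)"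
        by (simp add: h_def algebra_simps flip: exp_add)
      finally show ?thesis .
    qed
    have le: "(Max ((\<lambda>i. \<bar>Z i x\<bar>) ` I))\<^sup>2 \<le> F x" for x
    proof -
      define z where "z = Max ((\<lambda>i. \<bar>Z i x\<bar>) ` I)"
      have "z \<in> (\<lambda>i. \<bar>Z i x\<bar>) ` I" unfolding z_def using I by (intro Max_in) auto
      then obtain i where i: "i \<in> I" "z = \<bar>Z i x\<bar>" by auto
      have "exp (l * z) \<le> (\<Sum>i\<in>I. exp (l * \<bar>Z i x\<bar>))"
        unfolding i(2) using I i(1) by (intro member_le_sum[where f = "\<lambda>i. exp (l * \<bar>Z i x\<bar>)"]) auto
      then have "(l * z)\<^sup>2 \<le> (2 * L)\<^sup>2 + (4 * L + 2) * exp (- (2 * L)) * (\<Sum>i\<in>I. exp (l * \<bar>Z i x\<bar>))"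
        using L i(2) by (intro order.trans[OF square] add_left_mono mult_left_mono) auto
      then have "(C\<^sup>2 / (2 * L)) * (l * z)\<^sup>2 \<le> F x"
        unfolding F_def using L by (intro mult_left_mono) auto
      then show ?thesis
        using L C by (simp add: z_def power_mult_distrib l(2))
    qed
    have exps: "integrable M (\<lambda>x. exp (l * \<bar>Z i x\<bar>))" "expectation (\<lambda>x. exp (l * \<bar>Z i x\<bar>)) \<le> 2 * exp L"
      if "i \<in> I" for i
      using sub_Gaussian_integrable_exp[OF Z(1,2) l(1), OF that that]
        sub_Gaussian_expectation_exp[OF Z(1,2) l(1), OF that that] C by (auto simp: l(2))
    have F: "integrable M F"
      unfolding F_def using exps(1) by (auto intro!: Bochner_Integration.integrable_sum)
    have int: "integrable M (\<lambda>x. (Max ((\<lambda>i. \<bar>Z i x\<bar>) ` I))\<^sup>2)"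
      by (rule Bochner_Integration.integrable_bound[OF F]) (use le in \<open>auto intro!: AE_I2 intro: order.trans[OF _ abs_ge_self]\<close>)
    have "expectation (\<lambda>x. (Max ((\<lambda>i. \<bar>Z i x\<bar>) ` I))\<^sup>2) \<le> expectation F"
      by (intro integral_mono int F le)
    also have "\<dots> = (C\<^sup>2 / (2 * L)) * ((2 * L)\<^sup>2 + (4 * L + 2) * exp (- (2 * L)) * (\<Sum>i\<in>I. expectation (\<lambda>x. exp (l * \<bar>Z i x\<bar>))))"
      unfolding F_def using exps by (simp add: Bochner_Integration.integral_sum prob_space)
    also have "\<dots> \<le> (C\<^sup>2 / (2 * L)) * ((2 * L)\<^sup>2 + (4 * L + 2) * exp (- (2 * L)) * (\<Sum>i\<in>I. 2 * exp L))"
      using L by (intro mult_left_mono add_left_mono sum_mono exps(2)) auto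
    also have "(\<Sum>i\<in>I. 2 * exp L) = exp (2 * L)"
      using card by (simp add: L_def exp_double power2_eq_square)
    also have "(C\<^sup>2 / (2 * L)) * ((2 * L)\<^sup>2 + (4 * L + 2) * exp (- (2 * L)) * exp (2 * L))
        = (C\<^sup>2 / (2 * L)) * (4 * L\<^sup>2 + 4 * L + 2)"
      by (simp add: mult.assoc power_mult_distrib flip: exp_add)
    also have "\<dots> \<le> (C\<^sup>2 / (2 * L)) * (10 * L\<^sup>2)"
    proof (intro mult_left_mono)
      have "L \<le> L\<^sup>2" using L by (simp add: power2_eq_square)
      then show "4 * L\<^sup>2 + 4 * L + 2 \<le> 10 * L\<^sup>2" using L by linarith
    qed (use L in auto)
    also have "\<dots> = 5 * C\<^sup>2 * L" using L by (simp add: power2_eq_square)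
    finally show ?thesis using int by (simp add: L_def)
  qed
  then show "integrable M (\<lambda>x. (Max ((\<lambda>i. \<bar>Z i x\<bar>) ` I))\<^sup>2)"
    "expectation (\<lambda>x. (Max ((\<lambda>i. \<bar>Z i x\<bar>) ` I))\<^sup>2) \<le> 5 * C\<^sup>2 * ln (2 * real (card I))"
    by blast+
qed

end

end

section \<open>A sample and its ghost\<close>

text \<open>Rows \<open>0, \<dots>, n - 1\<close> are the sample and rows \<open>n, \<dots>, 2 * n - 1\<close> an independent copy of it.\<close>

locale ghost_sample = prob_space \<mu> for \<mu> :: "(nat \<Rightarrow> real) measure" +
  fixes n p :: nat and C M :: real and T :: "(nat \<Rightarrow> real) set"
  assumes n: "n \<ge> 1" and p: "p \<ge> 1" and sets_\<mu>: "sets \<mu> = sets (vec_space p)"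
    and C: "C \<ge> 0" and sub_Gaussian: "\<And>j. j < p \<Longrightarrow> sub_Gaussian \<mu> (\<lambda>x. x j) C"
    and M: "M > 0" and T_countable: "countable T" and T_nonempty: "T \<noteq> {}"
    and T_l1: "\<And>u. u \<in> T \<Longrightarrow> l1_norm p u \<le> M"
    and T_risk: "\<And>u. u \<in> T \<Longrightarrow> (\<integral>x. (inner_vec p x u)\<^sup>2 \<partial>\<mu>) \<le> 1"
begin

abbreviation V :: "(nat \<Rightarrow> nat \<Rightarrow> real) measure" where
  "V \<equiv> PiM {..<2 * n} (\<lambda>_. \<mu>)"

definition risk :: "(nat \<Rightarrow> real) \<Rightarrow> real" where
  "risk u = (\<integral>x. (inner_vec p x u)\<^sup>2 \<partial>\<mu>)"

definition dev :: "(nat \<Rightarrow> nat \<Rightarrow> real) \<Rightarrow> real" where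
  "dev x = (SUP u\<in>T. \<bar>emp_norm_sq n p x u - risk u\<bar>)"

abbreviation ghost_dev :: "(nat \<Rightarrow> nat \<Rightarrow> real) \<Rightarrow> real" where
  "ghost_dev x \<equiv> dev (\<lambda>i. x (n + i))"

definition sym_dev :: "(nat \<Rightarrow> nat \<Rightarrow> real) \<Rightarrow> real" where
  "sym_dev x = (SUP u\<in>T. \<bar>emp_diff n p x u\<bar>)"

text \<open>Unlike the two deviations, this supremum is invariant under exchanges of rows with their
  ghosts, so it may stand inside a bound that is conditional on the signs.\<close>

definition total :: "(nat \<Rightarrow> nat \<Rightarrow> real) \<Rightarrow> real" where
  "total x = (SUP u\<in>T. emp_sum n p x u)"

definition row_max :: "(nat \<Rightarrow> nat \<Rightarrow> real) \<Rightarrow> real" where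
  "row_max x = Max ((\<lambda>(i, j). \<bar>x i j\<bar>) ` ({..<2 * n} \<times> {..<p}))"

sublocale V: product_prob_space "\<lambda>_. \<mu>" "{..<2 * n}"
  by unfold_locales

lemma abs_entry_le: "i < 2 * n \<Longrightarrow> j < p \<Longrightarrow> \<bar>x i j\<bar> \<le> row_max x"
  unfolding row_max_def by (intro Max_ge) (auto simp: image_iff)

lemma row_max_nonneg: "row_max x \<ge> 0"
  using abs_entry_le[of 0 0 x] n p by linarith

lemma abs_inner_row_le: "u \<in> T \<Longrightarrow> i < 2 * n \<Longrightarrow> \<bar>inner_vec p (x i) u\<bar> \<le> M * row_max x"
  by (intro abs_inner_vec_le abs_entry_le T_l1 row_max_nonneg)

lemma inner_row_sq_le: "u \<in> T \<Longrightarrow> i < 2 * n \<Longrightarrow> (inner_vec p (x i) u)\<^sup>2 \<le> (M * row_max x)\<^sup>2"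
  using abs_inner_row_le[of u i x] M row_max_nonneg[of x] by (simp flip: abs_le_square_iff)

lemma emp_norm_sq_le:
  assumes "u \<in> T"
  shows "emp_norm_sq n p x u \<le> (M * row_max x)\<^sup>2"
    and "emp_norm_sq n p (\<lambda>i. x (n + i)) u \<le> (M * row_max x)\<^sup>2"
proof -
  have *: "emp_norm_sq n p (\<lambda>i. x (f i)) u \<le> (M * row_max x)\<^sup>2" if "\<And>i. i < n \<Longrightarrow> f i < 2 * n" for f
  proof -
    have "(\<Sum>i<n. (inner_vec p (x (f i)) u)\<^sup>2) \<le> (\<Sum>i<n. (M * row_max x)\<^sup>2)"
      using assms that by (intro sum_mono inner_row_sq_le) auto
    then show ?thesis using n by (simp add: emp_norm_sq_def divide_le_eq mult.commute)
  qed
  from *[of "\<lambda>i. i"] *[of "\<lambda>i. n + i"]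
  show "emp_norm_sq n p x u \<le> (M * row_max x)\<^sup>2" "emp_norm_sq n p (\<lambda>i. x (n + i)) u \<le> (M * row_max x)\<^sup>2"
    by simp_all
qed

lemma risk_bounds: "u \<in> T \<Longrightarrow> 0 \<le> risk u \<and> risk u \<le> 1"
  unfolding risk_def using T_risk by auto

lemma bdd_dev: "bdd_above ((\<lambda>u. \<bar>emp_norm_sq n p x u - risk u\<bar>) ` T)"
  using emp_norm_sq_le(1)[of _ x] emp_norm_sq_nonneg[of n p x] risk_bounds
  by (intro bdd_aboveI2[of _ _ "(M * row_max x)\<^sup>2 + 1"]) (smt (verit) zero_le_power2)

lemma bdd_total: "bdd_above (emp_sum n p x ` T)"
  unfolding emp_sum_def using emp_norm_sq_le[of _ x]
  by (intro bdd_aboveI2[of _ _ "2 * (M * row_max x)\<^sup>2"]) (smt (verit))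

lemma abs_emp_diff_le: "\<bar>emp_diff n p x u\<bar> \<le> emp_sum n p x u"
  using emp_norm_sq_nonneg[of n p x u] emp_norm_sq_nonneg[of n p "\<lambda>i. x (n + i)" u]
  unfolding emp_diff_def emp_sum_def by linarith

lemma bdd_sym_dev: "bdd_above ((\<lambda>u. \<bar>emp_diff n p x u\<bar>) ` T)"
proof -
  obtain b where "\<And>u. u \<in> T \<Longrightarrow> emp_sum n p x u \<le> b"
    using bdd_total[of x] by (auto simp: bdd_above_def)
  then show ?thesis
    by (intro bdd_aboveI2[of _ _ b] order.trans[OF abs_emp_diff_le])
qed

lemma dev_ge: "u \<in> T \<Longrightarrow> \<bar>emp_norm_sq n p x u - risk u\<bar> \<le> dev x"
  unfolding dev_def by (intro cSUP_upper bdd_dev)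

lemma sym_dev_ge: "u \<in> T \<Longrightarrow> \<bar>emp_diff n p x u\<bar> \<le> sym_dev x"
  unfolding sym_dev_def by (intro cSUP_upper bdd_sym_dev)

lemma total_ge: "u \<in> T \<Longrightarrow> emp_sum n p x u \<le> total x"
  unfolding total_def by (intro cSUP_upper bdd_total)

lemma dev_nonneg: "dev x \<ge> 0"
  using dev_ge[of _ x] T_nonempty by (metis abs_ge_zero ex_in_conv order.trans)

lemma sym_dev_nonneg: "sym_dev x \<ge> 0"
  using sym_dev_ge[of _ x] T_nonempty by (metis abs_ge_zero ex_in_conv order.trans)

lemma total_nonneg: "total x \<ge> 0"
  using total_ge[of _ x] abs_emp_diff_le[of x] T_nonempty by (metis abs_ge_zero ex_in_conv order.trans)

lemma total_le: "total x \<le> 2 + dev x + ghost_dev x"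
proof -
  have "emp_sum n p x u \<le> 2 + dev x + ghost_dev x" if "u \<in> T" for u
    using dev_ge[OF that, of x] dev_ge[OF that, of "\<lambda>i. x (n + i)"] risk_bounds[OF that]
    unfolding emp_sum_def by linarith
  then show ?thesis unfolding total_def by (intro cSUP_least T_nonempty)
qed

lemma dev_le_ghost_dev: "dev x \<le> ghost_dev x + sym_dev x"
  unfolding dev_def[of x]
proof (intro cSUP_least T_nonempty)
  fix u assume u: "u \<in> T"
  show "\<bar>emp_norm_sq n p x u - risk u\<bar> \<le> ghost_dev x + sym_dev x"
    using dev_ge[OF u, of "\<lambda>i. x (n + i)"] sym_dev_ge[OF u, of x] unfolding emp_diff_def by linarith
qed

lemma dev_le_row_max: "dev x \<le> (M * row_max x)\<^sup>2 + 1"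
  unfolding dev_def
proof (intro cSUP_least T_nonempty)
  fix u assume u: "u \<in> T"
  show "\<bar>emp_norm_sq n p x u - risk u\<bar> \<le> (M * row_max x)\<^sup>2 + 1"
    using emp_norm_sq_le(1)[OF u, of x] emp_norm_sq_nonneg[of n p x u] risk_bounds[OF u] by linarith
qed

lemma total_le_row_max: "total x \<le> 2 * (M * row_max x)\<^sup>2"
  unfolding total_def emp_sum_def
proof (intro cSUP_least T_nonempty)
  fix u assume u: "u \<in> T"
  show "emp_norm_sq n p x u + emp_norm_sq n p (\<lambda>i. x (n + i)) u \<le> 2 * (M * row_max x)\<^sup>2"
    using emp_norm_sq_le[OF u, of x] by linarith
qed

lemma sym_dev_le_total: "sym_dev x \<le> total x"
  unfolding sym_dev_def
  by (intro cSUP_least T_nonempty order.trans[OF abs_emp_diff_le] total_ge)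

section \<open>Measurability and integrability of the suprema\<close>

lemma measurable_entry: "j < p \<Longrightarrow> (\<lambda>x. x j) \<in> borel_measurable \<mu>"
  unfolding measurable_cong_sets[OF sets_\<mu> refl] vec_space_def by measurable

lemma measurable_inner_vec: "(\<lambda>x. inner_vec p x u) \<in> borel_measurable \<mu>"
  unfolding inner_vec_def using measurable_entry by measurable

lemma measurable_emp_norm_sq:
  assumes "f \<in> {..<n} \<rightarrow> J"
  shows "(\<lambda>x. emp_norm_sq n p (\<lambda>i. x (f i)) u) \<in> borel_measurable (PiM J (\<lambda>_. \<mu>))"
proof -
  have "(\<lambda>x. inner_vec p (x (f i)) u) \<in> borel_measurable (PiM J (\<lambda>_. \<mu>))" if "i < n" for i
    using assms that by (intro measurable_compose[where f = "\<lambda>x. x (f i)", OF _ measurable_inner_vec]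
      measurable_component_singleton) auto
  then show ?thesis unfolding emp_norm_sq_def by measurable
qed

lemma measurable_dev_reindex:
  assumes "f \<in> {..<n} \<rightarrow> J"
  shows "(\<lambda>x. dev (\<lambda>i. x (f i))) \<in> borel_measurable (PiM J (\<lambda>_. \<mu>))"
  unfolding dev_def using measurable_emp_norm_sq[OF assms]
  by (intro borel_measurable_cSUP T_countable bdd_dev) auto

lemma measurable_dev [measurable]: "dev \<in> borel_measurable V"
  using measurable_dev_reindex[of "\<lambda>i. i" "{..<2 * n}"] by auto

lemma measurable_ghost_dev [measurable]: "ghost_dev \<in> borel_measurable V"
  by (rule measurable_dev_reindex) auto

lemma measurable_emp_norm_sq_V [measurable]:
  "(\<lambda>x. emp_norm_sq n p x u) \<in> borel_measurable V"
  "(\<lambda>x. emp_norm_sq n p (\<lambda>i. x (n + i)) u) \<in> borel_measurable V"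
  using measurable_emp_norm_sq[of "\<lambda>i. i" "{..<2 * n}"] measurable_emp_norm_sq[of "\<lambda>i. n + i" "{..<2 * n}"]
  by auto

lemma measurable_sym_dev [measurable]: "sym_dev \<in> borel_measurable V"
  unfolding sym_dev_def[abs_def] by (intro borel_measurable_cSUP T_countable bdd_sym_dev) (auto simp: emp_diff_def)

lemma measurable_total [measurable]: "total \<in> borel_measurable V"
  unfolding total_def[abs_def] by (intro borel_measurable_cSUP T_countable bdd_total) (auto simp: emp_sum_def)

lemma measurable_entry_V: "i < 2 * n \<Longrightarrow> j < p \<Longrightarrow> (\<lambda>x. x i j) \<in> borel_measurable V"
  by (intro measurable_compose[where f = "\<lambda>x. x i", OF _ measurable_entry] measurable_component_singleton) auto

lemma sub_Gaussian_entry_V: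
  assumes "i < 2 * n" "j < p"
  shows "sub_Gaussian V (\<lambda>x. x i j) C"
  unfolding sub_Gaussian_def
proof (intro allI impI)
  fix l :: real assume l: "l > 0"
  have "(\<integral>\<^sup>+ x. ennreal (exp (l * \<bar>x i j\<bar>)) \<partial>V) = (\<integral>\<^sup>+ x. ennreal (exp (l * \<bar>x j\<bar>)) \<partial>distr V \<mu> (\<lambda>x. x i))"
    using assms measurable_entry by (subst nn_integral_distr) (auto intro!: measurable_component_singleton)
  also have "distr V \<mu> (\<lambda>x. x i) = \<mu>"
    using assms by (intro V.PiM_component) auto
  finally show "(\<integral>\<^sup>+ x. ennreal (exp (l * \<bar>x i j\<bar>)) \<partial>V) \<le> ennreal (2 * exp (l\<^sup>2 * C\<^sup>2 / 2))"
    using sub_Gaussian[OF assms(2)] l by (simp add: sub_Gaussian_def)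
qed

definition log_size :: real where "log_size = ln (4 * real n * real p)"

lemma card_entries: "2 * real (card ({..<2 * n} \<times> {..<p})) = 4 * real n * real p"
  by (simp add: card_cartesian_product)

lemma row_max_prob_gt:
  assumes "t \<ge> 0"
  shows "measure V {x\<in>space V. row_max x > C * sqrt (2 * (log_size + t))} \<le> exp (- t)"
proof -
  have "measure V {x\<in>space V. Max ((\<lambda>i. \<bar>(case i of (i, j) \<Rightarrow> \<lambda>x. x i j) x\<bar>) ` ({..<2 * n} \<times> {..<p})) >
      C * sqrt (2 * (ln (2 * real (card ({..<2 * n} \<times> {..<p}))) + t))} \<le> exp (- t)"
    using n p C assms measurable_entry_V sub_Gaussian_entry_V
    by (intro V.sub_Gaussian_max_prob_gt) (auto simp: lessThan_empty_iff)
  then show ?thesis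
    unfolding card_entries row_max_def log_size_def by (simp add: case_prod_unfold)
qed

lemma row_max_square_integrable: "integrable V (\<lambda>x. (row_max x)\<^sup>2)"
  and row_max_square: "(\<integral>x. (row_max x)\<^sup>2 \<partial>V) \<le> 5 * C\<^sup>2 * log_size"
proof -
  have eq: "row_max = (\<lambda>x. Max ((\<lambda>i. \<bar>(case i of (i, j) \<Rightarrow> \<lambda>x. x i j) x\<bar>) ` ({..<2 * n} \<times> {..<p})))"
    by (simp add: row_max_def[abs_def] case_prod_unfold)
  have "1 \<le> n * p" using n p by (metis mult_le_mono nat_mult_1)
  then have card: "card ({..<2 * n} \<times> {..<p}) \<ge> 2"
    by (simp add: card_cartesian_product)
  show "integrable V (\<lambda>x. (row_max x)\<^sup>2)"
    unfolding eq using n p C card measurable_entry_V sub_Gaussian_entry_V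
    by (intro V.sub_Gaussian_max_square_integrable) (auto simp: lessThan_empty_iff)
  show "(\<integral>x. (row_max x)\<^sup>2 \<partial>V) \<le> 5 * C\<^sup>2 * log_size"
    unfolding eq log_size_def card_entries[symmetric] using n p C card measurable_entry_V sub_Gaussian_entry_V
    by (intro V.sub_Gaussian_max_square) (auto simp: lessThan_empty_iff)
qed

lemma measurable_row_max [measurable]: "row_max \<in> borel_measurable V"
  unfolding row_max_def[abs_def] using measurable_entry_V
  by (intro borel_measurable_Max) auto

text \<open>A common dominating function for \<open>dev\<close>, \<open>sym_dev\<close> and
  \<open>total\<close>.\<close>

lemma integrable_row_max_bound:
  "integrable V (\<lambda>x. a * (M * row_max x)\<^sup>2 + b)"
  using row_max_square_integrable by (simp add: power_mult_distrib V.P.integrable_const)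

lemma integrable_total: "integrable V total"
  by (rule Bochner_Integration.integrable_bound[OF integrable_row_max_bound[of 2 0]])
    (use total_le_row_max total_nonneg in \<open>auto intro!: AE_I2\<close>)

lemma integrable_sym_dev: "integrable V sym_dev"
  by (rule Bochner_Integration.integrable_bound[OF integrable_total])
    (use sym_dev_le_total sym_dev_nonneg total_nonneg in \<open>auto intro!: AE_I2\<close>)

lemma integrable_dev: "integrable V dev"
  by (rule Bochner_Integration.integrable_bound[OF integrable_row_max_bound[of 1 1]])
    (use dev_le_row_max dev_nonneg in \<open>auto intro!: AE_I2 intro: order.trans[OF _ abs_ge_self]\<close>)

section \<open>Invariance of the product law under row exchanges\<close>

definition swapped :: "nat set \<Rightarrow> (nat \<Rightarrow> nat \<Rightarrow> real) \<Rightarrow> nat \<Rightarrow> nat \<Rightarrow> real" where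
  "swapped s x = (\<lambda>k\<in>{..<2 * n}. x (swap_rows n s k))"

text \<open>Permuting i.i.d. coordinates preserves the product measure. The restriction in
  \<open>swapped\<close> keeps the result \<open>undefined\<close> outside the index set, as
  elements of the product space must be.\<close>

lemma distr_swapped: "distr V V (swapped s) = V"
proof -
  have "inj_on (swap_rows n s) {..<2 * n}"
    by (rule inj_on_inverseI[where g = "swap_rows n s"]) (simp add: swap_rows_involution)
  then show ?thesis
    using distr_PiM_reindex[of "{..<2 * n}" "\<lambda>_. \<mu>" "swap_rows n s" "{..<2 * n}"]
    by (simp add: swapped_def[abs_def] swap_rows_less Pi_iff prob_space_axioms)
qed

lemma measurable_swapped [measurable]: "swapped s \<in> measurable V V"
  unfolding swapped_def[abs_def]
  by (intro measurable_restrict measurable_component_singleton) (simp add: swap_rows_less)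

lemma emp_diff_swapped: "emp_diff n p (swapped s x) u = emp_diff n p (\<lambda>i. x (swap_rows n s i)) u"
  unfolding emp_diff_def by (intro arg_cong2[where f = minus] emp_norm_sq_cong) (auto simp: swapped_def)

lemma total_swapped: "total (swapped s x) = total x"
proof -
  have "emp_sum n p (swapped s x) u = emp_sum n p (\<lambda>i. x (swap_rows n s i)) u" for u
    unfolding emp_sum_def by (intro arg_cong2[where f = plus] emp_norm_sq_cong) (auto simp: swapped_def)
  then show ?thesis by (simp add: total_def emp_sum_swap_rows)
qed

lemma row_max_swapped: "row_max (swapped s x) = row_max x"
proof -
  have "(\<lambda>(i, j). \<bar>swapped s x i j\<bar>) ` ({..<2 * n} \<times> {..<p}) = (\<lambda>(i, j). \<bar>x i j\<bar>) ` ({..<2 * n} \<times> {..<p})"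
    (is "?f ` ?A = ?g ` ?A")
  proof (intro set_eqI iffI)
    fix z assume "z \<in> ?f ` ?A"
    then obtain i j where "i < 2 * n" "j < p" "z = \<bar>x (swap_rows n s i) j\<bar>" by (auto simp: swapped_def)
    then show "z \<in> ?g ` ?A" by (intro image_eqI[of _ _ "(swap_rows n s i, j)"]) (auto simp: swap_rows_less)
  next
    fix z assume "z \<in> ?g ` ?A"
    then obtain i j where "i < 2 * n" "j < p" "z = \<bar>x i j\<bar>" by auto
    then show "z \<in> ?f ` ?A"
      by (intro image_eqI[of _ _ "(swap_rows n s i, j)"]) (auto simp: swap_rows_less swapped_def swap_rows_involution)
  qed
  then show ?thesis by (simp add: row_max_def)
qed

text \<open>The empty set exchanges every row with its ghost; hence both deviations have the same
  distribution.\<close>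

lemma dev_swapped_empty: "dev (swapped {} x) = ghost_dev x"
  unfolding dev_def
  by (intro SUP_cong refl arg_cong[where f = abs] arg_cong2[where f = minus] emp_norm_sq_cong)
    (auto simp: swapped_def swap_rows_def)

lemma
  fixes h :: "(nat \<Rightarrow> nat \<Rightarrow> real) \<Rightarrow> real"
  assumes h: "integrable V h"
  shows integrable_swapped: "integrable V (\<lambda>x. h (swapped s x))"
    and integral_swapped: "(\<integral>x. h (swapped s x) \<partial>V) = (\<integral>x. h x \<partial>V)"
proof -
  show "integrable V (\<lambda>x. h (swapped s x))"
    using h integrable_distr_eq[OF measurable_swapped, of h s] by (simp add: distr_swapped)
  show "(\<integral>x. h (swapped s x) \<partial>V) = (\<integral>x. h x \<partial>V)"
    using h integral_distr[OF measurable_swapped, of h s] by (simp add: distr_swapped)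
qed

lemma integral_ghost_dev: "(\<integral>x. ghost_dev x \<partial>V) = (\<integral>x. dev x \<partial>V)"
  and integrable_ghost_dev: "integrable V ghost_dev"
  using integral_swapped[OF integrable_dev, of "{}"] integrable_swapped[OF integrable_dev, of "{}"]
  by (simp_all add: dev_swapped_empty)

text \<open>Each of the \<open>2 ^ n\<close> exchanges preserves \<open>V\<close>, so an integral
  equals the integral of the average over exchanges. A counting bound for each fixed
  \<open>x\<close> then suffices, which replaces conditioning on the rows.\<close>

lemma integral_le_swap_average:
  fixes h b :: "(nat \<Rightarrow> nat \<Rightarrow> real) \<Rightarrow> real"
  assumes h: "integrable V h" and b: "integrable V b"
    and le: "\<And>x. (\<Sum>s\<in>Pow {..<n}. h (swapped s x)) \<le> 2 ^ n * b x"
  shows "(\<integral>x. h x \<partial>V) \<le> (\<integral>x. b x \<partial>V)"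
proof -
  have "2 ^ n * (\<integral>x. h x \<partial>V) = (\<Sum>s\<in>Pow {..<n}. (\<integral>x. h (swapped s x) \<partial>V))"
    by (simp add: integral_swapped[OF h] card_Pow)
  also have "\<dots> = (\<integral>x. (\<Sum>s\<in>Pow {..<n}. h (swapped s x)) \<partial>V)"
    by (intro Bochner_Integration.integral_sum[symmetric] integrable_swapped h)
  also have "\<dots> \<le> (\<integral>x. 2 ^ n * b x \<partial>V)"
    by (intro integral_mono Bochner_Integration.integrable_sum integrable_swapped h integrable_mult_right b le)
  finally show ?thesis by simp
qed

lemma measure_le_swap_average:
  assumes A: "Measurable.pred V A"
    and le: "\<And>x. real (card {s\<in>Pow {..<n}. A (swapped s x)}) \<le> 2 ^ n * c"
  shows "measure V {x\<in>space V. A x} \<le> c"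
proof -
  define h where "h x = (if A x then 1 else 0 :: real)" for x
  have hm: "h \<in> borel_measurable V" unfolding h_def[abs_def] using A by measurable
  have h: "integrable V h"
    by (rule V.P.integrable_const_bound[where B = 1]) (use hm in \<open>auto simp: h_def\<close>)
  have "measure V {x\<in>space V. A x} = (\<integral>x. indicator {x\<in>space V. A x} x \<partial>V)"
    using A by (simp add: pred_def)
  also have "\<dots> = (\<integral>x. h x \<partial>V)"
    by (intro Bochner_Integration.integral_cong) (auto simp: h_def indicator_def)
  also have "\<dots> \<le> (\<integral>x. c \<partial>V)"
  proof (intro integral_le_swap_average h V.P.integrable_const)
    fix x
    have "(\<Sum>s\<in>Pow {..<n}. h (swapped s x)) = real (card {s\<in>Pow {..<n}. A (swapped s x)})"
      by (simp add: h_def sum.If_cases Int_def)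
    with le[of x] show "(\<Sum>s\<in>Pow {..<n}. h (swapped s x)) \<le> 2 ^ n * c" by simp
  qed
  finally show ?thesis by (simp add: V.P.prob_space)
qed

section \<open>Fubini's theorem for sample rows and ghost rows\<close>

lemma rows_split: "{..<n} \<inter> {n..<2 * n} = {}" "{..<n} \<union> {n..<2 * n} = {..<2 * n}"
  by auto

abbreviation glue :: "(nat \<Rightarrow> nat \<Rightarrow> real) \<times> (nat \<Rightarrow> nat \<Rightarrow> real) \<Rightarrow> nat \<Rightarrow> nat \<Rightarrow> real" where
  "glue \<equiv> merge {..<n} {n..<2 * n}"

lemma emp_norm_sq_glue:
  "emp_norm_sq n p (glue (x, y)) u = emp_norm_sq n p x u"
  "emp_norm_sq n p (\<lambda>i. glue (x, y) (n + i)) u = emp_norm_sq n p (\<lambda>i. y (n + i)) u"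
  by (intro emp_norm_sq_cong; simp add: merge_def)+

lemma dev_glue: "dev (glue (x, y)) = dev x" "ghost_dev (glue (x, y)) = ghost_dev y"
  by (simp_all add: dev_def emp_norm_sq_glue)

lemma nn_integral_glue:
  "f \<in> borel_measurable V \<Longrightarrow> (\<integral>\<^sup>+ x. f x \<partial>V) =
     (\<integral>\<^sup>+ x. (\<integral>\<^sup>+ y. f (glue (x, y)) \<partial>PiM {n..<2 * n} (\<lambda>_. \<mu>)) \<partial>PiM {..<n} (\<lambda>_. \<mu>))"
  using V.product_nn_integral_fold[OF rows_split(1), of f] by (simp add: rows_split)

lemma measurable_glue: "x \<in> space (PiM {..<n} (\<lambda>_. \<mu>)) \<Longrightarrow>
    (\<lambda>y. glue (x, y)) \<in> measurable (PiM {n..<2 * n} (\<lambda>_. \<mu>)) V"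
  using measurable_Pair1'[of x "PiM {..<n} (\<lambda>_. \<mu>)" "PiM {n..<2 * n} (\<lambda>_. \<mu>)"]
    measurable_merge[of "{..<n}" "{n..<2 * n}" "\<lambda>_. \<mu>"]
  by (auto simp: rows_split intro: measurable_compose)

lemma integrable_inner_sq: 
  assumes "u \<in> T" shows "integrable \<mu> (\<lambda>x. (inner_vec p x u)\<^sup>2)"
proof -
  have meas: "(\<lambda>x. (inner_vec p x u)\<^sup>2) \<in> borel_measurable \<mu>"
    using measurable_inner_vec by measurable
  have comp: "(\<lambda>x. x 0) \<in> measurable V \<mu>" using n by (intro measurable_component_singleton) auto
  have "integrable V (\<lambda>x. (inner_vec p (x 0) u)\<^sup>2)"
    by (rule Bochner_Integration.integrable_bound[OF integrable_row_max_bound[of 1 0]])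
      (use inner_row_sq_le[OF assms, of 0] n measurable_compose[OF comp meas] in \<open>auto intro!: AE_I2\<close>)
  then have "integrable (distr V \<mu> (\<lambda>x. x 0)) (\<lambda>x. (inner_vec p x u)\<^sup>2)"
    using comp meas by (subst integrable_distr_eq) auto
  moreover have "distr V \<mu> (\<lambda>x. x 0) = \<mu>" using n by (intro V.PiM_component) auto
  ultimately show ?thesis by simp
qed

text \<open>Row 0 has law \<open>\<mu>\<close>. In contrast to the bound 1 on the risk, this one
  leads to a multiple of \<open>M\<^sup>2 * C\<^sup>2\<close>, which is the form needed for a single
  row.\<close>

lemma risk_le_row_max: 
  assumes "u \<in> T" shows "risk u \<le> M\<^sup>2 * (\<integral>x. (row_max x)\<^sup>2 \<partial>V)"
proof -
  have meas: "(\<lambda>x. (inner_vec p x u)\<^sup>2) \<in> borel_measurable \<mu>"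
    using measurable_inner_vec by measurable
  have comp: "(\<lambda>x. x 0) \<in> measurable V \<mu>" using n by (intro measurable_component_singleton) auto
  have d: "distr V \<mu> (\<lambda>x. x 0) = \<mu>" using n by (intro V.PiM_component) auto
  have "risk u = (\<integral>x. (inner_vec p x u)\<^sup>2 \<partial>distr V \<mu> (\<lambda>x. x 0))"
    unfolding d risk_def ..
  also have "\<dots> = (\<integral>x. (inner_vec p (x 0) u)\<^sup>2 \<partial>V)"
    by (rule integral_distr[OF comp meas])
  also have "\<dots> \<le> (\<integral>x. M\<^sup>2 * (row_max x)\<^sup>2 \<partial>V)"
    by (intro integral_mono' integrable_mult_right row_max_square_integrable)
      (use inner_row_sq_le[OF assms, of 0] n in \<open>auto simp: power_mult_distrib\<close>)
  finally show ?thesis by simp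
qed

lemma
  assumes u: "u \<in> T"
  shows integrable_ghost_emp: "integrable (PiM {n..<2 * n} (\<lambda>_. \<mu>)) (\<lambda>y. emp_norm_sq n p (\<lambda>i. y (n + i)) u)"
    and integral_ghost_emp: "(\<integral>y. emp_norm_sq n p (\<lambda>i. y (n + i)) u \<partial>PiM {n..<2 * n} (\<lambda>_. \<mu>)) = risk u"
proof -
  let ?W = "PiM {n..<2 * n} (\<lambda>_. \<mu>)"
  have meas: "(\<lambda>x. (inner_vec p x u)\<^sup>2) \<in> borel_measurable \<mu>"
    using measurable_inner_vec by measurable
  have row: "integrable ?W (\<lambda>y. (inner_vec p (y (n + i)) u)\<^sup>2) \<and>
      (\<integral>y. (inner_vec p (y (n + i)) u)\<^sup>2 \<partial>?W) = risk u" if "i < n" for i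
  proof -
    have comp: "(\<lambda>y. y (n + i)) \<in> measurable ?W \<mu>"
      using that by (intro measurable_component_singleton) auto
    have d: "distr ?W \<mu> (\<lambda>y. y (n + i)) = \<mu>"
      using that prob_space_axioms by (intro distr_PiM_component[where M = "\<lambda>_. \<mu>"]) auto
    show ?thesis
      using integrable_distr_eq[OF comp, of "\<lambda>x. (inner_vec p x u)\<^sup>2"] integral_distr[OF comp meas]
        integrable_inner_sq[OF u] meas
      by (simp add: d risk_def)
  qed
  then show "integrable ?W (\<lambda>y. emp_norm_sq n p (\<lambda>i. y (n + i)) u)"
    unfolding emp_norm_sq_def by (intro integrable_mult_right Bochner_Integration.integrable_sum) auto
  have "(\<integral>y. emp_norm_sq n p (\<lambda>i. y (n + i)) u \<partial>?W) = (1 / real n) * (\<Sum>i<n. risk u)"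
    unfolding emp_norm_sq_def using row by (simp add: Bochner_Integration.integral_sum)
  then show "(\<integral>y. emp_norm_sq n p (\<lambda>i. y (n + i)) u \<partial>?W) = risk u"
    using n by simp
qed

text \<open>Jensen's inequality over the ghost rows.\<close>

lemma integral_dev_le_sym_dev: "(\<integral>x. dev x \<partial>V) \<le> (\<integral>x. sym_dev x \<partial>V)"
proof -
  let ?W = "PiM {n..<2 * n} (\<lambda>_. \<mu>)"
  interpret W: prob_space ?W by (intro prob_space_PiM prob_space_axioms)
  have "(\<integral>\<^sup>+ x. ennreal (dev x) \<partial>V) = (\<integral>\<^sup>+ x. (\<integral>\<^sup>+ y. ennreal (dev (glue (x, y))) \<partial>?W) \<partial>PiM {..<n} (\<lambda>_. \<mu>))"
    by (rule nn_integral_glue) measurable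
  also have "\<dots> = (\<integral>\<^sup>+ x. ennreal (dev x) \<partial>PiM {..<n} (\<lambda>_. \<mu>))"
    by (simp add: dev_glue W.emeasure_space_1)
  also have "\<dots> \<le> (\<integral>\<^sup>+ x. (\<integral>\<^sup>+ y. ennreal (sym_dev (glue (x, y))) \<partial>?W) \<partial>PiM {..<n} (\<lambda>_. \<mu>))"
  proof (rule nn_integral_mono)
    fix x assume x: "x \<in> space (PiM {..<n} (\<lambda>_. \<mu>))"
    have [measurable]: "(\<lambda>y. sym_dev (glue (x, y))) \<in> borel_measurable ?W"
      using measurable_compose[OF measurable_glue[OF x] measurable_sym_dev] .
    show "ennreal (dev x) \<le> (\<integral>\<^sup>+ y. ennreal (sym_dev (glue (x, y))) \<partial>?W)"
    proof (cases "(\<integral>\<^sup>+ y. ennreal (sym_dev (glue (x, y))) \<partial>?W) = \<infinity>")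
      case False
      then have int: "integrable ?W (\<lambda>y. sym_dev (glue (x, y)))"
        by (intro integrableI_nonneg) (auto simp: sym_dev_nonneg less_top)
      have "dev x \<le> (\<integral>y. sym_dev (glue (x, y)) \<partial>?W)"
        unfolding dev_def
      proof (intro cSUP_least T_nonempty)
        fix u assume u: "u \<in> T"
        have "emp_norm_sq n p x u - risk u =
            (\<integral>y. emp_norm_sq n p x u - emp_norm_sq n p (\<lambda>i. y (n + i)) u \<partial>?W)"
          using integrable_ghost_emp[OF u] integral_ghost_emp[OF u]
          by (subst Bochner_Integration.integral_diff) (auto simp: W.prob_space)
        also have "\<bar>\<dots>\<bar> \<le> (\<integral>y. \<bar>emp_norm_sq n p x u - emp_norm_sq n p (\<lambda>i. y (n + i)) u\<bar> \<partial>?W)"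
          by (rule integral_abs_bound)
        also have "\<dots> \<le> (\<integral>y. sym_dev (glue (x, y)) \<partial>?W)"
        proof (intro integral_mono int)
          show "integrable ?W (\<lambda>y. \<bar>emp_norm_sq n p x u - emp_norm_sq n p (\<lambda>i. y (n + i)) u\<bar>)"
            using integrable_ghost_emp[OF u] by (intro integrable_abs Bochner_Integration.integrable_diff) auto
          show "\<bar>emp_norm_sq n p x u - emp_norm_sq n p (\<lambda>i. y (n + i)) u\<bar> \<le> sym_dev (glue (x, y))" for y
            using sym_dev_ge[OF u, of "glue (x, y)"] by (simp add: emp_diff_def emp_norm_sq_glue)
        qed
        finally show "\<bar>emp_norm_sq n p x u - risk u\<bar> \<le> (\<integral>y. sym_dev (glue (x, y)) \<partial>?W)" .
      qed
      then show ?thesis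
        by (subst nn_integral_eq_integral[OF int]) (auto simp: sym_dev_nonneg intro: ennreal_leI)
    qed simp
  qed
  also have "\<dots> = (\<integral>\<^sup>+ x. ennreal (sym_dev x) \<partial>V)"
    by (rule nn_integral_glue[symmetric]) measurable
  finally have "ennreal (\<integral>x. dev x \<partial>V) \<le> ennreal (\<integral>x. sym_dev x \<partial>V)"
    by (subst (asm) (1 2) nn_integral_eq_integral)
      (auto simp: integrable_dev integrable_sym_dev dev_nonneg sym_dev_nonneg)
  then show ?thesis
    by (subst (asm) ennreal_le_iff) (auto intro!: integral_nonneg_AE simp: sym_dev_nonneg)
qed

text \<open>Independence: \<open>dev\<close> reads only the rows below \<open>n\<close> and
  \<open>ghost_dev\<close> only the others. The first factor is already expressed over the
  \<open>n\<close> sample rows, where the result is wanted.\<close>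

lemma measure_dev_and_ghost_dev:
  "measure V {x\<in>space V. dev x > a \<and> ghost_dev x \<le> b} =
     measure (PiM {..<n} (\<lambda>_. \<mu>)) {x\<in>space (PiM {..<n} (\<lambda>_. \<mu>)). dev x > a} *
     measure V {x\<in>space V. ghost_dev x \<le> b}"
proof -
  let ?U = "PiM {..<n} (\<lambda>_. \<mu>)" and ?W = "PiM {n..<2 * n} (\<lambda>_. \<mu>)"
  interpret W: prob_space ?W by (intro prob_space_PiM prob_space_axioms)
  interpret U: prob_space ?U by (intro prob_space_PiM prob_space_axioms)
  define F where "F z = (if dev z > a then 1 else 0 :: ennreal)" for z
  define H where "H z = (if ghost_dev z \<le> b then 1 else 0 :: ennreal)" for z
  have dm [measurable]: "dev \<in> borel_measurable ?U" "ghost_dev \<in> borel_measurable ?W"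
    using measurable_dev_reindex[of "\<lambda>i. i" "{..<n}"] measurable_dev_reindex[of "\<lambda>i. n + i" "{n..<2 * n}"]
    by auto
  have [measurable]: "F \<in> borel_measurable V" "F \<in> borel_measurable ?U" "H \<in> borel_measurable V" "H \<in> borel_measurable ?W"
    unfolding F_def[abs_def] H_def[abs_def] by measurable
  have glueFH: "F (glue (x, y)) = F x" "H (glue (x, y)) = H y" for x y
    by (simp_all add: F_def H_def dev_glue)
  have ghost: "(\<integral>\<^sup>+ z. H z \<partial>V) = (\<integral>\<^sup>+ y. H y \<partial>?W)"
    by (subst nn_integral_glue) (simp_all add: glueFH U.emeasure_space_1)
  have "(\<integral>\<^sup>+ z. F z * H z \<partial>V) = (\<integral>\<^sup>+ x. (\<integral>\<^sup>+ y. F x * H y \<partial>?W) \<partial>?U)"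
    by (subst nn_integral_glue) (simp_all add: glueFH)
  also have "\<dots> = (\<integral>\<^sup>+ x. F x \<partial>?U) * (\<integral>\<^sup>+ z. H z \<partial>V)"
    by (simp add: nn_integral_cmult nn_integral_multc ghost)
  finally have prod: "(\<integral>\<^sup>+ z. F z * H z \<partial>V) = (\<integral>\<^sup>+ x. F x \<partial>?U) * (\<integral>\<^sup>+ z. H z \<partial>V)" .
  have "(\<integral>\<^sup>+ z. F z * H z \<partial>V) = (\<integral>\<^sup>+ z. indicator {x\<in>space V. dev x > a \<and> ghost_dev x \<le> b} z \<partial>V)"
    "(\<integral>\<^sup>+ x. F x \<partial>?U) = (\<integral>\<^sup>+ z. indicator {x\<in>space ?U. dev x > a} z \<partial>?U)"
    "(\<integral>\<^sup>+ z. H z \<partial>V) = (\<integral>\<^sup>+ z. indicator {x\<in>space V. ghost_dev x \<le> b} z \<partial>V)"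
    by (intro nn_integral_cong; auto simp: F_def H_def indicator_def)+
  then have eqs: "(\<integral>\<^sup>+ z. F z * H z \<partial>V) = ennreal (measure V {x\<in>space V. dev x > a \<and> ghost_dev x \<le> b})"
    "(\<integral>\<^sup>+ x. F x \<partial>?U) = ennreal (measure ?U {x\<in>space ?U. dev x > a})"
    "(\<integral>\<^sup>+ z. H z \<partial>V) = ennreal (measure V {x\<in>space V. ghost_dev x \<le> b})"
    by (simp_all add: V.P.emeasure_eq_measure U.emeasure_eq_measure)
  show ?thesis
    using prod unfolding eqs by (simp flip: ennreal_mult)
qed

end

section \<open>The deviation bound\<close>

text \<open>The hypothesis is the weighted arithmetic-geometric form of
  \<open>e \<le> c * sqrt (k * (2 + 2 * e))\<close>. For small \<open>c * sqrt k\<close> the weight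
  \<open>sqrt k\<close> suffices, for large values \<open>1 / (2 * c)\<close>, and for
  \<open>k = 0\<close> a small weight refutes \<open>e > 0\<close>. Linear and quadratic regimes are
  covered by the two terms of the conclusion.\<close>

lemma le_of_self_bounding:
  fixes e c k :: real
  assumes c: "c > 0" and k: "k \<ge> 0" and e: "\<And>a. a > 0 \<Longrightarrow> e \<le> c * (a * (1 + e) + k / (2 * a))"
  shows "e \<le> 3 * (c * sqrt k) + 2 * (c * sqrt k)\<^sup>2"
proof -
  have sq: "(c * sqrt k)\<^sup>2 = c\<^sup>2 * k" using k by (simp add: power_mult_distrib)
  consider "k = 0" | "k > 0" "c * sqrt k \<le> 1 / 2" | "c * sqrt k > 1 / 2" using k by fastforce
  then show ?thesis
  proof cases
    case 1
    show ?thesis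
    proof (rule ccontr)
      assume "\<not> ?thesis"
      then have pos: "e > 0" using 1 by simp
      define a where "a = min (1 / (2 * c)) (e / (4 * c))"
      have a: "a > 0" "c * a \<le> 1 / 2" "c * a \<le> e / 4"
        using pos c by (auto simp: a_def min_def field_simps)
      have "e \<le> c * a + (c * a) * e"
        using e[OF a(1)] 1 by (simp add: algebra_simps)
      also have "\<dots> \<le> e / 4 + (1 / 2) * e"
        using a pos by (intro add_mono mult_right_mono) auto
      finally show False using pos by simp
    qed
  next
    case 2
    have "e \<le> c * (sqrt k * (1 + e) + k / (2 * sqrt k))"
      using 2 by (intro e) auto
    also have "k / (2 * sqrt k) = sqrt k / 2"
      using 2 by (simp add: real_div_sqrt)
    also have "c * (sqrt k * (1 + e) + sqrt k / 2) = 3 / 2 * (c * sqrt k) + (c * sqrt k) * e"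
      by (simp add: field_simps)
    finally have *: "e \<le> 3 / 2 * (c * sqrt k) + (c * sqrt k) * e" .
    have "0 \<le> c * sqrt k" using c k by simp
    have "e \<le> 3 * (c * sqrt k)"
    proof (cases "e \<ge> 0")
      case True
      then have "(c * sqrt k) * e \<le> (1 / 2) * e" using 2 by (intro mult_right_mono)
      with * show ?thesis by simp
    qed (use \<open>0 \<le> c * sqrt k\<close> in linarith)
    then show ?thesis by (simp add: add_increasing2)
  next
    case 3
    have "e \<le> c * (1 / (2 * c) * (1 + e) + k / (2 * (1 / (2 * c))))"
      using c by (intro e) auto
    also have "\<dots> = (1 + e) / 2 + c\<^sup>2 * k"
      using c by (simp add: field_simps power2_eq_square)
    finally have "e \<le> 1 + 2 * (c * sqrt k)\<^sup>2" unfolding sq by (simp add: field_simps)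
    with 3 show ?thesis by simp
  qed
qed

text \<open>Split \<open>sqrt S\<close> as at most \<open>3 / 2 + sqrt (y + g)\<close>, bound
  \<open>d * sqrt (y + g)\<close> by half of \<open>d\<^sup>2 + y + g\<close>, and move the
  resulting \<open>y / 2\<close> to the left.\<close>

lemma le_of_sqrt_self_bounding:
  fixes y g d S :: real
  assumes y: "y \<le> g + d * sqrt S" and S: "S \<le> 2 + y + g" and nonneg: "y \<ge> 0" "g \<ge> 0" "d \<ge> 0"
  shows "y \<le> 3 * g + 3 * d + d\<^sup>2"
proof -
  have "sqrt S \<le> sqrt (2 + (y + g))" using S by simp
  also have "\<dots> \<le> sqrt 2 + sqrt (y + g)" using nonneg by (intro sqrt_add_le_add_sqrt) auto
  also have "sqrt 2 \<le> (3 / 2 :: real)" by (intro real_le_lsqrt) (auto simp: power2_eq_square)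
  finally have "d * sqrt S \<le> d * (3 / 2 + sqrt (y + g))"
    using nonneg by (intro mult_left_mono) auto
  moreover have "2 * (d * sqrt (y + g)) \<le> d\<^sup>2 + (y + g)"
    using sum_squares_bound[of d "sqrt (y + g)"] nonneg by (simp add: mult.assoc)
  ultimately show ?thesis using y by (simp add: algebra_simps)
qed

section \<open>Mean and tail of the deviation through chaining\<close>

locale ghost_chaining = ghost_sample \<mu> n p C M T + chaining_levels n p l \<kappa>
  for \<mu> n p C M T l \<kappa>
begin

lemma log_size_ge_1: "log_size \<ge> 1"
proof -
  have "1 \<le> real n * real p" using n p by (metis mult_le_mono nat_mult_1 of_nat_1 of_nat_le_iff of_nat_mult)
  moreover have "exp 1 \<le> (4 :: real)" using exp_le by simp
  ultimately have "exp 1 \<le> 4 * real n * real p" by linarith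
  then show ?thesis unfolding log_size_def using n p by (subst ln_ge_iff) auto
qed

text \<open>Symmetrisation and chaining bound the mean deviation by a multiple of the mean of
  \<open>sqrt (total x) * row_max x\<close>. A weight \<open>a\<close> that does not depend on
  \<open>x\<close> separates the product, so \<open>total\<close> and the squared maximum integrate
  on their own. Since the mean of \<open>total\<close> is at most \<open>2 + 2 * e\<close>, the
  inequality is self-bounding.\<close>

lemma expected_dev_le:
  defines "d \<equiv> 320 * M * G / sqrt (real n) * sqrt (5 * C\<^sup>2 * log_size)"
  shows "(\<integral>x. dev x \<partial>V) \<le> 3 * d + 2 * d\<^sup>2"
proof -
  define c where "c = 320 * M * G / sqrt (real n)"
  define e where "e = (\<integral>x. dev x \<partial>V)"
  define k where "k = 5 * C\<^sup>2 * log_size"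
  have c: "c > 0" using M n G_ge_1 by (simp add: c_def)
  have k: "k \<ge> 0" using log_size_ge_1 by (simp add: k_def)
  have total: "(\<integral>x. total x \<partial>V) \<le> 2 + 2 * e"
  proof -
    have "(\<integral>x. total x \<partial>V) \<le> (\<integral>x. 2 + dev x + ghost_dev x \<partial>V)"
      using integrable_total integrable_dev integrable_ghost_dev total_le by (intro integral_mono) auto
    also have "\<dots> = 2 + 2 * e"
      using integrable_dev integrable_ghost_dev
      by (simp add: integral_ghost_dev e_def V.P.prob_space)
    finally show ?thesis .
  qed
  have "e \<le> c * (a * (1 + e) + k / (2 * a))" if a: "a > 0" for a
  proof -
    define b where "b x = c * (a / 2 * total x + (row_max x)\<^sup>2 / (2 * a))" for x
    have b: "integrable V b"
      unfolding b_def[abs_def] using integrable_total row_max_square_integrable by auto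
    have "(\<integral>x. sym_dev x \<partial>V) \<le> (\<integral>x. b x \<partial>V)"
    proof (intro integral_le_swap_average integrable_sym_dev b)
      fix x
      have "\<exists>Y. (\<forall>s\<in>Pow {..<n}. \<forall>u\<in>T. \<bar>emp_diff n p (\<lambda>i. x (swap_rows n s i)) u\<bar> \<le> Y s) \<and>
          (\<Sum>s\<in>Pow {..<n}. Y s) \<le> 2 ^ n * (c * (sqrt (total x) * row_max x))"
        unfolding c_def by (intro swapped_chaining_mean M row_max_nonneg abs_entry_le T_l1 total_ge total_nonneg)
      then obtain Y where Y: "\<forall>s\<in>Pow {..<n}. \<forall>u\<in>T. \<bar>emp_diff n p (\<lambda>i. x (swap_rows n s i)) u\<bar> \<le> Y s"
          "(\<Sum>s\<in>Pow {..<n}. Y s) \<le> 2 ^ n * (c * (sqrt (total x) * row_max x))"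
        by (elim exE conjE) (rule that)
      have "(\<Sum>s\<in>Pow {..<n}. sym_dev (swapped s x)) \<le> (\<Sum>s\<in>Pow {..<n}. Y s)"
        unfolding sym_dev_def emp_diff_swapped using Y(1) by (intro sum_mono cSUP_least T_nonempty) auto
      also note Y(2)
      also have "sqrt (total x) * row_max x \<le> a / 2 * total x + (row_max x)\<^sup>2 / (2 * a)"
      proof -
        have "2 * (sqrt (total x) * sqrt a) * (row_max x / sqrt a)
            \<le> (sqrt (total x) * sqrt a)\<^sup>2 + (row_max x / sqrt a)\<^sup>2"
          by (rule sum_squares_bound)
        then have "2 * (sqrt (total x) * row_max x) \<le> total x * a + (row_max x)\<^sup>2 / a"
          using a total_nonneg[of x] by (simp add: power_mult_distrib power_divide)
        then show ?thesis by (simp add: field_simps)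
      qed
      finally show "(\<Sum>s\<in>Pow {..<n}. sym_dev (swapped s x)) \<le> 2 ^ n * b x"
        using c by (simp add: b_def mult_left_mono)
    qed
    also have "\<dots> = c * (a / 2 * (\<integral>x. total x \<partial>V) + (\<integral>x. (row_max x)\<^sup>2 \<partial>V) / (2 * a))"
      unfolding b_def using integrable_total row_max_square_integrable by simp
    also have "\<dots> \<le> c * (a / 2 * (2 + 2 * e) + k / (2 * a))"
      using c a total row_max_square unfolding k_def
      by (intro mult_left_mono add_mono divide_right_mono) auto
    finally have "(\<integral>x. sym_dev x \<partial>V) \<le> c * (a * (1 + e) + k / (2 * a))"
      by (simp add: algebra_simps)
    then show ?thesis using integral_dev_le_sym_dev unfolding e_def by linarith
  qed
  then show ?thesis
    using le_of_self_bounding[OF c k, of e] unfolding d_def c_def e_def k_def by simp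
qed

text \<open>The threshold is random, but \<open>total\<close> and \<open>row_max\<close> do not
  change under exchanges. Along the exchanges of a fixed matrix it is thus a constant, and the
  chaining tail applies.\<close>

lemma sym_dev_prob_gt:
  assumes t: "t \<ge> 0"
  shows "measure V {x\<in>space V. sym_dev x > 320 * M * (G + sqrt t) / sqrt (real n) * (sqrt (total x) * row_max x)}
    \<le> 2 * exp (- t)"
proof (rule measure_le_swap_average)
  fix x
  have "(sym_dev (swapped s x) > 320 * M * (G + sqrt t) / sqrt (real n) * (sqrt (total (swapped s x)) * row_max (swapped s x)))
      = (\<exists>u\<in>T. \<bar>emp_diff n p (\<lambda>i. x (swap_rows n s i)) u\<bar> >
          320 * M * (G + sqrt t) / sqrt (real n) * (sqrt (total x) * row_max x))" for s
    unfolding sym_dev_def less_cSUP_iff[OF T_nonempty bdd_sym_dev] emp_diff_swapped total_swapped row_max_swapped ..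
  then show "real (card {s\<in>Pow {..<n}. sym_dev (swapped s x) >
        320 * M * (G + sqrt t) / sqrt (real n) * (sqrt (total (swapped s x)) * row_max (swapped s x))})
      \<le> 2 ^ n * (2 * exp (- t))"
    by (simp only:) (intro swapped_chaining_tail M row_max_nonneg abs_entry_le T_l1 total_ge total_nonneg t)
qed measurable

lemma ghost_dev_prob_le: "measure V {x\<in>space V. ghost_dev x \<le> 2 * (\<integral>x. dev x \<partial>V)} \<ge> 1 / 2"
proof -
  define e where "e = (\<integral>x. dev x \<partial>V)"
  have e: "e \<ge> 0" unfolding e_def by (simp add: dev_nonneg)
  have "measure V {x\<in>space V. \<not> ghost_dev x \<le> 2 * e} \<le> 1 / 2"
  proof (cases "e = 0")
    \<comment> \<open>Markov's inequality would divide by zero here; a nonnegative function with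
      mean zero vanishes almost everywhere.\<close>
    case True
    have "AE x in V. ghost_dev x = 0"
      using integral_nonneg_eq_0_iff_AE[OF integrable_ghost_dev] True
      by (simp add: integral_ghost_dev e_def dev_nonneg)
    then have "measure V {x\<in>space V. \<not> ghost_dev x \<le> 2 * e} = 0"
      by (subst V.P.prob_eq_0) (auto simp: True)
    then show ?thesis by simp
  next
    case False
    have "measure V {x\<in>space V. \<not> ghost_dev x \<le> 2 * e} \<le> measure V {x\<in>space V. ghost_dev x \<ge> 2 * e}"
      by (intro V.P.finite_measure_mono) auto
    also have "\<dots> \<le> (\<integral>x. ghost_dev x \<partial>V) / (2 * e)"
      using integral_Markov_inequality_measure[OF integrable_ghost_dev sets.top, of "2 * e"] e False
      by (simp add: dev_nonneg)
    also have "\<dots> = 1 / 2" using False by (simp add: integral_ghost_dev e_def)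
    finally show ?thesis .
  qed
  moreover have "measure V {x\<in>space V. \<not> ghost_dev x \<le> 2 * e} = 1 - measure V {x\<in>space V. ghost_dev x \<le> 2 * e}"
    by (intro V.P.prob_neg) measurable
  ultimately show ?thesis unfolding e_def by linarith
qed

text \<open>On the event \<open>ghost_dev x \<le> 2 * e\<close> the deviation is bounded by the
  ghost deviation plus a multiple of \<open>sqrt (total x)\<close>, and the self-bounding inequality
  solves for it. The exceptional sets have measure at most 2 + 1 times \<open>exp (- t)\<close>;
  dividing by the probability 1/2 of the independent ghost event gives 6.\<close>

lemma dev_prob_gt:
  assumes t: "t \<ge> 0"
  defines "R \<equiv> M * C * sqrt ((G\<^sup>2 + t) * (log_size + t) / real n)"
  shows "measure (PiM {..<n} (\<lambda>_. \<mu>))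
      {x\<in>space (PiM {..<n} (\<lambda>_. \<mu>)). dev x > 20480 * R + 13516800 * R\<^sup>2} \<le> 6 * exp (- t)"
proof -
  define e where "e = (\<integral>x. dev x \<partial>V)"
  define c where "c = 320 * M * (G + sqrt t) / sqrt (real n)"
  define r where "r = C * sqrt (2 * (log_size + t))"
  define d where "d = c * r"
  define d0 where "d0 = 320 * M * G / sqrt (real n) * sqrt (5 * C\<^sup>2 * log_size)"
  have c: "c \<ge> 0" using M G_ge_1 t by (simp add: c_def)
  have r: "r \<ge> 0" using C log_size_ge_1 t by (simp add: r_def)
  have d: "d \<ge> 0" using c r by (simp add: d_def)
  have d0: "d0 \<ge> 0" using M G_ge_1 log_size_ge_1 by (simp add: d0_def)
  have e: "e \<ge> 0" unfolding e_def by (simp add: dev_nonneg)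
  have "d0 \<le> 8 / 5 * d"
  proof -
    have "d0\<^sup>2 = (320 * M / sqrt (real n))\<^sup>2 * (G\<^sup>2 * (5 * C\<^sup>2 * log_size))"
      using log_size_ge_1 by (simp add: d0_def power_mult_distrib power_divide)
    \<comment> \<open>64/25 is the square of 8/5, and twice it is 5.12, just above the 5 in the
      second moment of \<open>row_max\<close>.\<close>
    also have "\<dots> \<le> (320 * M / sqrt (real n))\<^sup>2 * ((G + sqrt t)\<^sup>2 * (64 / 25 * C\<^sup>2 * (2 * (log_size + t))))"
    proof (rule mult_left_mono, rule mult_mono)
      show "G\<^sup>2 \<le> (G + sqrt t)\<^sup>2" using G_ge_1 t by (intro power_mono) auto
      have "5 * log_size \<le> 64 / 25 * (2 * (log_size + t))" using log_size_ge_1 t by simp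
      from mult_left_mono[OF this, of "C\<^sup>2"]
      show "5 * C\<^sup>2 * log_size \<le> 64 / 25 * C\<^sup>2 * (2 * (log_size + t))" by (simp add: algebra_simps)
      show "0 \<le> 5 * C\<^sup>2 * log_size" using log_size_ge_1 by simp
    qed (rule zero_le_power2)+
    also have "\<dots> = (8 / 5 * d)\<^sup>2"
      using log_size_ge_1 t by (simp add: d_def c_def r_def power_mult_distrib power_divide)
    finally show ?thesis by (rule power2_le_imp_le) (use d in simp)
  qed
  then have "d0\<^sup>2 \<le> (8 / 5 * d)\<^sup>2" using d0 by (intro power_mono) auto
  then have "d0\<^sup>2 \<le> 64 / 25 * d\<^sup>2" by (simp add: power_mult_distrib power_divide)
  moreover have "e \<le> 3 * d0 + 2 * d0\<^sup>2"
    using expected_dev_le unfolding e_def d0_def .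
  \<comment> \<open>The 6 is three times the ghost bound \<open>2 * e\<close>. The previous facts
    give \<open>6 * e \<le> 28.8 * d + 30.72 * d\<^sup>2\<close>.\<close>
  ultimately have eB: "6 * e + 3 * d + d\<^sup>2 \<le> 32 * d + 33 * d\<^sup>2"
    using \<open>d0 \<le> 8 / 5 * d\<close> d using zero_le_power2[of d] by linarith
  have "d\<^sup>2 \<le> (640 * R)\<^sup>2"
  proof -
    have "(G + sqrt t)\<^sup>2 \<le> 2 * (G\<^sup>2 + t)"
      using sum_squares_bound[of G "sqrt t"] t by (simp add: power2_sum)
    moreover have "d\<^sup>2 = (320 * M * C)\<^sup>2 * ((G + sqrt t)\<^sup>2 * (2 * (log_size + t)) / real n)"
      using log_size_ge_1 t by (simp add: d_def c_def r_def power_mult_distrib power_divide)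
    ultimately have "d\<^sup>2 \<le> (320 * M * C)\<^sup>2 * ((2 * (G\<^sup>2 + t)) * (2 * (log_size + t)) / real n)"
      using log_size_ge_1 t by (auto intro!: mult_left_mono divide_right_mono mult_right_mono)
    also have "\<dots> = (640 * R)\<^sup>2"
      using log_size_ge_1 t by (simp add: R_def power_mult_distrib) (simp add: algebra_simps)
    finally show ?thesis .
  qed
  note d_sq = this
  have "R \<ge> 0" unfolding R_def using M C log_size_ge_1 t by simp
  then have "d \<le> 640 * R" by (intro power2_le_imp_le[OF d_sq]) simp
  moreover have "d\<^sup>2 \<le> 409600 * R\<^sup>2" using d_sq by (simp add: power_mult_distrib)
  \<comment> \<open>20480 is 32 * 640, and 13516800 is 33 * 640^2.\<close>
  ultimately have B: "6 * e + 3 * d + d\<^sup>2 \<le> 20480 * R + 13516800 * R\<^sup>2"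
    using eB by linarith
  define E1 where "E1 = {x\<in>space V. sym_dev x > c * (sqrt (total x) * row_max x)}"
  define E2 where "E2 = {x\<in>space V. row_max x > r}"
  have "{x\<in>space V. dev x > 20480 * R + 13516800 * R\<^sup>2 \<and> ghost_dev x \<le> 2 * e} \<subseteq> E1 \<union> E2"
  proof (rule subsetI, rule ccontr)
    fix x assume x: "x \<in> {x\<in>space V. dev x > 20480 * R + 13516800 * R\<^sup>2 \<and> ghost_dev x \<le> 2 * e}"
      "x \<notin> E1 \<union> E2"
    then have "sym_dev x \<le> c * (sqrt (total x) * row_max x)" "row_max x \<le> r"
      by (auto simp: E1_def E2_def)
    moreover have "c * (sqrt (total x) * row_max x) \<le> c * (sqrt (total x) * r)"
      using c \<open>row_max x \<le> r\<close> total_nonneg[of x] by (intro mult_left_mono) auto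
    ultimately have "dev x \<le> ghost_dev x + d * sqrt (total x)"
      using dev_le_ghost_dev[of x] by (simp add: d_def algebra_simps)
    then have "dev x \<le> 3 * ghost_dev x + 3 * d + d\<^sup>2"
      by (rule le_of_sqrt_self_bounding[OF _ total_le dev_nonneg dev_nonneg d])
    with x(1) B show False by auto
  qed
  then have "measure V {x\<in>space V. dev x > 20480 * R + 13516800 * R\<^sup>2 \<and> ghost_dev x \<le> 2 * e} \<le> measure V (E1 \<union> E2)"
    by (intro V.P.finite_measure_mono) (auto simp: E1_def E2_def)
  also have "\<dots> \<le> measure V E1 + measure V E2"
    by (intro measure_Un_le) (auto simp: E1_def E2_def)
  also have "\<dots> \<le> 2 * exp (- t) + exp (- t)"
    unfolding E1_def E2_def c_def r_def by (intro add_mono sym_dev_prob_gt row_max_prob_gt t)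
  finally have "measure V {x\<in>space V. dev x > 20480 * R + 13516800 * R\<^sup>2 \<and> ghost_dev x \<le> 2 * e} \<le> 3 * exp (- t)"
    by simp
  moreover define q where "q = measure (PiM {..<n} (\<lambda>_. \<mu>))
      {x\<in>space (PiM {..<n} (\<lambda>_. \<mu>)). dev x > 20480 * R + 13516800 * R\<^sup>2}"
  moreover have "q * (1 / 2) \<le> q * measure V {x\<in>space V. ghost_dev x \<le> 2 * e}"
    unfolding e_def using ghost_dev_prob_le by (intro mult_left_mono) (auto simp: q_def)
  ultimately show ?thesis
    unfolding measure_dev_and_ghost_dev by simp
qed

end

section \<open>A direct bound through the largest entry\<close>

context ghost_sample
begin

lemma measure_dev_marginal:
  "measure (PiM {..<n} (\<lambda>_. \<mu>)) {x\<in>space (PiM {..<n} (\<lambda>_. \<mu>)). dev x > a} = measure V {x\<in>space V. dev x > a}"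
proof -
  let ?U = "PiM {..<n} (\<lambda>_. \<mu>)"
  have d: "?U = distr V ?U (\<lambda>x. restrict x {..<n})"
    by (intro V.distr_restrict) auto
  have m: "(\<lambda>x. restrict x {..<n}) \<in> measurable V ?U"
    by (intro measurable_restrict_subset) auto
  have [measurable]: "dev \<in> borel_measurable ?U"
    using measurable_dev_reindex[of "\<lambda>i. i" "{..<n}"] by auto
  have "dev (restrict x {..<n}) = dev x" for x
    unfolding dev_def
    by (intro SUP_cong refl arg_cong[where f = abs] arg_cong2[where f = minus] emp_norm_sq_cong) auto
  then have "(\<lambda>x. restrict x {..<n}) -` {x\<in>space ?U. dev x > a} \<inter> space V = {x\<in>space V. dev x > a}"
    using measurable_space[OF m] by auto
  then show ?thesis
    by (subst d, subst measure_distr[OF m]) simp_all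
qed

text \<open>For a single row the chaining bound would cost an extra factor \<open>ln p\<close>.\<close>

lemma dev_prob_gt_crude:
  assumes t: "t \<ge> 0"
  shows "measure (PiM {..<n} (\<lambda>_. \<mu>))
      {x\<in>space (PiM {..<n} (\<lambda>_. \<mu>)). dev x > M\<^sup>2 * C\<^sup>2 * (7 * (log_size + t))} \<le> exp (- t)"
proof -
  have L: "log_size \<ge> 0"
    unfolding log_size_def using n p
    by (intro ln_ge_zero) (metis mult_le_mono mult_numeral_1_right nat_mult_1 of_nat_1 of_nat_le_iff of_nat_mult
      of_nat_numeral one_le_numeral)
  have "{x\<in>space V. dev x > M\<^sup>2 * C\<^sup>2 * (7 * (log_size + t))} \<subseteq>
      {x\<in>space V. row_max x > C * sqrt (2 * (log_size + t))}"
  proof (rule subsetI, rule ccontr)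
    fix x assume x: "x \<in> {x\<in>space V. dev x > M\<^sup>2 * C\<^sup>2 * (7 * (log_size + t))}"
      "x \<notin> {x\<in>space V. row_max x > C * sqrt (2 * (log_size + t))}"
    then have "row_max x \<le> C * sqrt (2 * (log_size + t))" by auto
    then have "(row_max x)\<^sup>2 \<le> (C * sqrt (2 * (log_size + t)))\<^sup>2"
      using row_max_nonneg by (intro power_mono)
    also have "\<dots> = C\<^sup>2 * (2 * (log_size + t))"
      using L t by (simp add: power_mult_distrib)
    finally have row: "M\<^sup>2 * (row_max x)\<^sup>2 \<le> M\<^sup>2 * (C\<^sup>2 * (2 * (log_size + t)))"
      by (intro mult_left_mono) auto
    have "M\<^sup>2 * (\<integral>x. (row_max x)\<^sup>2 \<partial>V) \<le> M\<^sup>2 * (5 * C\<^sup>2 * log_size)"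
      by (intro mult_left_mono row_max_square) simp
    also have "\<dots> \<le> M\<^sup>2 * (5 * C\<^sup>2 * (log_size + t))"
      using t by (intro mult_left_mono) auto
    finally have risk: "M\<^sup>2 * (\<integral>x. (row_max x)\<^sup>2 \<partial>V) \<le> M\<^sup>2 * (5 * C\<^sup>2 * (log_size + t))" .
    \<comment> \<open>Empirical norm and risk are bounded separately. The tail of
      \<open>row_max\<close> contributes 2 and its second moment 5, hence the 7.\<close>
    have "dev x \<le> M\<^sup>2 * (row_max x)\<^sup>2 + M\<^sup>2 * (\<integral>x. (row_max x)\<^sup>2 \<partial>V)"
      unfolding dev_def
    proof (intro cSUP_least T_nonempty)
      fix u assume u: "u \<in> T"
      have "0 \<le> M\<^sup>2 * (row_max x)\<^sup>2" by simp
      then show "\<bar>emp_norm_sq n p x u - risk u\<bar> \<le> M\<^sup>2 * (row_max x)\<^sup>2 + M\<^sup>2 * (\<integral>x. (row_max x)\<^sup>2 \<partial>V)"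
        using emp_norm_sq_le(1)[OF u, of x] emp_norm_sq_nonneg[of n p x u] risk_bounds[OF u]
          risk_le_row_max[OF u] unfolding power_mult_distrib by linarith
    qed
    also have "\<dots> \<le> M\<^sup>2 * (C\<^sup>2 * (2 * (log_size + t))) + M\<^sup>2 * (5 * C\<^sup>2 * (log_size + t))"
      by (intro add_mono row risk)
    also have "\<dots> = M\<^sup>2 * C\<^sup>2 * (7 * (log_size + t))" by (simp add: algebra_simps)
    finally show False using x(1) by simp
  qed
  then have "measure V {x\<in>space V. dev x > M\<^sup>2 * C\<^sup>2 * (7 * (log_size + t))} \<le>
      measure V {x\<in>space V. row_max x > C * sqrt (2 * (log_size + t))}"
    by (intro V.P.finite_measure_mono) auto
  also have "\<dots> \<le> exp (- t)" by (rule row_max_prob_gt[OF t])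
  finally show ?thesis unfolding measure_dev_marginal .
qed

end

section \<open>Reduction to a countable set of vectors\<close>

text \<open>The sublevel set of a continuous function is closed, so the bound on \<open>T0\<close>
  extends to its closure; boundedness has to be known on \<open>T0\<close> only.\<close>

lemma cSUP_dense:
  fixes f :: "'a::topological_space \<Rightarrow> real"
  assumes "T0 \<subseteq> T" "T \<subseteq> closure T0" "T0 \<noteq> {}" and f: "continuous_on UNIV f" and bdd: "bdd_above (f ` T0)"
  shows "(SUP u\<in>T. f u) = (SUP u\<in>T0. f u)"
proof -
  have "closed {u. f u \<le> (SUP u\<in>T0. f u)}"
    by (intro closed_Collect_le f continuous_on_const)
  then have "closure T0 \<subseteq> {u. f u \<le> (SUP u\<in>T0. f u)}"
    by (intro closure_minimal) (auto intro: cSUP_upper bdd)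
  with assms(2) have le: "f u \<le> (SUP u\<in>T0. f u)" if "u \<in> T" for u using that by auto
  show ?thesis
  proof (rule antisym)
    show "(SUP u\<in>T. f u) \<le> (SUP u\<in>T0. f u)"
      using assms(1,3) by (intro cSUP_least le) auto
    show "(SUP u\<in>T0. f u) \<le> (SUP u\<in>T. f u)"
      using assms(1,3) le by (intro cSUP_subset_mono bdd_aboveI2[where M = "SUP u\<in>T0. f u"]) auto
  qed
qed

lemma Lnorm_two:
  assumes "integrable M (\<lambda>x. (Z x)\<^sup>2)"
  shows "Lnorm M 2 Z = ennreal (sqrt (\<integral>x. (Z x)\<^sup>2 \<partial>M))"
proof -
  have "(\<integral>\<^sup>+ x. ennreal (\<bar>Z x\<bar> powr 2) \<partial>M) = ennreal (\<integral>x. (Z x)\<^sup>2 \<partial>M)"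
    using nn_integral_eq_integral[OF assms] by simp
  then show ?thesis by (simp add: Lnorm_def powr_half_sqrt)
qed

lemma Lnorm_distr:
  assumes "f \<in> measurable M N" "Z \<in> borel_measurable N"
  shows "Lnorm (distr M N f) m Z = Lnorm M m (\<lambda>x. Z (f x))"
  using assms unfolding Lnorm_def by (subst nn_integral_distr) auto

lemma sub_Gaussian_distr:
  assumes "f \<in> measurable M N" "Z \<in> borel_measurable N"
  shows "sub_Gaussian (distr M N f) Z C \<longleftrightarrow> sub_Gaussian M (\<lambda>x. Z (f x)) C"
  using assms unfolding sub_Gaussian_def by (subst nn_integral_distr) auto

lemma (in prob_space) integrable_sub_Gaussian_mult:
  assumes [measurable]: "Y \<in> borel_measurable M" "Z \<in> borel_measurable M"
    and "sub_Gaussian M Y C" "sub_Gaussian M Z C"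
  shows "integrable M (\<lambda>x. Y x * Z x)"
proof (rule Bochner_Integration.integrable_bound)
  show "integrable M (\<lambda>x. exp (1 * \<bar>Y x\<bar>) + exp (1 * \<bar>Z x\<bar>))"
    by (intro Bochner_Integration.integrable_add sub_Gaussian_integrable_exp[where C = C] assms) simp_all
  have sq: "z\<^sup>2 \<le> 2 * exp \<bar>z\<bar>" for z :: real
    using exp_lower_Taylor_quadratic[of "\<bar>z\<bar>"] by simp
  have "\<bar>y * z\<bar> \<le> exp \<bar>y\<bar> + exp \<bar>z\<bar>" for y z :: real
    using sum_squares_bound[of "\<bar>y\<bar>" "\<bar>z\<bar>"] sq[of y] sq[of z] by (simp add: abs_mult)
  then show "AE x in M. norm (Y x * Z x) \<le> norm (exp (1 * \<bar>Y x\<bar>) + exp (1 * \<bar>Z x\<bar>))"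
    by (intro AE_I2) (auto intro: order.trans[OF _ abs_ge_self])
qed measurable

text \<open>The second identity exhibits the risk as a quadratic form in finitely many coordinates
  of \<open>u\<close>. This gives its continuity in the product topology, on which the passage to a
  countable set rests.\<close>

lemma (in prob_space)
  assumes meas: "\<And>j. j < p \<Longrightarrow> (\<lambda>x. Z x j) \<in> borel_measurable M"
    and sub_G: "\<And>j. j < p \<Longrightarrow> sub_Gaussian M (\<lambda>x. Z x j) C"
  shows integrable_inner_vec_sq: "integrable M (\<lambda>x. (inner_vec p (Z x) u)\<^sup>2)"
    and expectation_inner_vec_sq: "expectation (\<lambda>x. (inner_vec p (Z x) u)\<^sup>2) =
      (\<Sum>j<p. \<Sum>k<p. expectation (\<lambda>x. Z x j * Z x k) * (u j * u k))"
proof -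
  have eq: "(inner_vec p (Z x) u)\<^sup>2 = (\<Sum>j<p. \<Sum>k<p. (Z x j * Z x k) * (u j * u k))" for x
    unfolding inner_vec_def power2_eq_square sum_product by (intro sum.cong refl) (simp add: mult_ac)
  have int: "integrable M (\<lambda>x. Z x j * Z x k)" if "j < p" "k < p" for j k
    using that by (intro integrable_sub_Gaussian_mult[where C = C] meas sub_G)
  show "integrable M (\<lambda>x. (inner_vec p (Z x) u)\<^sup>2)"
    unfolding eq using int by (intro Bochner_Integration.integrable_sum integrable_mult_left) auto
  show "expectation (\<lambda>x. (inner_vec p (Z x) u)\<^sup>2) =
      (\<Sum>j<p. \<Sum>k<p. expectation (\<lambda>x. Z x j * Z x k) * (u j * u k))"
  proof -
    have "expectation (\<lambda>x. \<Sum>j<p. \<Sum>k<p. Z x j * Z x k * (u j * u k)) =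
        (\<Sum>j<p. expectation (\<lambda>x. \<Sum>k<p. Z x j * Z x k * (u j * u k)))"
      using int by (intro Bochner_Integration.integral_sum Bochner_Integration.integrable_sum integrable_mult_left) auto
    also have "\<dots> = (\<Sum>j<p. \<Sum>k<p. expectation (\<lambda>x. Z x j * Z x k * (u j * u k)))"
      using int by (intro sum.cong refl Bochner_Integration.integral_sum integrable_mult_left) auto
    finally show ?thesis unfolding eq by simp
  qed
qed

section \<open>Choosing the number of chaining levels\<close>

lemma ln_ge_two_thirds: "n \<ge> 2 \<Longrightarrow> ln (real n) \<ge> 2 / 3"
  by (rule order.trans[OF ln2_ge_two_thirds]) simp

text \<open>Since \<open>ln n\<close> and \<open>ln p\<close> are at least 2/3, they absorb the
  roundings and additive constants: \<open>\<kappa> + 1\<close> and \<open>l\<close> are at most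
  \<open>4 * ln n\<close>, and \<open>ln (2 * p + 1)\<close> is at most \<open>3 * ln p\<close>. The
  product of these constants is 16 * 4 * 3 = 192.\<close>

lemma exists_chaining_levels:
  assumes n: "n \<ge> 2" and p: "p \<ge> 2"
  obtains l \<kappa> :: nat where "chaining_levels n p l \<kappa>"
    "(real \<kappa> + 1)\<^sup>2 * (real l * ln (2 * real p + 1)) \<le> 192 * (ln (real p) * ln (real n) ^ 3)"
proof -
  define l \<kappa> where "l = nat \<lceil>ln (2 * real n)\<rceil>" and "\<kappa> = nat \<lceil>log 4 (real n)\<rceil>"
  have ln_n: "ln (real n) \<ge> 2 / 3" using n by (rule ln_ge_two_thirds)
  have ln2: "ln 2 \<le> (7 / 10 :: real)" using ln2_le_25_over_36 by simp
  note ln2_ge = ln2_ge_two_thirds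
  have ln2n: "ln (2 * real n) = ln 2 + ln (real n)" using n by (simp add: ln_mult)
  have log_pos: "log 4 (real n) \<ge> 0" using n by simp
  have ln4: "ln (4 :: real) = 2 * ln 2" using ln_realpow[of 2 2] by simp
  have "n \<le> 4 ^ \<kappa>"
  proof -
    have "real n = 4 powr log 4 (real n)" using n by simp
    also have "\<dots> \<le> 4 powr real \<kappa>"
      unfolding \<kappa>_def using log_pos by (intro powr_mono real_nat_ceiling_ge) auto
    also have "\<dots> = real (4 ^ \<kappa>)" by (simp add: powr_realpow)
    finally show ?thesis by (simp only: of_nat_le_iff)
  qed
  moreover have l: "ln (2 * real n) \<le> real l" unfolding l_def by (rule real_nat_ceiling_ge)
  moreover have "l \<ge> 1"
  proof -
    have "0 < ln (2 * real n)" using ln_n ln2_ge ln2n by linarith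
    with l show ?thesis by (cases l) auto
  qed
  ultimately have levels: "chaining_levels n p l \<kappa>"
    using n p by unfold_locales auto
  have \<kappa>_le: "real \<kappa> + 1 \<le> 4 * ln (real n)"
  proof -
    have "real \<kappa> \<le> log 4 (real n) + 1" unfolding \<kappa>_def using log_pos by linarith
    moreover have "log 4 (real n) \<le> ln (real n) / (4 / 3)"
      unfolding log_def ln4 using ln2_ge ln_n by (intro divide_left_mono) auto
    ultimately show ?thesis using ln_n by simp
  qed
  have l_le: "real l \<le> 4 * ln (real n)"
  proof -
    have "real l \<le> ln (2 * real n) + 1" unfolding l_def using ln_n ln2_ge ln2n by linarith
    then show ?thesis using ln_n ln2 ln2n by linarith
  qed
  have p_le: "ln (2 * real p + 1) \<le> 3 * ln (real p)"
  proof -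
    have "2 * real p + 1 \<le> real p ^ 3"
    proof -
      have "4 \<le> real p ^ 2" using p power_mono[of 2 "real p" 2] by simp
      then have "4 * real p \<le> real p ^ 2 * real p" by (intro mult_right_mono) auto
      then have "4 * real p \<le> real p ^ 3" by (simp add: power3_eq_cube power2_eq_square)
      then show ?thesis using p by linarith
    qed
    then have "ln (2 * real p + 1) \<le> ln (real p ^ 3)" by (intro ln_mono) auto
    then show ?thesis using p by (simp add: ln_realpow)
  qed
  have "(real \<kappa> + 1)\<^sup>2 * (real l * ln (2 * real p + 1)) \<le> (4 * ln (real n))\<^sup>2 * ((4 * ln (real n)) * (3 * ln (real p)))"
    using \<kappa>_le l_le p_le ln_n by (intro mult_mono power_mono) auto
  also have "\<dots> = 192 * (ln (real p) * ln (real n) ^ 3)"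
    by (simp add: power2_eq_square power3_eq_cube)
  finally show ?thesis using levels that by blast
qed


text \<open>Here \<open>a\<close> dominates the logarithmic size of the matrix and \<open>b\<close>
  the squared chaining factor. For \<open>n \<ge> 2\<close> the chaining tail is used at
  \<open>t + ln 6\<close>. For \<open>n = 1\<close> the factor \<open>b\<close> is just
  \<open>t\<close>, so \<open>t\<close> must be bounded below, and the bound through the largest
  entry is used.\<close>

lemma (in ghost_sample) dev_prob_gt_uniform:
  fixes m t :: real
  assumes p2: "p \<ge> 2" and m: "m > 2" and t: "t > 0" and n_t: "n \<ge> 2 \<or> t > ln 2"
  defines "a \<equiv> 2 * t + 2 * ln (2 * real p) + 2 * m * ln (real n) / (m - 2)"
    and "b \<equiv> ln (real p) * (ln (real n)) ^ 3 + t"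
  shows "measure (PiM {..<n} (\<lambda>_. \<mu>)) {x\<in>space (PiM {..<n} (\<lambda>_. \<mu>)).
      dev x > 4400000000 * (M * C * sqrt (a * b / real n) + M\<^sup>2 * C\<^sup>2 * (a * b / real n))} \<le> exp (- t)"
    (is "measure ?U {x\<in>_. dev x > ?c * ?R} \<le> _")
proof -
  interpret U: prob_space ?U by (intro prob_space_PiM prob_space_axioms)
  have [measurable]: "dev \<in> borel_measurable ?U"
    using measurable_dev_reindex[of "\<lambda>i. i" "{..<n}"] by auto
  have mono: "measure ?U {x\<in>space ?U. dev x > ?c * ?R} \<le> measure ?U {x\<in>space ?U. dev x > r}"
    if "r \<le> ?c * ?R" for r
    using that by (intro U.finite_measure_mono) auto
  have ln_n: "ln (real n) \<ge> 0" using n by simp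
  have ln_p: "ln (real p) \<ge> 2 / 3" by (rule ln_ge_two_thirds[OF p2])
  have ln2: "ln 2 \<le> (7 / 10 :: real)" using ln2_le_25_over_36 by simp
  have ln_2p: "ln (2 * real p) = ln 2 + ln (real p)" using p2 by (simp add: ln_mult)
  have ln_2_p: "ln 2 \<le> ln (real p)" using p2 by simp
  \<comment> \<open>The factor \<open>m / (m - 2)\<close> exceeds 1, so \<open>a\<close> contains at
    least \<open>2 * ln n\<close>.\<close>
  have a: "2 * t + 2 * ln (2 * real p) + 2 * ln (real n) \<le> a"
  proof -
    have "2 * ln (real n) * 1 \<le> 2 * ln (real n) * (m / (m - 2))"
      using ln_n m by (intro mult_left_mono) auto
    then show ?thesis by (simp add: a_def mult_ac)
  qed
  have a0: "a \<ge> 0" using a t ln_n ln_2p ln_p ln2_ge_two_thirds by linarith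
  have b: "t \<le> b" "b \<ge> 0" using ln_n ln_p t by (auto simp: b_def)
  have log_size: "log_size = ln (real n) + ln (2 * real p) + ln 2"
  proof -
    have "log_size = ln (real n * (2 * real p) * 2)"
      unfolding log_size_def by (rule arg_cong[where f = ln]) simp
    moreover have "ln (real n * (2 * real p) * 2) = ln (real n * (2 * real p)) + ln 2"
      "ln (real n * (2 * real p)) = ln (real n) + ln (2 * real p)"
      using n p2 by (intro ln_mult_pos; simp)+
    ultimately show ?thesis by linarith
  qed
  show ?thesis
  proof (cases "n \<ge> 2")
    case True
    define q where "q = ln (real p) * ln (real n) ^ 3"
    obtain l \<kappa> where levels: "chaining_levels n p l \<kappa>"
      and G_sq: "(real \<kappa> + 1)\<^sup>2 * (real l * ln (2 * real p + 1)) \<le> 192 * q"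
      using exists_chaining_levels[OF True p2] unfolding q_def by blast
    interpret chaining_levels n p l \<kappa> by fact
    interpret ghost_chaining \<mu> n p C M T l \<kappa> by unfold_locales
    have G: "G\<^sup>2 \<le> 192 * q"
      using G_sq H_ge_1 by (simp add: G_def power_mult_distrib add.commute)
    have q: "q \<ge> 16 / 81"
    proof -
      have "2 / 3 * (2 / 3) ^ 3 \<le> q"
        unfolding q_def using ln_p ln_ge_two_thirds[OF True] by (intro mult_mono power_mono) auto
      then show ?thesis by (simp add: power3_eq_cube)
    qed
    have ln6: "ln 6 \<le> 3 * ln (2 :: real)"
    proof -
      have "ln 6 \<le> ln (2 ^ 3 :: real)" by simp
      also have "\<dots> = 3 * ln 2" by (subst ln_realpow) auto
      finally show ?thesis .
    qed
    have ln6_pos: "ln 6 \<ge> (0 :: real)" by simp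
    have ln12: "ln 2 + ln 6 \<le> 4 * ln (2 :: real)" using ln6 by simp
    define R where "R = M * C * sqrt ((G\<^sup>2 + (t + ln 6)) * (log_size + (t + ln 6)) / real n)"
    \<comment> \<open>203 = 192 + 11: as \<open>q \<ge> 16 / 81\<close>, the extra
      \<open>11 * q\<close> covers \<open>ln 6\<close>. The product 203 * 3/2 = 304.5 is below 18^2
      = 324.\<close>
    have "(G\<^sup>2 + (t + ln 6)) * (log_size + (t + ln 6)) \<le> (203 * b) * (3 / 2 * a)"
    proof (rule mult_mono)
      show "G\<^sup>2 + (t + ln 6) \<le> 203 * b"
        using G q ln6 ln2 t unfolding b_def q_def[symmetric] by simp
      show "log_size + (t + ln 6) \<le> 3 / 2 * a"
        using a ln12 ln_2p ln_2_p ln_n t unfolding log_size by linarith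
      show "0 \<le> 203 * b" using b by simp
      show "0 \<le> log_size + (t + ln 6)" using log_size_ge_1 t ln6_pos by linarith
    qed
    also have "\<dots> \<le> 18\<^sup>2 * (a * b)"
      using mult_nonneg_nonneg[OF a0 b(2)] by (simp add: mult_ac)
    finally have "(G\<^sup>2 + (t + ln 6)) * (log_size + (t + ln 6)) / real n \<le> 18\<^sup>2 * (a * b) / real n"
      by (intro divide_right_mono) auto
    then have "sqrt ((G\<^sup>2 + (t + ln 6)) * (log_size + (t + ln 6)) / real n) \<le> sqrt (18\<^sup>2 * (a * b / real n))"
      by simp
    also have "\<dots> = 18 * sqrt (a * b / real n)"
      unfolding real_sqrt_mult by simp
    finally have "R \<le> M * C * (18 * sqrt (a * b / real n))"
      unfolding R_def using M C by (intro mult_left_mono) auto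
    moreover define R0 where "R0 = M * C * sqrt (a * b / real n)"
    ultimately have R: "R \<le> 18 * R0" by simp
    have R_pos: "R \<ge> 0" "R0 \<ge> 0"
      unfolding R_def R0_def using M C a0 b log_size_ge_1 t ln6_pos by simp_all
    have "R\<^sup>2 \<le> (18 * R0)\<^sup>2" using R R_pos by (intro power_mono)
    then have R2: "R\<^sup>2 \<le> 324 * R0\<^sup>2" by (simp add: power_mult_distrib)
    have "M\<^sup>2 * C\<^sup>2 * (a * b / real n) = R0\<^sup>2"
      using a0 b by (simp add: R0_def power_mult_distrib)
    then have eq: "?R = R0 + R0\<^sup>2" by (simp only: R0_def)
    \<comment> \<open>The quadratic term decides the constant: 13516800 * 324 is 4379443200.\<close>
    have "20480 * R + 13516800 * R\<^sup>2 \<le> ?c * ?R"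
      unfolding eq distrib_left using R R2 R_pos zero_le_power2[of R0] by linarith
    from mono[OF this] have "measure ?U {x\<in>space ?U. dev x > ?c * ?R} \<le> 6 * exp (- (t + ln 6))"
      using dev_prob_gt[of "t + ln 6"] t ln6_pos unfolding R_def by linarith
    also have "\<dots> = exp (- t)" by (simp add: exp_diff exp_minus)
    finally show ?thesis .
  next
    case False
    with n n_t have n1: "n = 1" and t2: "t > ln 2" by auto
    have t23: "t \<ge> 2 / 3" using t2 ln2_ge_two_thirds by linarith
    have "log_size + t \<le> 2 * a"
      using a ln_2p ln_2_p ln_n t ln2_ge_two_thirds unfolding log_size by linarith
    then have "7 * (log_size + t) \<le> 14 * a" by simp
    \<comment> \<open>The lower bound 2/3 for \<open>t\<close> turns the linear bound
      \<open>14 * a\<close> into a multiple of \<open>a * t\<close>.\<close>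
    also have "\<dots> \<le> 21 * (a * t)"
      using mult_left_mono[OF t23 a0] by simp
    also have "a * t \<le> a * b" using a0 b by (intro mult_left_mono)
    finally have "M\<^sup>2 * C\<^sup>2 * (7 * (log_size + t)) \<le> M\<^sup>2 * C\<^sup>2 * (21 * (a * b))"
      by (intro mult_left_mono) auto
    also have "\<dots> \<le> ?c * ?R"
    proof -
      define w v where "w = M\<^sup>2 * C\<^sup>2 * (a * b)" and "v = M * C * sqrt (a * b)"
      have "w \<ge> 0" "v \<ge> 0"
        unfolding w_def v_def using M C a0 b by simp_all
      moreover have "M\<^sup>2 * C\<^sup>2 * (21 * (a * b)) = 21 * w" "?R = v + w"
        by (simp_all add: w_def v_def n1)
      ultimately show ?thesis by simp
    qed
    finally have "M\<^sup>2 * C\<^sup>2 * (7 * (log_size + t)) \<le> ?c * ?R" .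
    from mono[OF this] show ?thesis
      using dev_prob_gt_crude[of t] t by linarith
  qed
qed

text \<open>Everything is carried over to the law \<open>\<mu>\<close> of \<open>X0\<close> and its
  n-fold product: the supremum is replaced by one over a countable dense set of vectors, and
  independence identifies the joint law of the rows.\<close>

lemma sup_deviation_prob:
  fixes n p :: nat and m Cm C M t :: real
  assumes n: "n \<ge> 1" and p2: "p \<ge> 2" and m: "m > 2" and C: "C \<ge> 0" and M: "M \<ge> 1"
    and P: "prob_space P" and X0: "X0 \<in> measurable P (vec_space p)"
    and Q: "prob_space Q" and iid: "iid_copies n p Q X P X0"
    and sub_G: "\<And>j. j < p \<Longrightarrow> sub_Gaussian P (\<lambda>\<omega>. X0 \<omega> j) C" and t: "t > 0"
  shows "measure Q {\<omega> \<in> space Q.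
            (1 / 4400000000) * sup_deviation n p (\<lambda>i. X i \<omega>) P X0 M
            \<le> M * C * sqrt ((2 * t + 2 * ln (2 * real p) + 2 * m * ln (real n) / (m - 2))
                             * (ln (real p) * (ln (real n)) ^ 3 + t) / real n)
              + M\<^sup>2 * C\<^sup>2 * ((2 * t + 2 * ln (2 * real p) + 2 * m * ln (real n) / (m - 2))
                             * (ln (real p) * (ln (real n)) ^ 3 + t) / real n)
              + Cm\<^sup>2 * (exp (- t * (m - 2) / m) / real n)}
          \<ge> 1 - (1 + real n powr (- (m / (m - 2)))) * exp (- t)" (is "measure Q ?E \<ge> 1 - ?\<delta>")
proof (cases "n \<ge> 2 \<or> t > ln 2")
  case False
  \<comment> \<open>For \<open>n = 1\<close> the power of \<open>n\<close> equals 1, so the allowed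
    failure probability is \<open>2 * exp (- t)\<close>, which is at least 1 when
    \<open>t \<le> ln 2\<close>.\<close>
  then have "n = 1" "t \<le> ln 2" using n by auto
  have "exp (- ln 2) \<le> exp (- t)" using \<open>t \<le> ln 2\<close> by simp
  then have "1 \<le> ?\<delta>" using \<open>n = 1\<close> by (simp add: exp_minus)
  then show ?thesis using measure_nonneg[of Q ?E] by linarith
next
  case True
  interpret P: prob_space P by fact
  interpret Q: prob_space Q by fact
  define \<mu> where "\<mu> = distr P (vec_space p) X0"
  interpret \<mu>: prob_space \<mu> unfolding \<mu>_def by (rule P.prob_space_distr[OF X0])
  have entry: "(\<lambda>x. x j) \<in> borel_measurable (vec_space p)" if "j < p" for j
    using that unfolding vec_space_def by (intro measurable_component_singleton) simp
  have inner: "(\<lambda>x. inner_vec p x u) \<in> borel_measurable (vec_space p)" for u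
    unfolding inner_vec_def using entry by measurable
  have entry_\<mu>: "(\<lambda>x. x j) \<in> borel_measurable \<mu>" if "j < p" for j
    using entry[OF that] by (simp add: \<mu>_def)
  have sub_G_\<mu>: "sub_Gaussian \<mu> (\<lambda>x. x j) C" if "j < p" for j
    using sub_G[OF that] unfolding \<mu>_def sub_Gaussian_distr[OF X0 entry[OF that]] .
  define q where "q u = (\<integral>x. (inner_vec p x u)\<^sup>2 \<partial>\<mu>)" for u
  have q0: "q u \<ge> 0" for u by (simp add: q_def)
  have norm: "Lnorm P 2 (\<lambda>\<omega>. inner_vec p (X0 \<omega>) u) = ennreal (sqrt (q u))" for u
    using Lnorm_distr[OF X0 inner, of 2 u]
      Lnorm_two[OF \<mu>.integrable_inner_vec_sq[where Z = "\<lambda>x. x", OF entry_\<mu> sub_G_\<mu>]]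
    unfolding \<mu>_def[symmetric] q_def by simp
  define T where "T = {u. q u \<le> 1 \<and> l1_norm p u \<le> M}"
  have T: "{u. Lnorm P 2 (\<lambda>\<omega>. inner_vec p (X0 \<omega>) u) \<le> 1 \<and> l1_norm p u \<le> M} = T"
    unfolding T_def norm by (simp add: q0)
  have zero: "(\<lambda>_. 0) \<in> T"
    using M by (simp add: T_def q_def inner_vec_def l1_norm_def)
  \<comment> \<open>Density is in the product topology of functions on \<open>nat\<close>; values
    beyond \<open>p\<close> influence neither the constraints nor the deviation.\<close>
  obtain T0 where T0: "countable T0" "T0 \<subseteq> T" "T \<subseteq> closure T0"
    using separable[of T] .
  have "T0 \<noteq> {}" using zero T0 by auto
  interpret ghost_sample \<mu> n p C M T0
  proof unfold_locales
    show "sets \<mu> = sets (vec_space p)" by (simp add: \<mu>_def)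
    show "(\<integral>x. (inner_vec p x u)\<^sup>2 \<partial>\<mu>) \<le> 1" "l1_norm p u \<le> M" if "u \<in> T0" for u
      using that T0(2) by (auto simp: T_def q_def)
  qed (use n p2 C M T0 \<open>T0 \<noteq> {}\<close> sub_G_\<mu> in auto)
  have risk: "risk u = q u" for u by (simp add: risk_def q_def)
  have dev: "sup_deviation n p A P X0 M = dev A" for A
  proof -
    have coord: "continuous_on UNIV (\<lambda>u::nat \<Rightarrow> real. u j)" for j by simp
    have "q u = (\<Sum>j<p. \<Sum>k<p. \<mu>.expectation (\<lambda>x. x j * x k) * (u j * u k))" for u
      unfolding q_def by (rule \<mu>.expectation_inner_vec_sq[where Z = "\<lambda>x. x", OF entry_\<mu> sub_G_\<mu>])
    then have "q = (\<lambda>u. \<Sum>j<p. \<Sum>k<p. \<mu>.expectation (\<lambda>x. x j * x k) * (u j * u k))" ..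
    then have "continuous_on UNIV q"
      by (simp only:) (intro continuous_intros coord)
    then have "continuous_on UNIV (\<lambda>u. \<bar>emp_norm_sq n p A u - q u\<bar>)"
      unfolding emp_norm_sq_def inner_vec_def by (intro continuous_intros coord)
    then have "(SUP u\<in>T. \<bar>emp_norm_sq n p A u - q u\<bar>) = (SUP u\<in>T0. \<bar>emp_norm_sq n p A u - q u\<bar>)"
      using T0 \<open>T0 \<noteq> {}\<close> bdd_dev[of A] unfolding risk by (intro cSUP_dense)
    then show ?thesis
      unfolding sup_deviation_def T dev_def risk by (simp add: norm q0)
  qed
  define a where "a = 2 * t + 2 * ln (2 * real p) + 2 * m * ln (real n) / (m - 2)"
  define b where "b = ln (real p) * (ln (real n)) ^ 3 + t"
  define c where "c = (4400000000 :: real)"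
  define R where "R = M * C * sqrt (a * b / real n) + M\<^sup>2 * C\<^sup>2 * (a * b / real n)"
  \<comment> \<open>The restricted row map takes values in the product space; \<open>dev\<close>
    reads only rows below \<open>n\<close> and is unaffected.\<close>
  let ?U = "PiM {..<n} (\<lambda>_. \<mu>)" and ?Y = "\<lambda>\<omega>. \<lambda>i\<in>{..<n}. X i \<omega>"
  interpret U: prob_space ?U by (intro prob_space_PiM \<mu>.prob_space_axioms)
  have [measurable]: "dev \<in> borel_measurable ?U"
    using measurable_dev_reindex[of "\<lambda>i. i" "{..<n}"] by auto
  have X: "Q.indep_vars (\<lambda>_. vec_space p) X {..<n}" "\<And>i. i < n \<Longrightarrow> distr Q (vec_space p) (X i) = \<mu>"
    using iid by (auto simp: iid_copies_def \<mu>_def)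
  have X_meas: "X i \<in> measurable Q (vec_space p)" if "i < n" for i
    using X(1) that by (auto simp: Q.indep_vars_def)
  have sets_U: "sets (PiM {..<n} (\<lambda>_. vec_space p)) = sets ?U"
    by (intro sets_PiM_cong) (auto simp: sets_\<mu>)
  have "?Y \<in> measurable Q (PiM {..<n} (\<lambda>_. vec_space p))"
    using X_meas by (intro measurable_restrict) auto
  then have Y: "?Y \<in> measurable Q ?U"
    by (simp add: measurable_cong_sets[OF refl sets_U])
  have "distr Q ?U ?Y = distr Q (PiM {..<n} (\<lambda>_. vec_space p)) ?Y"
    by (intro distr_cong refl sets_U[symmetric])
  also have "\<dots> = PiM {..<n} (\<lambda>i. distr Q (vec_space p) (X i))"
    using X(1) n X_meas by (subst (asm) Q.indep_vars_iff_distr_eq_PiM') (auto simp: lessThan_empty_iff)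
  also have "\<dots> = ?U" using X(2) by (intro PiM_cong) auto
  finally have law: "distr Q ?U ?Y = ?U" .
  have dev_Y: "dev (?Y \<omega>) = dev (\<lambda>i. X i \<omega>)" for \<omega>
    unfolding dev_def
    by (intro SUP_cong refl arg_cong[where f = abs] arg_cong2[where f = minus] emp_norm_sq_cong) auto
  have "measure ?U {x\<in>space ?U. dev x > c * R} \<le> exp (- t)"
    unfolding c_def R_def a_def b_def by (rule dev_prob_gt_uniform[OF p2 m t True])
  then have "1 - exp (- t) \<le> measure ?U {x\<in>space ?U. \<not> dev x > c * R}"
    by (subst U.prob_neg) auto
  also have "\<dots> = measure (distr Q ?U ?Y) {x\<in>space ?U. \<not> dev x > c * R}"
    unfolding law ..
  also have "\<dots> = measure Q (?Y -` {x\<in>space ?U. \<not> dev x > c * R} \<inter> space Q)"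
    by (rule measure_distr[OF Y]) measurable
  also have "?Y -` {x\<in>space ?U. \<not> dev x > c * R} \<inter> space Q = {\<omega>\<in>space Q. dev (\<lambda>i. X i \<omega>) \<le> c * R}"
    using measurable_space[OF Y] by (auto simp: dev_Y)
  also have "measure Q \<dots> \<le> measure Q ?E"
  proof (intro Q.finite_measure_mono)
    have "0 \<le> Cm\<^sup>2 * (exp (- t * (m - 2) / m) / real n)" by simp
    then have "1 / 4400000000 * y \<le> R + Cm\<^sup>2 * (exp (- t * (m - 2) / m) / real n)" if "y \<le> c * R" for y
      using that unfolding c_def by linarith
    then show "{\<omega>\<in>space Q. dev (\<lambda>i. X i \<omega>) \<le> c * R} \<subseteq> ?E"
      unfolding dev a_def[symmetric] b_def[symmetric] R_def[symmetric] by blast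
    have "(\<lambda>\<omega>. dev (\<lambda>i. X i \<omega>)) \<in> borel_measurable Q"
      using measurable_compose[OF Y, of dev borel] by (simp add: dev_Y)
    then show "?E \<in> Q.events"
      unfolding dev by measurable
  qed
  finally have "1 - exp (- t) \<le> measure Q ?E" .
  moreover have "exp (- t) \<le> ?\<delta>" by (simp add: distrib_right)
  ultimately show ?thesis by linarith
qed

theorem theorem7p1:
  "\<exists>c1::real. c1 > 0 \<and>
    (\<forall>(n::nat) (p::nat) (m::real) (Cm::real) (C::real) (M::real)
       (P :: (nat \<Rightarrow> real) measure) (X0 :: (nat \<Rightarrow> real) \<Rightarrow> nat \<Rightarrow> real)
       (Q :: (nat \<Rightarrow> nat \<Rightarrow> real) measure) (X :: nat \<Rightarrow> (nat \<Rightarrow> nat \<Rightarrow> real) \<Rightarrow> nat \<Rightarrow> real).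
       n \<ge> 1 \<longrightarrow> p \<ge> 2 \<longrightarrow> m > 2 \<longrightarrow> C \<ge> 0 \<longrightarrow> M \<ge> 1 \<longrightarrow>
       prob_space P \<longrightarrow> X0 \<in> measurable P (vec_space p) \<longrightarrow>
       prob_space Q \<longrightarrow> iid_copies n p Q X P X0 \<longrightarrow>
       strongly_isotropic P p X0 m Cm \<longrightarrow>
       (\<forall>j<p. sub_Gaussian P (\<lambda>\<omega>. X0 \<omega> j) C) \<longrightarrow>
       (\<forall>t>0.
          measure Q {\<omega> \<in> space Q.
            (1 / c1) * sup_deviation n p (\<lambda>i. X i \<omega>) P X0 M
            \<le> M * C * sqrt ((2 * t + 2 * ln (2 * real p) + 2 * m * ln (real n) / (m - 2))
                             * (ln (real p) * (ln (real n)) ^ 3 + t) / real n)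
              + M\<^sup>2 * C\<^sup>2 * ((2 * t + 2 * ln (2 * real p) + 2 * m * ln (real n) / (m - 2))
                             * (ln (real p) * (ln (real n)) ^ 3 + t) / real n)
              + Cm\<^sup>2 * (exp (- t * (m - 2) / m) / real n)}
          \<ge> 1 - (1 + real n powr (- (m / (m - 2)))) * exp (- t)))"
  by (rule exI[of _ 4400000000], intro conjI allI impI sup_deviation_prob) auto

end
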